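(* Let $\mathsf T$ be a countable discrete abelian group or $\mathsf T=\mathbb R^m$ with $m\in\mathbb N$, let $\alpha\in(0,\infty)^q$, and let $\nu$ be a shift-invariant $\alpha$-multihomogeneous tail measure on $\mathcal C=C(\mathsf T,\mathbb R^q)$. Then, with the power normalisers $b_i(u)=u^{\alpha_i}$, there exists a strictly stationary $\mathcal C$-valued random field $X$ such that $X\in\mathrm{RV}_\Pi(\alpha,\nu)$. If $\nu$ is carried by nonnegative paths, then $X$ can be chosen nonnegative.
   Context: $q\in\mathbb N=\{1,2,\dots\}$. $\mathcal C=C(\mathsf T,\mathbb R^q)$ is the space of continuous functions $f=(f_1,\dots,f_q)$ with the topology of locally uniform convergence and its Borel $\sigma$-field (countable groups, possibly finite, carry the discrete topology). $(K_n)_{n\ge1}$ is an increasing exhaustion of $\mathsf T$ by nonempty compact sets such that every compact subset lies in some $K_n$ (for $\mathsf T=\mathbb R^m$, $K_n=[-n,n]^m$), and $\rho_{n,i}(f)=\sup_{t\in K_n}|f_i(t)|$. $G=(0,\infty)^q$; $(r\odot f)(t)=(r_1f_1(t),\dots,r_qf_q(t))$ for $r\in G$; $u^{-1}=(u_1^{-1},\dots,u_q^{-1})$; $\chi_\alpha(r)=\prod_{i=1}^qr_i^{\alpha_i}$; $D_\Pi=\bigcup_{i=1}^q\{f\in\mathcal C:f_i\equiv0\}$, $\mathcal C_\Pi^\circ=\mathcal C\setminus D_\Pi$. Product windows: $U_{\boldsymbol n,\varepsilon}=\{f\in\mathcal C:\rho_{n_i,i}(f)>\varepsilon_i,\ 1\le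 i\le q\}$, $\boldsymbol n\in\mathbb N^q$, $\varepsilon\in G$. A nonzero Borel measure $\nu$ on $\mathcal C$ is an $\alpha$-multihomogeneous tail measure if $\nu(D_\Pi)=0$; $\nu(U_{\boldsymbol n,\boldsymbol 1})<\infty$ for all $\boldsymbol n\in\mathbb N^q$, where $\boldsymbol1=(1,\dots,1)$; and $\nu(r\odot A)=\chi_\alpha(r)^{-1}\nu(A)$ for all $r\in G$ and Borel $A\subset\mathcal C$. It is shift-invariant if $\nu\circ(B^h)^{-1}=\nu$ for all $h\in\mathsf T$, where $(B^hf)(t)=f(t-h)$. A random field $X$ is strictly stationary if $B^hX$ has the same law as $X$ for every $h\in\mathsf T$. $X\in\mathrm{RV}_\Pi(\alpha,\nu)$ means: $\lim_{u\to\infty}\chi_\alpha(u)\,\mathbb E\{F(u^{-1}\odot X)\}=\int F\,d\nu$ for every bounded continuous $F:\mathcal C\to\mathbb R$ that vanishes outside some product window, where $u\in G$ and $u\to\infty$ means $\min_iu_i\to\infty$, with no restriction on the relative rates (the limit holds along every such sequence). *)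

theory Defs
  imports "HOL-Analysis.Analysis" "HOL-Probability.Probability"
begin

section \<open>The space of continuous functions with locally uniform convergence\<close>

typedef (overloaded) ('a, 'b) cfun = "{f :: 'a::topological_space \<Rightarrow> 'b::metric_space. continuous_on UNIV f}"
  morphisms apply_cfun Cfun
proof -
  have "(\<lambda>_. undefined) \<in> {f :: 'a \<Rightarrow> 'b. continuous_on UNIV f}"
    by simp
  then show ?thesis
    by blast
qed

setup_lifting type_definition_cfun

definition cfun_nbhd ::
    "('a::topological_space, 'b::metric_space) cfun \<Rightarrow> 'a set \<Rightarrow> real \<Rightarrow> ('a, 'b) cfun set" where
  "cfun_nbhd f K e = {g. \<forall>t\<in>K. dist (apply_cfun g t) (apply_cfun f t) < e}"

text \<open>
  The topology of uniform convergence on compact sets; over a locally compact domain this is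
  locally uniform convergence.
\<close>

instantiation cfun :: (topological_space, metric_space) topological_space
begin

definition open_cfun :: "('a, 'b) cfun set \<Rightarrow> bool" where
  "open_cfun S \<longleftrightarrow> (\<forall>f\<in>S. \<exists>K e. compact K \<and> e > 0 \<and> cfun_nbhd f K e \<subseteq> S)"

instance
proof
  show "open (UNIV :: ('a, 'b) cfun set)"
    unfolding open_cfun_def by (intro ballI exI[of _ "{}"] exI[of _ "1::real"]) simp
next
  fix S T :: "('a, 'b) cfun set"
  assume S: "open S" and T: "open T"
  show "open (S \<inter> T)"
    unfolding open_cfun_def
  proof
    fix f assume f: "f \<in> S \<inter> T"
    obtain K d where K: "compact K" "d > 0" "cfun_nbhd f K d \<subseteq> S"
      using S f unfolding open_cfun_def by blast
    obtain L e where L: "compact L" "e > 0" "cfun_nbhd f L e \<subseteq> T"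
      using T f unfolding open_cfun_def by blast
    have "cfun_nbhd f (K \<union> L) (min d e) \<subseteq> cfun_nbhd f K d \<inter> cfun_nbhd f L e"
      unfolding cfun_nbhd_def by auto
    then have "cfun_nbhd f (K \<union> L) (min d e) \<subseteq> S \<inter> T"
      using K L by blast
    moreover have "compact (K \<union> L)" "min d e > 0"
      using K L by (simp_all add: compact_Un)
    ultimately show "\<exists>K e. compact K \<and> e > 0 \<and> cfun_nbhd f K e \<subseteq> S \<inter> T"
      by blast
  qed
next
  fix \<S> :: "('a, 'b) cfun set set"
  assume \<S>: "\<forall>S\<in>\<S>. open S"
  show "open (\<Union>\<S>)"
    unfolding open_cfun_def
  proof
    fix f assume "f \<in> \<Union>\<S>"
    then obtain S where S: "S \<in> \<S>" "f \<in> S"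
      by blast
    then have "open S"
      using \<S> by blast
    then obtain K e where "compact K" "e > 0" "cfun_nbhd f K e \<subseteq> S"
      using S unfolding open_cfun_def by blast
    with S(1) show "\<exists>K e. compact K \<and> e > 0 \<and> cfun_nbhd f K e \<subseteq> \<Union>\<S>"
      by blast
  qed
qed

end

lift_definition shift :: "'a::topological_ab_group_add \<Rightarrow> ('a, 'b::metric_space) cfun \<Rightarrow> ('a, 'b) cfun"
  is "\<lambda>h f t. f (t - h)"
proof -
  fix h :: 'a and f :: "'a \<Rightarrow> 'b"
  assume "continuous_on UNIV f"
  moreover have "continuous_on UNIV (\<lambda>t::'a. t - h)"
    by (intro continuous_on_diff continuous_on_id continuous_on_const)
  ultimately show "continuous_on UNIV (\<lambda>t. f (t - h))"
    by (rule continuous_on_compose2) simp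
qed

lift_definition scale :: "real^'q \<Rightarrow> ('a::topological_space, real^'q) cfun \<Rightarrow> ('a, real^'q) cfun"
    (infixr "\<odot>" 75)
  is "\<lambda>r f t. \<chi> i. r $ i * f t $ i"
  by (intro continuous_intros)


section \<open>Product windows and tail measures\<close>

definition posG :: "(real^'q) set" where
  "posG = {r. \<forall>i. 0 < r $ i}"

definition vinverse :: "real^'q \<Rightarrow> real^'q" where
  "vinverse u = (\<chi> i. inverse (u $ i))"

definition chi :: "real^'q \<Rightarrow> real^'q \<Rightarrow> real" where
  "chi \<alpha> r = (\<Prod>i\<in>UNIV. (r $ i) powr (\<alpha> $ i))"

text \<open>Indices run over the positive naturals; the set \<open>K 0\<close> is never used.\<close>

definition compact_exhaustion :: "(nat \<Rightarrow> 'a::topological_space set) \<Rightarrow> bool" where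
  "compact_exhaustion K \<longleftrightarrow>
     (\<forall>n\<ge>1. compact (K n) \<and> K n \<noteq> {} \<and> K n \<subseteq> K (Suc n)) \<and>
     (\<Union>n\<in>{1..}. K n) = UNIV \<and>
     (\<forall>C. compact C \<longrightarrow> (\<exists>n\<ge>1. C \<subseteq> K n))"

definition cube :: "nat \<Rightarrow> (real^'m) set" where
  "cube n = {t. \<forall>j. - real n \<le> t $ j \<and> t $ j \<le> real n}"

definition rho :: "(nat \<Rightarrow> 'a set) \<Rightarrow> nat \<Rightarrow> 'q \<Rightarrow> ('a::topological_space, real^'q) cfun \<Rightarrow> real" where
  "rho K n i f = (SUP t\<in>K n. \<bar>apply_cfun f t $ i\<bar>)"

definition window ::
    "(nat \<Rightarrow> 'a set) \<Rightarrow> nat^'q \<Rightarrow> real^'q \<Rightarrow> ('a::topological_space, real^'q) cfun set" where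
  "window K n \<epsilon> = {f. \<forall>i. rho K (n $ i) i f > \<epsilon> $ i}"

definition D_Pi :: "('a::topological_space, real^'q) cfun set" where
  "D_Pi = (\<Union>i. {f. \<forall>t. apply_cfun f t $ i = 0})"

definition multihomogeneous_tail_measure ::
    "(nat \<Rightarrow> 'a set) \<Rightarrow> real^'q \<Rightarrow> ('a::topological_space, real^'q) cfun measure \<Rightarrow> bool" where
  "multihomogeneous_tail_measure K \<alpha> \<nu> \<longleftrightarrow>
     sets \<nu> = sets borel \<and>
     emeasure \<nu> UNIV \<noteq> 0 \<and>
     emeasure \<nu> D_Pi = 0 \<and>
     (\<forall>n. (\<forall>i. 1 \<le> n $ i) \<longrightarrow> emeasure \<nu> (window K n 1) < \<infinity>) \<and>
     (\<forall>r\<in>posG. \<forall>A\<in>sets borel.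
        emeasure \<nu> ((\<lambda>f. r \<odot> f) ` A) = ennreal (inverse (chi \<alpha> r)) * emeasure \<nu> A)"

definition shift_invariant :: "('a::topological_ab_group_add, real^'q) cfun measure \<Rightarrow> bool" where
  "shift_invariant \<nu> \<longleftrightarrow> (\<forall>h. distr \<nu> borel (shift h) = \<nu>)"

definition nonnegative_path :: "('a::topological_space, real^'q) cfun \<Rightarrow> bool" where
  "nonnegative_path f \<longleftrightarrow> (\<forall>t i. 0 \<le> apply_cfun f t $ i)"


section \<open>Random fields and regular variation\<close>

definition random_field ::
    "'w measure \<Rightarrow> ('w \<Rightarrow> ('a::topological_space, real^'q) cfun) \<Rightarrow> bool" where
  "random_field M X \<longleftrightarrow> prob_space M \<and> X \<in> M \<rightarrow>\<^sub>M borel"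

definition strictly_stationary ::
    "'w measure \<Rightarrow> ('w \<Rightarrow> ('a::topological_ab_group_add, real^'q) cfun) \<Rightarrow> bool" where
  "strictly_stationary M X \<longleftrightarrow>
     (\<forall>h. distr M borel (\<lambda>\<omega>. shift h (X \<omega>)) = distr M borel X)"

text \<open>
  The filter of \<open>u \<rightarrow> \<infinity>\<close> inside \<open>posG\<close> in the sense that the smallest coordinate tends to infinity;
  the relative rates of the coordinates are unrestricted.
\<close>

definition at_top_min :: "(real^'q) filter" where
  "at_top_min = inf (filtercomap (\<lambda>u. MIN i. u $ i) at_top) (principal posG)"

definition RV_Pi ::
    "(nat \<Rightarrow> 'a set) \<Rightarrow> real^'q \<Rightarrow> ('a::topological_space, real^'q) cfun measure \<Rightarrow>
     'w measure \<Rightarrow> ('w \<Rightarrow> ('a, real^'q) cfun) \<Rightarrow> bool" where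
  "RV_Pi K \<alpha> \<nu> M X \<longleftrightarrow>
     (\<forall>F :: ('a, real^'q) cfun \<Rightarrow> real.
        continuous_on UNIV F \<and> bounded (range F) \<and>
        (\<exists>n \<epsilon>. (\<forall>i. 1 \<le> n $ i) \<and> \<epsilon> \<in> posG \<and> (\<forall>f. f \<notin> window K n \<epsilon> \<longrightarrow> F f = 0)) \<longrightarrow>
        ((\<lambda>u. chi \<alpha> u * (\<integral>\<omega>. F (vinverse u \<odot> X \<omega>) \<partial>M)) \<longlongrightarrow> (\<integral>f. F f \<partial>\<nu>)) at_top_min)"

end

theory Submission
  imports Defs
begin

text \<open>
  Write \<open>e\<^sup>y\<close> for the vector with entries \<open>exp (y $ i)\<close>. The field is a mixture over levels \<open>k\<close> of
  \<open>e\<^sup>y \<odot> Y\<^sub>k\<close>, where \<open>Y\<^sub>k\<close> is a bounded stationary field and \<open>y\<close> has density proportional to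
  \<open>exp (- (\<alpha> \<bullet> y))\<close> times a slowly varying weight. Because the scale factor is common to all points
  of \<open>Y\<^sub>k\<close>, the unrestricted rates of \<open>u\<close> are absorbed by a translation of \<open>y\<close>, and it remains to
  approximate \<open>\<nu>\<close> by the measures that \<open>Y\<^sub>k\<close> generates when smeared with the full density.

  The field \<open>Y\<^sub>k\<close> is the pointwise supremum, for positive and negative parts separately, over a
  Poisson process with intensity \<open>\<delta>\<^sub>k \<nu>\<close> of paths that are clamped to height \<open>exp L\<^sub>k\<close> and discarded at
  the time \<open>t\<close> unless every component exceeds 1 somewhere on \<open>t + K k\<close>. Void probabilities show that
  it is stationary. For tiny \<open>\<delta>\<^sub>k\<close> two points are never seen in one window; for a single point,
  homogeneity of \<open>\<nu>\<close> turns the smearing into an average over logarithmic scales in a cube of side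
  \<open>L\<^sub>k\<close>, on most of which clamping and discarding are invisible.

  The nonnegative version replaces the field by its absolute value.
\<close>

section \<open>Borel sets of the path space\<close>

text \<open>Homogeneity holds in each component separately. For q \<ge> 2 a set that restricts only
  one component is unchanged by rescaling another one, so its \<nu>-mass is 0 or \<infinity>. Only
  joint conditions such as product windows have finite mass, and superposing all points of \<nu>
  need not be locally finite; this forces the rule that discards a path wherever one of its
  components is not visible.

  Sizes of paths are read on a logarithmic scale in units of L: for 0 < v $ i < 1 the paths e^(L v)
  g grow beyond the threshold 1 and stay far below exp L, so both truncations disappear as L grows.
  The volume L^q of the cube of such scales is the normaliser; what lies outside the cube must be of
  smaller order.

  One level only approximates \<nu>, hence the mixture. After translation by z = ln u the weight of
  a level is taken at y + z. It depends on the smallest coordinate only, which is all that u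
  \<rightarrow> \<infinity> controls, and varies so slowly that it can be evaluated at z. What
  remains is an average of the level integrals with weights that sum to 1 and leave every fixed
  level.\<close>

lemma continuous_apply_cfun: "continuous_on UNIV (apply_cfun f)"
  using apply_cfun[of f] by simp

lemma cfun_eqI: "(\<And>t. apply_cfun f t = apply_cfun g t) \<Longrightarrow> f = g"
  by (metis apply_cfun_inject ext)

lemma open_cfun_nbhdD:
  assumes "open S" "f \<in> S"
  obtains K e where "compact K" "e > 0" "cfun_nbhd f K e \<subseteq> S"
  using assms unfolding open_cfun_def by blast

lemma continuous_on_evaluation [continuous_intros]:
  "continuous_on A (\<lambda>f::('a::topological_space, 'b::metric_space) cfun. apply_cfun f t)"
proof -
  have "open {f. apply_cfun f t \<in> V}" if "open V" for V :: "'b set"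
    unfolding open_cfun_def
  proof safe
    fix f :: "('a, 'b) cfun" assume "apply_cfun f t \<in> V"
    with that obtain e where "e > 0" "\<And>y. dist y (apply_cfun f t) < e \<Longrightarrow> y \<in> V"
      unfolding open_dist by blast
    then show "\<exists>K e. compact K \<and> 0 < e \<and> cfun_nbhd f K e \<subseteq> {f. apply_cfun f t \<in> V}"
      by (intro exI[of _ "{t}"] exI[of _ e]) (auto simp: cfun_nbhd_def)
  qed
  then have "continuous_on UNIV (\<lambda>f::('a, 'b) cfun. apply_cfun f t)"
    by (intro continuous_on_open_vimage[THEN iffD2]) (auto simp: vimage_def)
  then show ?thesis
    using continuous_on_subset by blast
qed

lemma measurable_evaluation [measurable]:
  "(\<lambda>f::('a::topological_space, 'b::metric_space) cfun. apply_cfun f t) \<in> borel_measurable borel"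
  by (intro borel_measurable_continuous_onI continuous_on_evaluation)

lemma borel_measurable_vec_nth [measurable]: "(\<lambda>x::real^'n. x $ i) \<in> borel_measurable borel"
  by (intro borel_measurable_continuous_onI continuous_intros)

lemma borel_measurable_vecI:
  fixes f :: "'a \<Rightarrow> real^'n"
  assumes "\<And>i. (\<lambda>x. f x $ i) \<in> borel_measurable M"
  shows "f \<in> borel_measurable M"
proof (rule borel_measurable_euclidean_space[THEN iffD2], rule ballI)
  fix b :: "real^'n" assume "b \<in> Basis"
  then obtain i where "b = axis i 1" by (auto simp: Basis_vec_def)
  with assms show "(\<lambda>x. f x \<bullet> b) \<in> borel_measurable M" by (simp add: inner_axis)
qed

text \<open>The conditions are closed and are imposed on all of the open set \<open>B\<close>; this
  is what later allows each of them to be tested on a dense subset. Compactness of \<open>K\<close>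
  leaves finitely many, and two distances to a common centre \<open>y\<close> cost at most
  \<open>2 * r < e\<close>.\<close>

lemma cfun_box_nbhd:
  fixes f :: "('a::topological_space, 'b::{metric_space, second_countable_topology}) cfun"
  assumes BA: "topological_basis BA" and K: "compact K" and e: "e > 0"
    and dense: "\<And>U::'b set. open U \<Longrightarrow> U \<noteq> {} \<Longrightarrow> \<exists>d\<in>D. d \<in> U"
  obtains J where "finite J" "J \<subseteq> BA \<times> D \<times> \<rat>"
    "\<forall>(B, y, r)\<in>J. \<forall>t\<in>B. dist y (apply_cfun f t) \<le> r"
    "{g. \<forall>(B, y, r)\<in>J. \<forall>t\<in>B. dist y (apply_cfun g t) \<le> r} \<subseteq> cfun_nbhd f K e"
proof -
  obtain r where r: "r \<in> \<rat>" "e/8 < r" "r < e/4"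
    using Rats_dense_in_real[of "e/8" "e/4"] e by auto
  have "\<exists>B y. B \<in> BA \<and> y \<in> D \<and> t \<in> B \<and> (\<forall>s\<in>B. dist y (apply_cfun f s) \<le> r)" for t
  proof -
    obtain y where y: "y \<in> D" "dist (apply_cfun f t) y < r"
      using dense[of "ball (apply_cfun f t) r"] r e by auto
    have "open (apply_cfun f -` ball y r)"
      by (intro open_vimage open_ball continuous_apply_cfun)
    moreover have "t \<in> apply_cfun f -` ball y r"
      using y by (simp add: dist_commute)
    ultimately obtain B where "B \<in> BA" "t \<in> B" "B \<subseteq> apply_cfun f -` ball y r"
      by (rule topological_basisE[OF BA])
    then show ?thesis
      using y by (intro exI[of _ B] exI[of _ y]) (auto simp: less_imp_le)
  qed
  then obtain B y where By: "\<And>t. B t \<in> BA" "\<And>t. y t \<in> D" "\<And>t. t \<in> B t"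
      "\<And>t s. s \<in> B t \<Longrightarrow> dist (y t) (apply_cfun f s) \<le> r"
    by metis
  have "\<And>t. open (B t)"
    using By(1) BA topological_basis_open by blast
  then obtain T where T: "T \<subseteq> K" "finite T" "K \<subseteq> (\<Union>t\<in>T. B t)"
  proof (rule compactE_image[OF K, of K B])
    show "K \<subseteq> (\<Union>t\<in>K. B t)" using By(3) by blast
  qed blast+
  show ?thesis
  proof (rule that[of "(\<lambda>t. (B t, y t, r)) ` T"])
    show "finite ((\<lambda>t. (B t, y t, r)) ` T)" using T by simp
    show "(\<lambda>t. (B t, y t, r)) ` T \<subseteq> BA \<times> D \<times> \<rat>" using By r by auto
    show "\<forall>(B', y', r')\<in>(\<lambda>t. (B t, y t, r)) ` T. \<forall>t\<in>B'. dist y' (apply_cfun f t) \<le> r'"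
      using By(4) by auto
    show "{g. \<forall>(B', y', r')\<in>(\<lambda>t. (B t, y t, r)) ` T. \<forall>t\<in>B'. dist y' (apply_cfun g t) \<le> r'} \<subseteq> cfun_nbhd f K e"
      unfolding cfun_nbhd_def
    proof safe
      fix g s
      assume g: "\<forall>(B', y', r')\<in>(\<lambda>t. (B t, y t, r)) ` T. \<forall>t\<in>B'. dist y' (apply_cfun g t) \<le> r'" and "s \<in> K"
      then obtain t where t: "t \<in> T" "s \<in> B t" using T by blast
      have "dist (y t) (apply_cfun g s) \<le> r"
        using g t by auto
      moreover have "dist (y t) (apply_cfun f s) \<le> r"
        using By t by auto
      ultimately have "dist (apply_cfun g s) (apply_cfun f s) \<le> r + r"
        by (smt (verit) dist_commute dist_triangle)
      also have "\<dots> < e" using r e by simp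
      finally show "dist (apply_cfun g s) (apply_cfun f s) < e" .
    qed
  qed
qed

text \<open>The base of the compact-open topology formed by finitely many conditions \<open>g ` B \<subseteq> cball y r\<close> is
  countable, and each condition need only be tested on a countable dense subset of \<open>B\<close>.\<close>

lemma measurable_cfunI:
  fixes X :: "'w \<Rightarrow> ('a::topological_space, 'b::{metric_space, second_countable_topology}) cfun"
    and BA :: "'a set set"
  assumes BA: "topological_basis BA" "countable BA"
    and X: "\<And>t. (\<lambda>\<omega>. apply_cfun (X \<omega>) t) \<in> borel_measurable M"
  shows "X \<in> borel_measurable M"
proof (rule borel_measurableI)
  fix U :: "('a, 'b) cfun set" assume U: "open U"
  obtain D :: "'b set" where D: "countable D" "\<And>U. open U \<Longrightarrow> U \<noteq> {} \<Longrightarrow> \<exists>d\<in>D. d \<in> U"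
    using countable_dense_exists by blast
  obtain C :: "'a set" where C: "countable C" "\<And>U::'a set. open U \<Longrightarrow> U \<noteq> {} \<Longrightarrow> \<exists>d\<in>C. d \<in> U"
  proof -
    let ?C = "(\<lambda>B. SOME x. x \<in> B) ` BA"
    have "\<exists>d\<in>?C. d \<in> U" if U: "open U" "U \<noteq> {}" for U
    proof -
      obtain x where "x \<in> U" using U by blast
      then obtain B where "B \<in> BA" "x \<in> B" "B \<subseteq> U"
        using U by (elim topological_basisE[OF BA(1) U(1)])
      then show ?thesis
        by (metis image_eqI someI_ex subsetD)
    qed
    then show ?thesis using that[of ?C] BA by simp
  qed
  define S where "S J = {g. \<forall>(B, y, r)\<in>J. \<forall>t\<in>B. dist y (apply_cfun g t) \<le> r}"
    for J :: "('a set \<times> 'b \<times> real) set"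
  define \<J> where "\<J> = {J. finite J \<and> J \<subseteq> BA \<times> D \<times> \<rat> \<and> S J \<subseteq> U}"
  have "countable {J. finite J \<and> J \<subseteq> BA \<times> D \<times> (\<rat>::real set)}"
    by (intro countable_Collect_finite_subset countable_SIGMA BA D countable_rat)
  then have cJ: "countable \<J>"
    unfolding \<J>_def by (rule countable_subset[rotated]) auto
  have U_eq: "U = (\<Union>J\<in>\<J>. S J)"
  proof
    show "(\<Union>J\<in>\<J>. S J) \<subseteq> U" unfolding \<J>_def by blast
    show "U \<subseteq> (\<Union>J\<in>\<J>. S J)"
    proof
      fix f assume "f \<in> U"
      then obtain K e where Ke: "compact K" "e > 0" "cfun_nbhd f K e \<subseteq> U"
        using U open_cfun_nbhdD by blast
      obtain J where J: "finite J" "J \<subseteq> BA \<times> D \<times> \<rat>" "f \<in> S J" "S J \<subseteq> cfun_nbhd f K e"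
      proof (rule cfun_box_nbhd[OF BA(1) Ke(1,2) D(2), of f])
        fix J :: "('a set \<times> 'b \<times> real) set"
        assume *: "finite J" "J \<subseteq> BA \<times> D \<times> \<rat>"
          "\<forall>(B, y, r)\<in>J. \<forall>t\<in>B. dist y (apply_cfun f t) \<le> r"
          "{g. \<forall>(B, y, r)\<in>J. \<forall>t\<in>B. dist y (apply_cfun g t) \<le> r} \<subseteq> cfun_nbhd f K e"
        show thesis
          by (rule that[OF *(1,2)]) (use *(3,4) in \<open>simp_all add: S_def\<close>)
      qed
      then show "f \<in> (\<Union>J\<in>\<J>. S J)"
        using Ke(3) unfolding \<J>_def by blast
    qed
  qed
  have S_eq: "S J = (\<Inter>(B, y, r)\<in>J. \<Inter>t\<in>B \<inter> C. {g. dist y (apply_cfun g t) \<le> r})"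
    if J: "J \<subseteq> BA \<times> D \<times> \<rat>" for J
  proof
    show "S J \<subseteq> (\<Inter>(B, y, r)\<in>J. \<Inter>t\<in>B \<inter> C. {g. dist y (apply_cfun g t) \<le> r})"
      unfolding S_def by auto
    show "(\<Inter>(B, y, r)\<in>J. \<Inter>t\<in>B \<inter> C. {g. dist y (apply_cfun g t) \<le> r}) \<subseteq> S J"
    proof
      fix g assume g: "g \<in> (\<Inter>(B, y, r)\<in>J. \<Inter>t\<in>B \<inter> C. {g. dist y (apply_cfun g t) \<le> r})"
      show "g \<in> S J"
        unfolding S_def
      proof safe
        fix B y r t assume *: "(B, y, r) \<in> J" "t \<in> B"
        show "dist y (apply_cfun g t) \<le> r"
        proof (rule ccontr)
          assume nle: "\<not> dist y (apply_cfun g t) \<le> r"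
          define V where "V = B \<inter> apply_cfun g -` {z. r < dist y z}"
          have "open {z. r < dist y z}"
            by (intro open_Collect_less continuous_intros)
          then have "open (apply_cfun g -` {z. r < dist y z})"
            by (intro open_vimage continuous_apply_cfun)
          then have "open V"
            unfolding V_def using * J topological_basis_open[OF BA(1), of B] by auto
          moreover have "t \<in> V" using nle * by (auto simp: V_def)
          ultimately obtain s where "s \<in> C" "s \<in> V" using C by blast
          then show False using g * by (force simp: V_def)
        qed
      qed
    qed
  qed
  have "X -` U \<inter> space M = (\<Union>J\<in>\<J>. X -` S J \<inter> space M)"
    unfolding U_eq by blast
  also have "\<dots> \<in> sets M"
  proof (intro sets.countable_UN'' cJ)
    fix J assume "J \<in> \<J>"
    then have J: "finite J" "J \<subseteq> BA \<times> D \<times> \<rat>" unfolding \<J>_def by auto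
    have "X -` S J \<inter> space M =
        (\<Inter>(B, y, r)\<in>J. \<Inter>t\<in>B \<inter> C. {\<omega>\<in>space M. dist y (apply_cfun (X \<omega>) t) \<le> r}) \<inter> space M"
      unfolding S_eq[OF J(2)] by auto
    also have "\<dots> = {\<omega>\<in>space M. \<forall>(B, y, r)\<in>J. \<forall>t\<in>B \<inter> C. dist y (apply_cfun (X \<omega>) t) \<le> r}"
      by auto
    also have "\<dots> \<in> sets M"
    proof -
      have [measurable]: "(\<lambda>\<omega>. apply_cfun (X \<omega>) t) \<in> borel_measurable M" for t by (rule X)
      have "{\<omega>\<in>space M. \<forall>j\<in>J. \<forall>t\<in>fst j \<inter> C. dist (fst (snd j)) (apply_cfun (X \<omega>) t) \<le> snd (snd j)} \<in> sets M"
        by (intro sets.sets_Collect_countable_All' countable_finite[OF J(1)] countable_Int2 C(1)) measurable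
      then show ?thesis by (simp add: case_prod_beta)
    qed
    finally show "X -` S J \<inter> space M \<in> sets M" .
  qed
  finally show "X -` U \<inter> space M \<in> sets M" .
qed

lemma measurable_cfun_vecI:
  fixes X :: "'w \<Rightarrow> ('a::topological_space, real^'n) cfun"
    and BA :: "'a set set"
  assumes "topological_basis BA" "countable BA"
    and "\<And>t i. (\<lambda>\<omega>. apply_cfun (X \<omega>) t $ i) \<in> borel_measurable M"
  shows "X \<in> borel_measurable M"
  by (intro measurable_cfunI[OF assms(1,2)] borel_measurable_vecI assms(3))

text \<open>Lower orthants at finitely many points are stable under intersection, and they generate
  the Borel sets because the identity out of their sigma-algebra is measurable by
  \<open>measurable_cfun_vecI\<close>. Lower orthants fit a field built from maxima, whose
  distribution functions are void probabilities.\<close>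

lemma measure_eqI_cfun:
  fixes P Q :: "('a::topological_space, real^'n) cfun measure"
    and BA :: "'a set set"
  assumes BA: "topological_basis BA" "countable BA"
    and P: "finite_measure P" "sets P = sets borel" and Q: "sets Q = sets borel"
    and eq: "\<And>J y. finite J \<Longrightarrow>
      emeasure P {f. \<forall>(t, i)\<in>J. apply_cfun f t $ i \<le> y (t, i)} =
      emeasure Q {f. \<forall>(t, i)\<in>J. apply_cfun f t $ i \<le> y (t, i)}"
  shows "P = Q"
proof -
  interpret P: finite_measure P by fact
  define R where "R J y = {f::('a, real^'n) cfun. \<forall>(t, i)\<in>J. apply_cfun f t $ i \<le> y (t, i)}"
    for J and y :: "_ \<Rightarrow> real"
  define E where "E = {R J y | J y. finite J}"
  have sub: "E \<subseteq> Pow UNIV" by simp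
  have R_borel: "R J y \<in> sets borel" if "finite J" for J y
  proof -
    have "{f\<in>space borel. \<forall>j\<in>J. apply_cfun f (fst j) $ snd j \<le> y j} \<in> sets borel"
      by (intro sets.sets_Collect_countable_All' countable_finite[OF that]) measurable
    then show ?thesis by (simp add: R_def case_prod_beta)
  qed
  have gen: "sets (borel :: ('a, real^'n) cfun measure) = sigma_sets UNIV E"
  proof
    show "sigma_sets UNIV E \<subseteq> sets (borel :: ('a, real^'n) cfun measure)"
      using sets.sigma_sets_subset[of E "borel :: ('a, real^'n) cfun measure"] R_borel
      by (auto simp: E_def)
    have "(\<lambda>f. f) \<in> borel_measurable (sigma UNIV E)"
    proof (rule measurable_cfun_vecI[OF BA])
      fix t :: 'a and i :: 'n
      show "(\<lambda>f. apply_cfun f t $ i) \<in> borel_measurable (sigma UNIV E)"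
      proof (rule borel_measurableI_le)
        fix a :: real
        have "{f. apply_cfun f t $ i \<le> a} = R {(t, i)} (\<lambda>_. a)" by (simp add: R_def)
        then have "{f. apply_cfun f t $ i \<le> a} \<in> E" unfolding E_def by blast
        then show "{f \<in> space (sigma UNIV E). apply_cfun f t $ i \<le> a} \<in> sets (sigma UNIV E)"
          by (simp add: sub sigma_sets.Basic)
      qed
    qed
    then show "sets (borel :: ('a, real^'n) cfun measure) \<subseteq> sigma_sets UNIV E"
      using measurable_sets[of "\<lambda>f. f" "sigma UNIV E" borel] by (fastforce simp: sub)
  qed
  show ?thesis
  proof (rule measure_eqI_generator_eq[of E UNIV P Q "\<lambda>_. UNIV"])
    show "Int_stable E"
    proof (rule Int_stableI)
      fix A B assume "A \<in> E" "B \<in> E"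
      then obtain J y J' y' where A: "A = R J y" "finite J" and B: "B = R J' y'" "finite J'"
        unfolding E_def by blast
      define z where "z j = (if j \<in> J then if j \<in> J' then min (y j) (y' j) else y j else y' j)" for j
      have "A \<inter> B = R (J \<union> J') z"
        unfolding A B R_def z_def by (auto split: if_splits)
      then show "A \<inter> B \<in> E" unfolding E_def using A B by blast
    qed
    have "UNIV = R {} (\<lambda>_. 0)" by (simp add: R_def)
    then show "range (\<lambda>_. UNIV) \<subseteq> E" unfolding E_def by blast
    show "emeasure P X = emeasure Q X" if "X \<in> E" for X
      using that eq unfolding E_def R_def by blast
    show "sets P = sigma_sets UNIV E" "sets Q = sigma_sets UNIV E"
      using P Q gen by simp_all
    show "emeasure P UNIV \<noteq> \<infinity>" by simp
  qed (use sub in auto)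
qed

section \<open>Operations on paths and tail measures\<close>

lemma continuous_cfun_nth [continuous_intros]:
  "continuous_on UNIV (\<lambda>t. apply_cfun f t $ i)" for f :: "('a::topological_space, real^'n) cfun"
  by (intro continuous_on_component continuous_apply_cfun)

lift_definition cfun_max ::
    "('a::topological_space, real^'n) cfun \<Rightarrow> ('a, real^'n) cfun \<Rightarrow> ('a, real^'n) cfun"
  is "\<lambda>f g t. \<chi> i. max (f t $ i) (g t $ i)"
  by (intro continuous_intros)

lift_definition cfun_zero :: "('a::topological_space, real^'n) cfun" is "\<lambda>_. 0"
  by (intro continuous_intros)

lift_definition cfun_abs :: "('a::topological_space, real^'n) cfun \<Rightarrow> ('a, real^'n) cfun"
  is "\<lambda>f t. \<chi> i. \<bar>f t $ i\<bar>"
  by (intro continuous_intros)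

text \<open>Superposition by maxima works for nonnegative fields. A signed field is therefore
  carried with components \<open>'n \<times> bool\<close>, where \<open>True\<close> marks positive
  and \<open>False\<close> negative parts, and is reassembled only at the end.\<close>

lift_definition cfun_diff :: "('a::topological_space, real^('n \<times> bool)) cfun \<Rightarrow> ('a, real^'n) cfun"
  is "\<lambda>f t. \<chi> i. f t $ (i, True) - f t $ (i, False)"
  by (intro continuous_intros)

lemmas cfun_apply_simps [simp] = cfun_max.rep_eq cfun_zero.rep_eq cfun_abs.rep_eq cfun_diff.rep_eq
  shift.rep_eq scale.rep_eq

text \<open>Logarithmic coordinates on \<open>posG\<close>: division by \<open>u\<close> becomes a
  translation, and Lebesgue measure in \<open>y\<close> is the Haar measure of the scaling
  group.\<close>

definition vexp :: "real^'n \<Rightarrow> real^'n" where "vexp y = (\<chi> i. exp (y $ i))"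

lemma vexp_nth [simp]: "vexp y $ i = exp (y $ i)" by (simp add: vexp_def)

lemma vexp_posG [simp]: "vexp y \<in> posG" by (simp add: posG_def)

lemma chi_vexp: "chi \<alpha> (vexp y) = exp (\<alpha> \<bullet> y)"
  by (simp add: chi_def inner_vec_def powr_def exp_sum)

lemma posGD: "r \<in> posG \<Longrightarrow> 0 < r $ i"
  by (simp add: posG_def)

lemma chi_pos:
  assumes "r \<in> posG" shows "0 < chi \<alpha> r"
proof -
  have "r $ i \<noteq> 0" for i using posGD[OF assms, of i] by simp
  then show ?thesis unfolding chi_def by (intro prod_pos) simp
qed

lemma posG_vexp_ln:
  assumes "r \<in> posG" shows "vexp (\<chi> i. ln (r $ i)) = r"
  unfolding vec_eq_iff using posGD[OF assms] by (simp add: exp_ln)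

lemma vexp_scale_scale: "vexp x \<odot> (vexp y \<odot> f) = vexp (x + y) \<odot> f"
  by (rule cfun_eqI) (simp add: vec_eq_iff exp_add)

lemma vexp_0_scale: "vexp 0 \<odot> f = f"
  by (rule cfun_eqI) (simp add: vec_eq_iff)

lemma shift_scale: "shift h (r \<odot> f) = r \<odot> shift h f"
  by (rule cfun_eqI) (simp add: vec_eq_iff)

lemma shift_cfun_diff: "shift h (cfun_diff f) = cfun_diff (shift h f)"
  by (rule cfun_eqI) (simp add: vec_eq_iff)

lemma vinverse_scale_vexp:
  assumes "u \<in> posG"
  shows "vinverse u \<odot> (vexp y \<odot> f) = vexp (y - (\<chi> i. ln (u $ i))) \<odot> f"
  using assms
  by (intro cfun_eqI) (simp add: vec_eq_iff vinverse_def posG_def exp_diff field_simps)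

lemma SUP_compact_less_iff:
  fixes g :: "'a::topological_space \<Rightarrow> real"
  assumes C: "compact C" "C \<noteq> {}" and g: "continuous_on C g"
  shows "(SUP s\<in>C. g s) < c \<longleftrightarrow> (\<forall>s\<in>C. g s < c)"
    and "c < (SUP s\<in>C. g s) \<longleftrightarrow> (\<exists>s\<in>C. c < g s)"
proof -
  obtain s where s: "s \<in> C" "\<And>s'. s' \<in> C \<Longrightarrow> g s' \<le> g s"
    using continuous_attains_sup[OF C g] by blast
  then have "(SUP s\<in>C. g s) = g s"
    by (intro cSup_eq_maximum) auto
  with s show "(SUP s\<in>C. g s) < c \<longleftrightarrow> (\<forall>s\<in>C. g s < c)" "c < (SUP s\<in>C. g s) \<longleftrightarrow> (\<exists>s\<in>C. c < g s)"
    by (auto intro: le_less_trans less_le_trans)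
qed

text \<open>A lower bound survives near \<open>t\<close> because a single point of \<open>C\<close>
  witnesses it; an upper bound survives by the tube lemma.\<close>

lemma continuous_on_SUP_compact:
  fixes g :: "'a::topological_space \<Rightarrow> 'b::topological_space \<Rightarrow> real"
  assumes C: "compact C" "C \<noteq> {}" and g: "continuous_on UNIV (\<lambda>(t, s). g t s)"
  shows "continuous_on UNIV (\<lambda>t. SUP s\<in>C. g t s)"
proof -
  have gs: "continuous_on A (\<lambda>s. g t s)" for t A
    using continuous_on_compose2[OF g, of A "\<lambda>s. (t, s)"] by (simp add: continuous_on_Pair)
  have gt: "continuous_on A (\<lambda>t. g t s)" for s A
    using continuous_on_compose2[OF g, of A "\<lambda>t. (t, s)"] by (simp add: continuous_on_Pair)
  have "((\<lambda>t. SUP s\<in>C. g t s) \<longlongrightarrow> (SUP s\<in>C. g t s)) (at t)" for t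
  proof (rule order_tendstoI)
    fix a assume "a < (SUP s\<in>C. g t s)"
    then obtain s where s: "s \<in> C" "a < g t s"
      using SUP_compact_less_iff(2)[OF C gs] by blast
    have "open {t. a < g t s}"
      by (intro open_Collect_less continuous_intros gt)
    then have "\<forall>\<^sub>F x in at t. a < g x s"
      using s(2) unfolding eventually_at_topological by blast
    then show "\<forall>\<^sub>F x in at t. a < (SUP s\<in>C. g x s)"
      by eventually_elim (use s(1) SUP_compact_less_iff(2)[OF C gs] in blast)
  next
    fix a assume "(SUP s\<in>C. g t s) < a"
    then have "{t} \<times> C \<subseteq> {p. (case p of (t, s) \<Rightarrow> g t s) < a}"
      using SUP_compact_less_iff(1)[OF C gs] by auto
    moreover have "open {p. (case p of (t, s) \<Rightarrow> g t s) < a}"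
      by (intro open_Collect_less g continuous_intros)
    ultimately obtain U where U: "t \<in> U" "open U" "U \<times> C \<subseteq> {p. (case p of (t, s) \<Rightarrow> g t s) < a}"
      using Elementary_Topology.tube_lemma[OF C(1)] by metis
    have "\<forall>x\<in>U. (SUP s\<in>C. g x s) < a"
      using U(3) SUP_compact_less_iff(1)[OF C gs] by auto
    then show "\<forall>\<^sub>F x in at t. (SUP s\<in>C. g x s) < a"
      using U(1,2) unfolding eventually_at_topological by blast
  qed
  then show ?thesis
    by (simp add: continuous_on_def)
qed

text \<open>Meant for a supremum of infinitely many paths of which only finitely many are nonzero
  near a given point.\<close>

lemma continuous_on_locally_eq:
  fixes f :: "'a::topological_space \<Rightarrow> 'b::topological_space"
  assumes "\<And>t. \<exists>U g. open U \<and> t \<in> U \<and> continuous_on UNIV g \<and> (\<forall>s\<in>U. f s = g s)"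
  shows "continuous_on UNIV f"
proof -
  have "(f \<longlongrightarrow> f t) (at t)" for t
  proof -
    obtain U g where *: "open U" "t \<in> U" "continuous_on UNIV g" "\<And>s. s \<in> U \<Longrightarrow> f s = g s"
      using assms[of t] by blast
    then have "(g \<longlongrightarrow> f t) (at t)"
      by (simp add: continuous_on_def)
    moreover have "\<forall>\<^sub>F x in at t. g x = f x"
      using * unfolding eventually_at_topological by (metis (no_types))
    ultimately show ?thesis
      by (rule Lim_transform_eventually)
  qed
  then show ?thesis
    by (simp add: continuous_on_def)
qed

text \<open>Common ground of countable discrete groups and \<open>real^'m\<close>. The countable
  base serves measurability; \<open>nbhd\<close> turns statements about the sets \<open>K n\<close>
  into local ones, as continuity of a locally finite supremum requires.\<close>

locale exhausted_group =
  fixes K :: "nat \<Rightarrow> 't::topological_ab_group_add set" and BA :: "'t set set"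
  assumes exh: "compact_exhaustion K"
    and basis: "topological_basis BA" "countable BA"
    and nbhd: "\<And>t. \<exists>n\<ge>1. \<exists>U. open U \<and> t \<in> U \<and> U \<subseteq> K n"
begin

lemmas K_props = exh[unfolded compact_exhaustion_def, THEN conjunct1, rule_format]

lemma compact_K: "1 \<le> n \<Longrightarrow> compact (K n)" and K_nonempty: "1 \<le> n \<Longrightarrow> K n \<noteq> {}"
  using K_props[of n] by simp_all

lemma K_mono: "1 \<le> n \<Longrightarrow> n \<le> m \<Longrightarrow> K n \<subseteq> K m"
proof (induction m)
  case (Suc m)
  then show ?case
    using K_props[of m] by (cases "n = Suc m") auto
qed simp

lemma compact_subset_K:
  assumes "compact C" obtains n where "1 \<le> n" "C \<subseteq> K n"
  using exh[unfolded compact_exhaustion_def, THEN conjunct2, THEN conjunct2, rule_format, OF assms]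
  by auto

lemma measurable_fieldI:
  fixes X :: "'w \<Rightarrow> ('t, real^'n) cfun"
  assumes "\<And>t i. (\<lambda>\<omega>. apply_cfun (X \<omega>) t $ i) \<in> borel_measurable M"
  shows "X \<in> borel_measurable M"
  by (rule measurable_cfun_vecI[OF basis assms])

lemma measurable_shift [measurable]: "shift h \<in> borel \<rightarrow>\<^sub>M (borel :: ('t, real^'n) cfun measure)"
  by (rule measurable_fieldI) (simp, measurable)

lemma measurable_cfun_diff [measurable]:
  "cfun_diff \<in> borel \<rightarrow>\<^sub>M (borel :: ('t, real^'n) cfun measure)"
  by (rule measurable_fieldI) (simp, measurable)

lemma measurable_cfun_abs [measurable]:
  "cfun_abs \<in> borel \<rightarrow>\<^sub>M (borel :: ('t, real^'n) cfun measure)"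
  by (rule measurable_fieldI) (simp, measurable)

lemma measurable_cfun_max [measurable (raw)]:
  fixes X Y :: "'w \<Rightarrow> ('t, real^'n) cfun"
  assumes [measurable]: "X \<in> borel_measurable M" "Y \<in> borel_measurable M"
  shows "(\<lambda>\<omega>. cfun_max (X \<omega>) (Y \<omega>)) \<in> borel_measurable M"
  by (rule measurable_fieldI) (simp, measurable)

lemma measurable_scale [measurable (raw)]:
  fixes X :: "'w \<Rightarrow> ('t, real^'n) cfun"
  assumes [measurable]: "r \<in> borel_measurable M" "X \<in> borel_measurable M"
  shows "(\<lambda>\<omega>. r \<omega> \<odot> X \<omega>) \<in> borel_measurable M"
  by (rule measurable_fieldI) (simp, measurable)

lemma measurable_vexp [measurable]: "vexp \<in> borel \<rightarrow>\<^sub>M borel"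
  by (rule borel_measurable_vecI) simp

lemma rho_gt_iff: "1 \<le> n \<Longrightarrow> c < rho K n i f \<longleftrightarrow> (\<exists>t\<in>K n. c < \<bar>apply_cfun f t $ i\<bar>)"
  unfolding rho_def
  by (intro SUP_compact_less_iff compact_K K_nonempty continuous_intros
      continuous_on_subset[OF continuous_cfun_nth]) auto

lemma window_iff:
  "(\<And>i. 1 \<le> n $ i) \<Longrightarrow> f \<in> window K n \<epsilon> \<longleftrightarrow> (\<forall>i. \<exists>t\<in>K (n $ i). \<epsilon> $ i < \<bar>apply_cfun f t $ i\<bar>)"
  unfolding window_def by (simp add: rho_gt_iff)

lemma open_cfun_gt: "open {f::('t, real^'n) cfun. c < \<bar>apply_cfun f t $ i\<bar>}"
  by (intro open_Collect_less continuous_intros)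

lemma open_window:
  assumes "\<And>i. 1 \<le> n $ i"
  shows "open (window K n \<epsilon> :: ('t, real^'n) cfun set)"
proof -
  have "window K n \<epsilon> = (\<Inter>i. \<Union>t\<in>K (n $ i). {f::('t, real^'n) cfun. \<epsilon> $ i < \<bar>apply_cfun f t $ i\<bar>})"
    using window_iff[OF assms] by auto
  then show ?thesis
    by (simp only:) (intro open_INT open_UN open_cfun_gt ballI finite)
qed

lemma sets_window [measurable]:
  "(\<And>i. 1 \<le> n $ i) \<Longrightarrow> (window K n \<epsilon> :: ('t, real^'n) cfun set) \<in> sets borel"
  by (rule borel_open) (rule open_window)

lemma scale_window_iff:
  assumes "\<And>i. 1 \<le> n $ i" "r \<in> posG"
  shows "r \<odot> f \<in> window K n \<epsilon> \<longleftrightarrow> f \<in> window K n (\<chi> i. \<epsilon> $ i / r $ i)"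
  using assms(2) unfolding window_iff[OF assms(1)]
  by (simp add: abs_mult posGD abs_of_pos pos_divide_less_eq mult.commute)

lemma window_mono:
  assumes "\<And>i. 1 \<le> n $ i" "\<And>i. n $ i \<le> m $ i" "\<And>i. \<epsilon> $ i \<le> \<delta> $ i"
  shows "window K n \<delta> \<subseteq> (window K m \<epsilon> :: ('t, real^'n) cfun set)"
proof
  fix f :: "('t, real^'n) cfun" assume f: "f \<in> window K n \<delta>"
  have m: "\<And>i. 1 \<le> m $ i" using assms order_trans by blast
  show "f \<in> window K m \<epsilon>"
    unfolding window_iff[OF m]
  proof
    fix i
    obtain t where "t \<in> K (n $ i)" "\<delta> $ i < \<bar>apply_cfun f t $ i\<bar>"
      using f window_iff[OF assms(1)] by blast
    then show "\<exists>t\<in>K (m $ i). \<epsilon> $ i < \<bar>apply_cfun f t $ i\<bar>"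
      using K_mono[OF assms(1) assms(2), of i] assms(3)[of i] by (meson le_less_trans subsetD)
  qed
qed

end

section \<open>Tail measures in logarithmic coordinates\<close>

locale tail_measure = exhausted_group K BA
  for K :: "nat \<Rightarrow> 't::topological_ab_group_add set" and BA :: "'t set set" +
  fixes \<alpha> :: "real^'q" and \<nu> :: "('t, real^'q) cfun measure"
  assumes alpha_pos: "\<And>i. 0 < \<alpha> $ i"
    and tail: "multihomogeneous_tail_measure K \<alpha> \<nu>"
    and inv: "shift_invariant \<nu>"
begin

lemma sets_nu [simp, measurable_cong]: "sets \<nu> = sets borel"
  using tail unfolding multihomogeneous_tail_measure_def by blast

lemma space_nu [simp]: "space \<nu> = UNIV"
  using sets_eq_imp_space_eq[OF sets_nu] by simp

lemma distr_shift: "distr \<nu> borel (shift h) = \<nu>"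
  using inv unfolding shift_invariant_def by blast

text \<open>Homogeneity is assumed for images. A preimage under scaling by \<open>vexp y\<close> is
  an image under scaling by \<open>vexp (-y)\<close>, hence the positive exponent.\<close>

lemma emeasure_vimage_vexp:
  assumes "A \<in> sets borel"
  shows "emeasure \<nu> {f. vexp y \<odot> f \<in> A} = ennreal (exp (\<alpha> \<bullet> y)) * emeasure \<nu> A"
proof -
  have "{f. vexp y \<odot> f \<in> A} = (\<lambda>f. vexp (-y) \<odot> f) ` A"
  proof
    show "{f. vexp y \<odot> f \<in> A} \<subseteq> (\<lambda>f. vexp (-y) \<odot> f) ` A"
    proof
      fix f assume "f \<in> {f. vexp y \<odot> f \<in> A}"
      moreover have "f = vexp (-y) \<odot> (vexp y \<odot> f)" by (simp add: vexp_scale_scale vexp_0_scale)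
      ultimately show "f \<in> (\<lambda>f. vexp (-y) \<odot> f) ` A" by blast
    qed
  qed (auto simp: vexp_scale_scale vexp_0_scale)
  moreover have "emeasure \<nu> ((\<lambda>f. vexp (-y) \<odot> f) ` A)
      = ennreal (inverse (chi \<alpha> (vexp (-y)))) * emeasure \<nu> A"
    using tail assms vexp_posG unfolding multihomogeneous_tail_measure_def by blast
  ultimately show ?thesis
    by (simp add: chi_vexp exp_minus)
qed

lemma distr_vexp: "distr \<nu> borel (\<lambda>f. vexp y \<odot> f) = density \<nu> (\<lambda>_. ennreal (exp (\<alpha> \<bullet> y)))"
proof (rule measure_eqI)
  fix A assume "A \<in> sets (distr \<nu> borel (\<lambda>f. vexp y \<odot> f))"
  then have A: "A \<in> sets borel" by simp
  have "emeasure (distr \<nu> borel (\<lambda>f. vexp y \<odot> f)) A = emeasure \<nu> {f. vexp y \<odot> f \<in> A}"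
    using A by (subst emeasure_distr) (auto simp: vimage_def)
  then show "emeasure (distr \<nu> borel (\<lambda>f. vexp y \<odot> f)) A
      = emeasure (density \<nu> (\<lambda>_. ennreal (exp (\<alpha> \<bullet> y)))) A"
    using A by (simp add: emeasure_vimage_vexp emeasure_density nn_integral_cmult_indicator)
qed simp

text \<open>The change of variables that turns smearing over \<open>y\<close> into an average over
  logarithmic scales; it is applied there with \<open>L j *\<^sub>R v\<close> for
  \<open>y\<close>.\<close>

lemma integral_vexp:
  fixes h :: "_ \<Rightarrow> real"
  assumes [measurable]: "h \<in> borel_measurable borel"
  shows "(\<integral>f. h f \<partial>\<nu>) = exp (- (\<alpha> \<bullet> y)) * (\<integral>f. h (vexp y \<odot> f) \<partial>\<nu>)"
proof -
  have "(\<integral>f. h (vexp y \<odot> f) \<partial>\<nu>) = (\<integral>f. h f \<partial>distr \<nu> borel (\<lambda>f. vexp y \<odot> f))"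
    by (subst integral_distr) simp_all
  also have "\<dots> = exp (\<alpha> \<bullet> y) * (\<integral>f. h f \<partial>\<nu>)"
    unfolding distr_vexp by (subst integral_density) simp_all
  finally show ?thesis
    by (simp add: exp_minus)
qed

lemma D_Pi_null: "D_Pi \<in> null_sets \<nu>"
proof -
  have "D_Pi = (\<Union>i. \<Inter>t. {f::('t, real^'q) cfun. apply_cfun f t $ i = 0})"
    by (auto simp: D_Pi_def)
  moreover have "closed (\<Union>i. \<Inter>t. {f::('t, real^'q) cfun. apply_cfun f t $ i = 0})"
    by (intro closed_UN closed_INT ballI finite closed_Collect_eq continuous_intros)
  ultimately have "D_Pi \<in> sets \<nu>" by (simp add: borel_closed)
  moreover have "emeasure \<nu> D_Pi = 0"
    using tail unfolding multihomogeneous_tail_measure_def by blast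
  ultimately show ?thesis by blast
qed

lemma AE_not_D_Pi: "AE f in \<nu>. \<forall>i. \<exists>t. apply_cfun f t $ i \<noteq> 0"
  by (rule AE_I'[OF D_Pi_null]) (auto simp: D_Pi_def)

lemma window_scaling:
  assumes n: "\<And>i. 1 \<le> n $ i" and \<epsilon>: "\<epsilon> \<in> posG"
  shows "emeasure \<nu> (window K n \<epsilon>) = ennreal (inverse (chi \<alpha> \<epsilon>)) * emeasure \<nu> (window K n 1)"
proof -
  define y where "y = (\<chi> i. ln (\<epsilon> $ i))"
  have e: "vexp y = \<epsilon>" using posG_vexp_ln[OF \<epsilon>] by (simp add: y_def)
  have "window K n 1 = {f. vexp y \<odot> f \<in> window K n \<epsilon>}"
    using scale_window_iff[OF n \<epsilon>] \<epsilon> by (auto simp: e posG_def one_vec_def less_le)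
  then have "emeasure \<nu> (window K n 1) = ennreal (chi \<alpha> \<epsilon>) * emeasure \<nu> (window K n \<epsilon>)"
    using emeasure_vimage_vexp[of "window K n \<epsilon>" y] n by (simp add: chi_vexp[symmetric] e)
  then have "ennreal (inverse (chi \<alpha> \<epsilon>)) * emeasure \<nu> (window K n 1)
      = ennreal (inverse (chi \<alpha> \<epsilon>) * chi \<alpha> \<epsilon>) * emeasure \<nu> (window K n \<epsilon>)"
    using chi_pos[OF \<epsilon>, of \<alpha>] by (simp only: ennreal_mult'' less_imp_le mult.assoc)
  then show ?thesis using chi_pos[OF \<epsilon>, of \<alpha>] by simp
qed

lemma window_finite:
  assumes n: "\<And>i. 1 \<le> n $ i" and \<epsilon>: "\<epsilon> \<in> posG"
  shows "emeasure \<nu> (window K n \<epsilon>) < \<infinity>"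
proof -
  have "emeasure \<nu> (window K n 1) < \<infinity>"
    using tail n unfolding multihomogeneous_tail_measure_def by blast
  then show ?thesis
    unfolding window_scaling[OF assms] by (simp add: ennreal_mult_less_top)
qed

text \<open>Outside \<open>D_Pi\<close> every component is nonzero somewhere, so the path lies in a
  window with large index and small height, and such windows have finite mass. Measurability of
  integrals over \<nu> that depend on a parameter rests on this.\<close>

lemma sigma_finite_nu: "sigma_finite_measure \<nu>"
proof
  define W where "W n = (window K (\<chi> i. Suc n) (\<chi> i. inverse (real (Suc n))) :: ('t, real^'q) cfun set)" for n
  have "UNIV - D_Pi \<subseteq> (\<Union>n. W n)"
  proof
    fix f :: "('t, real^'q) cfun" assume "f \<in> UNIV - D_Pi"
    then have "\<forall>i. \<exists>t. apply_cfun f t $ i \<noteq> 0" by (auto simp: D_Pi_def)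
    then obtain t where t: "\<And>i. apply_cfun f (t i) $ i \<noteq> 0" by metis
    have "\<exists>n. \<forall>m\<ge>n. t i \<in> K (Suc m) \<and> inverse (real (Suc m)) < \<bar>apply_cfun f (t i) $ i\<bar>" for i
    proof -
      obtain n1 where n1: "n1 \<ge> 1" "{t i} \<subseteq> K n1" using compact_subset_K[of "{t i}"] by auto
      obtain n2 where n2: "inverse (real (Suc n2)) < \<bar>apply_cfun f (t i) $ i\<bar>"
        using reals_Archimedean[of "\<bar>apply_cfun f (t i) $ i\<bar>"] t[of i] by auto
      show ?thesis
      proof (intro exI[of _ "max n1 n2"] allI impI conjI)
        fix m assume m: "max n1 n2 \<le> m"
        show "t i \<in> K (Suc m)" using n1 m K_mono[of n1 "Suc m"] by auto
        have "inverse (real (Suc m)) \<le> inverse (real (Suc n2))" using m by (intro le_imp_inverse_le) auto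
        with n2 show "inverse (real (Suc m)) < \<bar>apply_cfun f (t i) $ i\<bar>" by linarith
      qed
    qed
    then obtain N where N: "\<And>i m. m \<ge> N i \<Longrightarrow> t i \<in> K (Suc m) \<and> inverse (real (Suc m)) < \<bar>apply_cfun f (t i) $ i\<bar>"
      by metis
    have "f \<in> W (Max (range N))"
      unfolding W_def using N[of _ "Max (range N)"]
      by (subst window_iff) (auto intro!: bexI[of _ "t _"])
    then show "f \<in> (\<Union>n. W n)" by blast
  qed
  then have "\<Union>(insert D_Pi (range W)) = space \<nu>" by auto
  moreover have "D_Pi \<in> sets \<nu>" "emeasure \<nu> D_Pi = 0"
    using D_Pi_null by auto
  moreover have "W n \<in> sets \<nu>" "emeasure \<nu> (W n) \<noteq> \<infinity>" for n
    using window_finite[of "\<chi> i. Suc n" "\<chi> i. inverse (real (Suc n))"]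
    by (auto simp: W_def posG_def less_top)
  ultimately show "\<exists>A. countable A \<and> A \<subseteq> sets \<nu> \<and> \<Union>A = space \<nu> \<and> (\<forall>a\<in>A. emeasure \<nu> a \<noteq> \<infinity>)"
    by (intro exI[of _ "insert D_Pi (range W)"]) auto
qed

end

section \<open>Poisson superposition\<close>

primrec cfun_Max :: "(nat \<Rightarrow> ('a::topological_space, real^'n) cfun) \<Rightarrow> nat \<Rightarrow> ('a, real^'n) cfun" where
  "cfun_Max z 0 = cfun_zero"
| "cfun_Max z (Suc m) = cfun_max (cfun_Max z m) (z m)"

lemma cfun_Max_le_iff:
  "apply_cfun (cfun_Max z m) t $ i \<le> y \<longleftrightarrow> 0 \<le> y \<and> (\<forall>j<m. apply_cfun (z j) t $ i \<le> y)"
  by (induction m) (auto simp: less_Suc_eq)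

lemma cfun_Max_nonneg: "0 \<le> apply_cfun (cfun_Max z m) t $ i"
  by (induction m) (auto simp: le_max_iff_disj)

text \<open>The rate 0 occurs for pieces of mass 0; with it \<open>pmf_poisson_law\<close> covers
  every \<open>0 \<le> r\<close>.\<close>

definition poisson_law :: "real \<Rightarrow> nat pmf" where
  "poisson_law r = (if r = 0 then return_pmf 0 else poisson_pmf r)"

lemma pmf_poisson_law: "0 \<le> r \<Longrightarrow> pmf (poisson_law r) n = r ^ n / fact n * exp (- r)"
  by (cases n) (auto simp: poisson_law_def)

text \<open>With \<open>x\<close> the chance that one point misses a set, this is the chance that a
  Poisson number of independent points all miss it.\<close>

lemma nn_integral_poisson_law_power:
  assumes r: "0 \<le> r" and x: "0 \<le> x"
  shows "(\<integral>\<^sup>+n. ennreal (x ^ n) \<partial>measure_pmf (poisson_law r)) = ennreal (exp (- (r * (1 - x))))"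
proof -
  have "(\<integral>\<^sup>+n. ennreal (x ^ n) \<partial>measure_pmf (poisson_law r))
      = (\<Sum>n. ennreal ((r * x) ^ n /\<^sub>R fact n * exp (- r)))"
    using assms by (simp add: nn_integral_measure_pmf nn_integral_count_space_nat pmf_poisson_law
        ennreal_mult[symmetric] power_mult_distrib divide_inverse mult_ac)
  also have "\<dots> = ennreal (exp (r * x) * exp (- r))"
    using assms by (intro suminf_ennreal_eq sums_mult2 exp_converges) simp
  finally show ?thesis by (simp add: mult_exp_exp algebra_simps)
qed

text \<open>Two or more points are an event of second order, while the normalisation of a level
  divides only by the first power of \<open>\<delta>\<close>.\<close>

lemma poisson_law_ge_2:
  assumes r: "0 \<le> r"
  shows "measure (measure_pmf (poisson_law r)) {2..} \<le> r\<^sup>2"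
proof -
  have "measure (measure_pmf (poisson_law r)) {2..} = 1 - measure (measure_pmf (poisson_law r)) {0, 1}"
  proof -
    have "{2..} = UNIV - {0, 1::nat}" by auto
    then show ?thesis using measure_pmf.prob_compl[of "{0, 1}" "poisson_law r"] by simp
  qed
  also have "measure (measure_pmf (poisson_law r)) {0, 1} = exp (- r) * (1 + r)"
    using r by (subst measure_measure_pmf_finite) (simp_all add: pmf_poisson_law algebra_simps)
  also have "1 - exp (- r) * (1 + r) \<le> 1 - (1 - r) * (1 + r)"
    using r exp_ge_add_one_self[of "-r"] by (simp add: mult_right_mono)
  finally show ?thesis by (simp add: power2_eq_square algebra_simps)
qed

text \<open>A point \<open>f\<close> of the process contributes the path \<open>Z f\<close>. The set
  \<open>A n\<close> contains every point whose path can be seen in \<open>K (k + n)\<close>, so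
  finiteness of its mass is local finiteness of the superposition.\<close>

locale poisson_superposition = exhausted_group K BA
  for K :: "nat \<Rightarrow> 't::topological_ab_group_add set" and BA :: "'t set set" +
  fixes k :: nat and \<nu> :: "'s measure" and Z :: "'s \<Rightarrow> ('t, real^'p) cfun" and A :: "nat \<Rightarrow> 's set"
    and \<delta> c :: real
  assumes k: "1 \<le> k" and space_nu: "space \<nu> = UNIV" and delta: "0 < \<delta>"
    and Z_meas [measurable]: "Z \<in> borel_measurable \<nu>"
    and Z_nonneg: "\<And>f t i. 0 \<le> apply_cfun (Z f) t $ i" and Z_le: "\<And>f t i. apply_cfun (Z f) t $ i \<le> c"
    and A_sets [measurable]: "\<And>n. A n \<in> sets \<nu>" and A_mono: "incseq A"
    and A_finite: "\<And>n. emeasure \<nu> (A n) \<noteq> \<infinity>"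
    and Z_out: "\<And>n f t. f \<notin> A n \<Longrightarrow> t \<in> K (k + n) \<Longrightarrow> apply_cfun (Z f) t = 0"
begin

definition B :: "nat \<Rightarrow> 's set" where "B = disjointed A"

definition rate :: "nat \<Rightarrow> real" where "rate n = \<delta> * measure \<nu> (B n)"

text \<open>On a null piece the law of the points is irrelevant, since the rate is 0.\<close>

definition PB :: "nat \<Rightarrow> 's measure" where
  "PB n = (if measure \<nu> (B n) = 0 then return \<nu> undefined else uniform_measure \<nu> (B n))"

text \<open>A Poisson process of finite mass, encoded as a Poisson number together with an infinite
  independent sequence, of which only the first \<open>fst p\<close> entries count.\<close>

definition piece :: "nat \<Rightarrow> (nat \<times> (nat \<Rightarrow> 's)) measure" where
  "piece n = measure_pmf (poisson_law (rate n)) \<Otimes>\<^sub>M (\<Pi>\<^sub>M j\<in>UNIV. PB n)"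

text \<open>Points outside \<open>B n\<close> are suppressed so that \<open>part_vanish\<close>, and
  with it the continuity of \<open>rest\<close>, holds at every sample point and not only almost
  surely.\<close>

definition pt :: "nat \<Rightarrow> nat \<times> (nat \<Rightarrow> 's) \<Rightarrow> nat \<Rightarrow> ('t, real^'p) cfun" where
  "pt n p j = (if snd p j \<in> B n then Z (snd p j) else cfun_zero)"

definition part :: "nat \<Rightarrow> nat \<times> (nat \<Rightarrow> 's) \<Rightarrow> ('t, real^'p) cfun" where
  "part n p = cfun_Max (pt n p) (fst p)"

text \<open>Piece 0 is kept apart from the others because only its points can be seen in
  \<open>K k\<close>; compare \<open>rest_vanish\<close>.\<close>

definition rest_space :: "(nat \<Rightarrow> nat \<times> (nat \<Rightarrow> 's)) measure" where
  "rest_space = (\<Pi>\<^sub>M n\<in>UNIV. piece (Suc n))"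

definition rest :: "(nat \<Rightarrow> nat \<times> (nat \<Rightarrow> 's)) \<Rightarrow> ('t, real^'p) cfun" where
  "rest \<omega> = Cfun (\<lambda>t. \<chi> i. SUP n. apply_cfun (part (Suc n) (\<omega> n)) t $ i)"

definition full_space :: "((nat \<times> (nat \<Rightarrow> 's)) \<times> (nat \<Rightarrow> nat \<times> (nat \<Rightarrow> 's))) measure" where
  "full_space = piece 0 \<Otimes>\<^sub>M rest_space"

definition full :: "(nat \<times> (nat \<Rightarrow> 's)) \<times> (nat \<Rightarrow> nat \<times> (nat \<Rightarrow> 's)) \<Rightarrow> ('t, real^'p) cfun" where
  "full \<omega> = cfun_max (part 0 (fst \<omega>)) (rest (snd \<omega>))"

lemma B_sets [measurable]: "B n \<in> sets \<nu>"
  unfolding B_def using sets.range_disjointed_sets[of A \<nu>] A_sets by blast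

lemma B_sub: "B n \<subseteq> A n"
  unfolding B_def by (rule disjointed_subset)

lemma B_finite: "emeasure \<nu> (S \<inter> B n) \<noteq> \<infinity>"
proof -
  have "emeasure \<nu> (S \<inter> B n) \<le> emeasure \<nu> (A n)"
    using B_sub by (intro emeasure_mono) auto
  then show ?thesis using A_finite[of n] by (auto simp: top_unique)
qed

lemma B_0: "B 0 = A 0"
  by (simp add: B_def disjointed_def)

lemma B_disjoint_A: "m < n \<Longrightarrow> B n \<inter> A m = {}"
  unfolding B_def disjointed_def by auto

lemma UN_B: "(\<Union>n\<le>m. B n) = A m"
proof -
  have "(\<Union>n\<le>m. B n) = (\<Union>n\<in>{0..<Suc m}. B n)" by (simp add: atLeast0LessThan lessThan_Suc_atMost)
  also have "\<dots> = (\<Union>n\<in>{0..<Suc m}. A n)" unfolding B_def by (rule finite_UN_disjointed_eq)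
  also have "\<dots> = A m"
  proof
    show "(\<Union>n\<in>{0..<Suc m}. A n) \<subseteq> A m"
      using A_mono by (intro UN_least) (simp add: incseq_def less_Suc_eq_le)
  qed auto
  finally show ?thesis .
qed

lemma rate_nonneg: "0 \<le> rate n"
  using delta by (simp add: rate_def)

lemma sets_PB [simp, measurable_cong]: "sets (PB n) = sets \<nu>"
  by (simp add: PB_def)

lemma space_PB [simp]: "space (PB n) = UNIV"
  by (simp add: PB_def space_nu)

lemma prob_space_PB: "prob_space (PB n)"
proof (cases "measure \<nu> (B n) = 0")
  case True
  then show ?thesis by (simp add: PB_def prob_space_return space_nu)
next
  case False
  then have "emeasure \<nu> (B n) \<noteq> 0" by (auto simp: measure_def)
  then show ?thesis
    using False B_finite[of UNIV n] by (simp add: PB_def prob_space_uniform_measure)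
qed

lemma rate_PB:
  assumes "T \<in> sets \<nu>" shows "rate n * measure (PB n) T = \<delta> * measure \<nu> (B n \<inter> T)"
proof (cases "measure \<nu> (B n) = 0")
  case True
  have "measure \<nu> (B n \<inter> T) \<le> measure \<nu> (B n)"
    using assms B_finite[of UNIV n] by (intro measure_mono_fmeasurable fmeasurableI) (auto simp: less_top)
  then show ?thesis using True measure_nonneg[of \<nu> "B n \<inter> T"] by (simp add: rate_def)
next
  case False
  then have "emeasure \<nu> (B n) \<noteq> 0" by (auto simp: measure_def)
  then show ?thesis
    using False B_finite[of UNIV n] assms by (simp add: PB_def rate_def)
qed

lemma rate_integral_PB:
  fixes g :: "'s \<Rightarrow> real"
  assumes [measurable]: "g \<in> borel_measurable \<nu>"
  shows "rate n * (\<integral>f. g f \<partial>PB n) = \<delta> * (\<integral>f. indicator (B n) f * g f \<partial>\<nu>)"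
proof (cases "measure \<nu> (B n) = 0")
  case True
  then have "emeasure \<nu> (B n) = 0"
    using B_finite[of UNIV n] by (simp add: emeasure_eq_ennreal_measure)
  then have "AE f in \<nu>. f \<notin> B n"
    by (intro AE_not_in) (simp add: null_sets_def)
  then have "(\<integral>f. indicator (B n) f * g f \<partial>\<nu>) = (\<integral>f. 0 \<partial>\<nu>)"
    by (intro integral_cong_AE) (auto elim!: eventually_mono)
  then show ?thesis using True by (simp add: rate_def)
next
  case False
  let ?m = "measure \<nu> (B n)"
  have m: "emeasure \<nu> (B n) = ennreal ?m" "0 < ?m"
    using B_finite[of UNIV n] False by (simp_all add: emeasure_eq_ennreal_measure zero_less_measure_iff)
  have "PB n = density \<nu> (\<lambda>f. ennreal (indicator (B n) f / ?m))"
    using False m unfolding PB_def uniform_measure_def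
    by (auto intro!: density_cong simp: divide_ennreal[of 1, simplified] split: split_indicator)
  then have "(\<integral>f. g f \<partial>PB n) = (\<integral>f. indicator (B n) f / ?m * g f \<partial>\<nu>)"
    using m by (simp add: integral_density)
  also have "\<dots> = (\<integral>f. indicator (B n) f * g f \<partial>\<nu>) / ?m"
    by simp
  finally show ?thesis using m by (simp add: rate_def)
qed

lemma prob_space_piece: "prob_space (piece n)"
  unfolding piece_def by (intro prob_space_pair prob_space_PiM prob_space_PB prob_space_measure_pmf)

lemma prob_space_rest: "prob_space rest_space"
  unfolding rest_space_def by (intro prob_space_PiM prob_space_piece)

lemma prob_space_full: "prob_space full_space"
  unfolding full_space_def by (intro prob_space_pair prob_space_piece prob_space_rest)

lemma space_piece [simp]: "space (piece n) = UNIV"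
  by (simp add: piece_def space_pair_measure space_PiM)

lemma space_rest [simp]: "space rest_space = UNIV"
  by (simp add: rest_space_def space_PiM)

lemma space_full [simp]: "space full_space = UNIV"
  by (simp add: full_space_def space_pair_measure)

lemma measurable_piece_fst [measurable]: "fst \<in> piece n \<rightarrow>\<^sub>M count_space UNIV"
  unfolding piece_def
  by (subst measurable_cong_sets[OF refl sets_measure_pmf_count_space[symmetric]]) (rule measurable_fst)

lemma measurable_piece_snd [measurable]: "(\<lambda>p. snd p j) \<in> piece n \<rightarrow>\<^sub>M \<nu>"
proof -
  have "(\<lambda>p. snd p j) \<in> piece n \<rightarrow>\<^sub>M PB n"
    unfolding piece_def by measurable
  then show ?thesis by (simp cong: measurable_cong_sets)
qed

lemma measurable_pt [measurable]: "(\<lambda>p. pt n p j) \<in> borel_measurable (piece n)"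
  unfolding pt_def by measurable

lemma measurable_part [measurable]: "part n \<in> borel_measurable (piece n)"
proof -
  have "(\<lambda>p. cfun_Max (pt n p) m) \<in> borel_measurable (piece n)" for m
    by (induction m) (simp_all, measurable)
  then show ?thesis
    unfolding part_def[abs_def] by (rule measurable_compose_countable) measurable
qed

lemma part_nonneg: "0 \<le> apply_cfun (part n p) t $ i"
  unfolding part_def by (rule cfun_Max_nonneg)

lemma c_nonneg: "0 \<le> c"
  using Z_nonneg Z_le order_trans by blast

lemma part_le_iff:
  "apply_cfun (part n p) t $ i \<le> y \<longleftrightarrow>
    0 \<le> y \<and> (\<forall>j<fst p. snd p j \<in> B n \<longrightarrow> apply_cfun (Z (snd p j)) t $ i \<le> y)"
  unfolding part_def cfun_Max_le_iff by (auto simp: pt_def)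

lemma part_le: "apply_cfun (part n p) t $ i \<le> c"
  unfolding part_le_iff using c_nonneg Z_le by blast

lemma part_vanish:
  assumes "m < n" "t \<in> K (k + m)" shows "apply_cfun (part n p) t $ i = 0"
proof -
  have "apply_cfun (part n p) t $ i \<le> 0"
    unfolding part_le_iff
  proof safe
    fix j assume "snd p j \<in> B n"
    then have "snd p j \<notin> A m" using B_disjoint_A[OF assms(1)] by auto
    then show "apply_cfun (Z (snd p j)) t $ i \<le> 0" using Z_out[OF _ assms(2)] by simp
  qed
  then show ?thesis using part_nonneg[of n p t i] by simp
qed

lemma bdd_part: "bdd_above (range (\<lambda>n. apply_cfun (part (Suc n) (\<omega> n)) t $ i))"
  using part_le by (intro bdd_aboveI2)

lemma apply_rest: "apply_cfun (rest \<omega>) t $ i = (SUP n. apply_cfun (part (Suc n) (\<omega> n)) t $ i)"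
proof -
  have "continuous_on UNIV (\<lambda>t. \<chi> i. SUP n. apply_cfun (part (Suc n) (\<omega> n)) t $ i)"
  proof (rule continuous_on_locally_eq)
    fix t
    obtain m U where U: "m \<ge> 1" "open U" "t \<in> U" "U \<subseteq> K m" using nbhd by blast
    have U': "U \<subseteq> K (k + m)" using U K_mono[of m "k + m"] by auto
    \<comment> \<open>On \<open>U\<close> the parts with index above \<open>m\<close> vanish, so the
      supremum is a finite maximum there.\<close>
    let ?g = "cfun_Max (\<lambda>n. part (Suc n) (\<omega> n)) m"
    have eq: "(SUP n. apply_cfun (part (Suc n) (\<omega> n)) s $ i) = apply_cfun ?g s $ i" if "s \<in> U" for s i
    proof (rule antisym)
      have "apply_cfun (part (Suc n) (\<omega> n)) s $ i \<le> apply_cfun ?g s $ i" for n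
      proof (cases "n < m")
        case True
        then show ?thesis using cfun_Max_le_iff[of "\<lambda>n. part (Suc n) (\<omega> n)" m s i] by blast
      next
        case False
        then have "apply_cfun (part (Suc n) (\<omega> n)) s $ i = 0"
          using part_vanish[of m "Suc n" s "\<omega> n"] that U' by auto
        then show ?thesis using cfun_Max_nonneg by simp
      qed
      then show "(SUP n. apply_cfun (part (Suc n) (\<omega> n)) s $ i) \<le> apply_cfun ?g s $ i"
        by (intro cSUP_least) auto
      show "apply_cfun ?g s $ i \<le> (SUP n. apply_cfun (part (Suc n) (\<omega> n)) s $ i)"
        unfolding cfun_Max_le_iff
        by (auto intro!: cSUP_upper bdd_part cSUP_upper2[OF bdd_part] part_nonneg)
    qed
    show "\<exists>U g. open U \<and> t \<in> U \<and> continuous_on UNIV g \<and>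
        (\<forall>s\<in>U. (\<chi> i. SUP n. apply_cfun (part (Suc n) (\<omega> n)) s $ i) = g s)"
      by (rule exI[of _ U], rule exI[of _ "apply_cfun ?g"])
        (simp add: U continuous_apply_cfun vec_eq_iff eq)
  qed
  then show ?thesis
    unfolding rest_def by (subst Cfun_inverse) simp_all
qed

lemma rest_le_iff: "apply_cfun (rest \<omega>) t $ i \<le> y \<longleftrightarrow> (\<forall>n. apply_cfun (part (Suc n) (\<omega> n)) t $ i \<le> y)"
  unfolding apply_rest using cSUP_le_iff[OF _ bdd_part, of \<omega> t i y] by auto

lemma rest_nonneg: "0 \<le> apply_cfun (rest \<omega>) t $ i"
  using rest_le_iff[of \<omega> t i "apply_cfun (rest \<omega>) t $ i"] part_nonneg order_trans by blast

lemma rest_le: "apply_cfun (rest \<omega>) t $ i \<le> c"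
  unfolding rest_le_iff using part_le by blast

lemma rest_vanish: "t \<in> K k \<Longrightarrow> apply_cfun (rest \<omega>) t = 0"
  using part_vanish[of 0] by (simp add: vec_eq_iff apply_rest)

lemma measurable_rest_component [measurable]: "(\<lambda>\<omega>. \<omega> n) \<in> rest_space \<rightarrow>\<^sub>M piece (Suc n)"
  unfolding rest_space_def by (rule measurable_component_singleton) simp

lemma measurable_rest [measurable]: "rest \<in> borel_measurable rest_space"
proof (rule measurable_fieldI)
  fix t i
  have "(\<lambda>\<omega>. SUP n\<in>UNIV. apply_cfun (part (Suc n) (\<omega> n)) t $ i) \<in> borel_measurable rest_space"
    by (intro borel_measurable_cSUP bdd_part countableI_type) measurable
  then show "(\<lambda>\<omega>. apply_cfun (rest \<omega>) t $ i) \<in> borel_measurable rest_space"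
    by (simp add: apply_rest)
qed

lemma measurable_full [measurable]: "full \<in> borel_measurable full_space"
  unfolding full_def[abs_def] full_space_def by measurable

lemma full_nonneg: "0 \<le> apply_cfun (full \<omega>) t $ i"
  and full_le: "apply_cfun (full \<omega>) t $ i \<le> c"
  using part_nonneg part_le rest_le by (auto simp: full_def le_max_iff_disj)

section \<open>Void probabilities and stationarity\<close>

definition void :: "nat \<Rightarrow> 's set \<Rightarrow> (nat \<times> (nat \<Rightarrow> 's)) set" where
  "void n T = {p. \<forall>j<fst p. snd p j \<notin> T \<inter> B n}"

lemma void_sets [measurable]:
  assumes [measurable]: "T \<in> sets \<nu>" shows "void n T \<in> sets (piece n)"
proof -
  have "{p \<in> space (piece n). \<forall>j. j < fst p \<longrightarrow> snd p j \<notin> T \<inter> B n} \<in> sets (piece n)"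
    by measurable
  then show ?thesis by (simp add: void_def)
qed

text \<open>Given the number \<open>m\<close> of points, they miss \<open>T \<inter> B n\<close>
  independently; averaging over \<open>m\<close> is the generating function of the Poisson
  law.\<close>

lemma emeasure_void:
  assumes T [measurable]: "T \<in> sets \<nu>"
  shows "emeasure (piece n) (void n T) = ennreal (exp (- (\<delta> * measure \<nu> (B n \<inter> T))))"
proof -
  interpret P: prob_space "PB n" by (rule prob_space_PB)
  interpret PP: product_prob_space "\<lambda>_. PB n" "UNIV :: nat set"
    by (intro product_prob_spaceI prob_space_PB)
  let ?x = "1 - measure (PB n) (B n \<inter> T)"
  have "emeasure (PiM UNIV (\<lambda>_. PB n)) (Pair m -` void n T) = ennreal (?x ^ m)" for m :: nat
  proof -
    have "Pair m -` void n T = prod_emb UNIV (\<lambda>_. PB n) {..<m} (Pi\<^sub>E {..<m} (\<lambda>_. UNIV - (B n \<inter> T)))"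
      by (simp add: set_eq_iff void_def prod_emb_def PiE_iff restrict_def extensional_def) blast
    then have "emeasure (PiM UNIV (\<lambda>_. PB n)) (Pair m -` void n T)
        = (\<Prod>j<m. emeasure (PB n) (UNIV - (B n \<inter> T)))"
      by (simp only:) (rule PP.emeasure_PiM_emb, use sets.compl_sets[of "B n \<inter> T" "PB n"] in auto)
    also have "emeasure (PB n) (UNIV - (B n \<inter> T)) = ennreal ?x"
      using P.prob_compl[of "B n \<inter> T"] by (simp add: P.emeasure_eq_measure)
    finally show ?thesis by (simp add: ennreal_power)
  qed
  then have "emeasure (piece n) (void n T) = (\<integral>\<^sup>+m. ennreal (?x ^ m) \<partial>measure_pmf (poisson_law (rate n)))"
    using void_sets[OF T, of n] unfolding piece_def by (simp add: PP.emeasure_pair_measure_alt)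
  also have "\<dots> = ennreal (exp (- (rate n * measure (PB n) (B n \<inter> T))))"
    by (subst nn_integral_poisson_law_power) (simp_all add: rate_nonneg)
  also have "rate n * measure (PB n) (B n \<inter> T) = \<delta> * measure \<nu> (B n \<inter> T)"
    by (subst rate_PB) (simp_all add: Int_absorb1)
  finally show ?thesis .
qed

text \<open>Since \<open>T \<subseteq> A m\<close>, only finitely many pieces carry a nontrivial
  condition, and the event is a cylinder in the infinite product. The exponents add up over the
  disjoint sets \<open>B n \<inter> T\<close>.\<close>

lemma emeasure_full_void:
  assumes T [measurable]: "T \<in> sets \<nu>" and sub: "T \<subseteq> A m"
  shows "emeasure full_space (void 0 T \<times> {\<omega>. \<forall>n. \<omega> n \<in> void (Suc n) T}) = ennreal (exp (- (\<delta> * measure \<nu> T)))"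
proof -
  interpret R: prob_space rest_space by (rule prob_space_rest)
  interpret PP: product_prob_space "\<lambda>n. piece (Suc n)" "UNIV :: nat set"
    by (intro product_prob_spaceI prob_space_piece)
  have triv: "void (Suc n) T = UNIV" if "m \<le> n" for n
    using B_disjoint_A[of m "Suc n"] sub that by (auto simp: void_def)
  have eq: "{\<omega>. \<forall>n. \<omega> n \<in> void (Suc n) T} =
      prod_emb UNIV (\<lambda>n. piece (Suc n)) {..<m} (Pi\<^sub>E {..<m} (\<lambda>n. void (Suc n) T))"
  proof -
    have "(\<forall>n. \<omega> n \<in> void (Suc n) T) \<longleftrightarrow> (\<forall>n<m. \<omega> n \<in> void (Suc n) T)" for \<omega>
      using triv by (metis UNIV_I not_le)
    then show ?thesis by (auto simp: prod_emb_def PiE_iff restrict_def extensional_def)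
  qed
  have R: "emeasure rest_space {\<omega>. \<forall>n. \<omega> n \<in> void (Suc n) T}
      = (\<Prod>n<m. ennreal (exp (- (\<delta> * measure \<nu> (B (Suc n) \<inter> T)))))"
    unfolding eq rest_space_def
    by (subst PP.emeasure_PiM_emb) (simp_all add: emeasure_void)
  have "{\<omega>. \<forall>n. \<omega> n \<in> void (Suc n) T} \<in> sets rest_space"
    unfolding eq rest_space_def by (intro sets_PiM_I) auto
  then have "emeasure full_space (void 0 T \<times> {\<omega>. \<forall>n. \<omega> n \<in> void (Suc n) T})
      = ennreal (exp (- (\<delta> * measure \<nu> (B 0 \<inter> T)))) * (\<Prod>n<m. ennreal (exp (- (\<delta> * measure \<nu> (B (Suc n) \<inter> T)))))"
    unfolding full_space_def by (subst R.emeasure_pair_measure_Times) (simp_all add: R emeasure_void)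
  also have "\<dots> = (\<Prod>n\<le>m. ennreal (exp (- (\<delta> * measure \<nu> (B n \<inter> T)))))"
    by (simp add: prod.atMost_shift)
  also have "\<dots> = ennreal (exp (- (\<delta> * (\<Sum>n\<le>m. measure \<nu> (B n \<inter> T)))))"
    by (simp add: prod_ennreal exp_sum[symmetric] sum_negf sum_distrib_left)
  also have "(\<Sum>n\<le>m. measure \<nu> (B n \<inter> T)) = measure \<nu> (\<Union>n\<le>m. B n \<inter> T)"
  proof (rule measure_finite_Union[symmetric])
    show "disjoint_family_on (\<lambda>n. B n \<inter> T) {..m}"
      using disjoint_family_disjointed[of A] unfolding B_def disjoint_family_on_def by blast
    show "emeasure \<nu> (B i \<inter> T) \<noteq> \<infinity>" for i
      using B_finite[of T i] by (simp add: Int_commute)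
  qed auto
  also have "(\<Union>n\<le>m. B n \<inter> T) = T"
    using UN_B[of m] sub by auto
  finally show ?thesis .
qed

definition exceed :: "('t \<times> 'p) set \<Rightarrow> ('t \<times> 'p \<Rightarrow> real) \<Rightarrow> 's set" where
  "exceed J y = {f. \<exists>(t, i)\<in>J. y (t, i) < apply_cfun (Z f) t $ i}"

lemma exceed_sets:
  assumes J: "finite J" shows "exceed J y \<in> sets \<nu>"
proof -
  have "{f\<in>space \<nu>. \<exists>j\<in>J. y j < apply_cfun (Z f) (fst j) $ snd j} \<in> sets \<nu>"
    by (intro sets.sets_Collect_countable_Ex' countable_finite[OF J]) measurable
  then show ?thesis by (simp add: exceed_def space_nu case_prod_beta)
qed

text \<open>The field stays below \<open>y\<close> on \<open>J\<close> exactly when no point falls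
  into \<open>exceed J y\<close>. A negative bound is never met, because the field is nonnegative
  even without points; nonnegative bounds confine \<open>exceed J y\<close> to some
  \<open>A m\<close>.\<close>

lemma full_distribution:
  assumes J: "finite J"
  shows "emeasure full_space {\<omega>. \<forall>(t, i)\<in>J. apply_cfun (full \<omega>) t $ i \<le> y (t, i)} =
    (if \<forall>j\<in>J. 0 \<le> y j then ennreal (exp (- (\<delta> * measure \<nu> (exceed J y)))) else 0)"
proof (cases "\<forall>j\<in>J. 0 \<le> y j")
  case False
  then obtain t i where "(t, i) \<in> J" "y (t, i) < 0" by (auto simp: not_le)
  then have "\<not> (\<forall>(t, i)\<in>J. apply_cfun (full \<omega>) t $ i \<le> y (t, i))" for \<omega>
    using full_nonneg[of \<omega> t i] by fastforce
  then have "{\<omega>. \<forall>(t, i)\<in>J. apply_cfun (full \<omega>) t $ i \<le> y (t, i)} = {}" by blast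
  then show ?thesis using False by (simp only: if_False emeasure_empty)
next
  case True
  have T [measurable]: "exceed J y \<in> sets \<nu>"
    by (rule exceed_sets[OF J])
  obtain m where m: "fst ` J \<subseteq> K (k + m)"
  proof -
    obtain m where "1 \<le> m" "fst ` J \<subseteq> K m"
      using compact_subset_K[OF finite_imp_compact[of "fst ` J"]] J by auto
    then show ?thesis using that[of m] K_mono[of m "k + m"] by auto
  qed
  have sub: "exceed J y \<subseteq> A m"
  proof
    fix f assume "f \<in> exceed J y"
    then obtain t i where *: "(t, i) \<in> J" "y (t, i) < apply_cfun (Z f) t $ i" by (auto simp: exceed_def)
    then have "0 < apply_cfun (Z f) t $ i" using True by force
    moreover have "t \<in> K (k + m)" using m *(1) by force
    ultimately show "f \<in> A m" using Z_out[of f m t] by (metis less_irrefl zero_index)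
  qed
  have void_iff: "p \<in> void n (exceed J y) \<longleftrightarrow> (\<forall>j\<in>J. apply_cfun (part n p) (fst j) $ snd j \<le> y j)" for n p
    unfolding part_le_iff void_def exceed_def using True by (fastforce simp: not_less)
  have "{\<omega>. \<forall>(t, i)\<in>J. apply_cfun (full \<omega>) t $ i \<le> y (t, i)} =
      void 0 (exceed J y) \<times> {\<omega>. \<forall>n. \<omega> n \<in> void (Suc n) (exceed J y)}"
    unfolding full_def void_iff set_eq_iff mem_Times_iff mem_Collect_eq case_prod_beta
    by (simp add: rest_le_iff) blast
  then show ?thesis
    using emeasure_full_void[OF T sub] True by simp
qed

text \<open>The pieces are cut along a fixed exhaustion, which shifts need not respect. The
  finite-dimensional distributions, however, depend only on the masses of the exceedance sets, and
  these are preserved by \<open>\<theta>\<close>.\<close>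

lemma stationary:
  assumes \<theta> [measurable]: "\<theta> \<in> \<nu> \<rightarrow>\<^sub>M \<nu>" and inv: "distr \<nu> \<nu> \<theta> = \<nu>"
    and equi: "\<And>f. Z (\<theta> f) = shift h (Z f)"
  shows "distr full_space borel (\<lambda>\<omega>. shift h (full \<omega>)) = distr full_space borel full"
proof (rule measure_eqI_cfun[OF basis])
  interpret F: prob_space full_space by (rule prob_space_full)
  show "finite_measure (distr full_space borel (\<lambda>\<omega>. shift h (full \<omega>)))"
    by (intro F.finite_measure_distr) measurable
  fix J :: "('t \<times> 'p) set" and y :: "'t \<times> 'p \<Rightarrow> real" assume J: "finite J"
  let ?S = "{f. \<forall>(t, i)\<in>J. apply_cfun f t $ i \<le> y (t, i)}"
  have S: "?S \<in> sets borel"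
  proof -
    have "{f\<in>space borel. \<forall>j\<in>J. apply_cfun f (fst j) $ snd j \<le> y j} \<in> sets borel"
      by (intro sets.sets_Collect_countable_All' countable_finite[OF J]) measurable
    then show ?thesis by (simp add: case_prod_beta)
  qed
  define J' where "J' = (\<lambda>(t, i). (t - h, i)) ` J"
  define y' where "y' = (\<lambda>(t, i). y (t + h, i) :: real)"
  have J': "finite J'" unfolding J'_def using J by simp
  have exc: "exceed J' y' = \<theta> -` exceed J y \<inter> space \<nu>"
    by (simp add: set_eq_iff exceed_def J'_def y'_def equi space_nu case_prod_beta)
  have "exceed J y \<in> sets \<nu>"
    by (rule exceed_sets[OF J])
  then have "measure \<nu> (exceed J' y') = measure \<nu> (exceed J y)"
    unfolding exc using measure_distr[OF \<theta>, of "exceed J y"] inv by simp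
  moreover have "(\<forall>j\<in>J'. 0 \<le> y' j) \<longleftrightarrow> (\<forall>j\<in>J. 0 \<le> y j)"
    by (auto simp: J'_def y'_def)
  moreover have "emeasure (distr full_space borel (\<lambda>\<omega>. shift h (full \<omega>))) ?S =
      emeasure full_space {\<omega>. \<forall>(t, i)\<in>J'. apply_cfun (full \<omega>) t $ i \<le> y' (t, i)}"
    using S by (subst emeasure_distr) (auto simp: J'_def y'_def intro!: arg_cong[where f="emeasure full_space"])
  moreover have "emeasure (distr full_space borel full) ?S =
      emeasure full_space {\<omega>. \<forall>(t, i)\<in>J. apply_cfun (full \<omega>) t $ i \<le> y (t, i)}"
    using S by (subst emeasure_distr) (auto intro!: arg_cong[where f="emeasure full_space"])
  ultimately show "emeasure (distr full_space borel (\<lambda>\<omega>. shift h (full \<omega>))) ?S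
      = emeasure (distr full_space borel full) ?S"
    by (simp add: full_distribution[OF J] full_distribution[OF J'])
qed simp_all

text \<open>To first order in \<open>\<delta>\<close> the field sees \<open>A 0\<close> through a single Poisson point; the remaining points
  do not reach \<open>K k\<close>.\<close>

lemma single_point_approximation:
  fixes H :: "('t, real^'p) cfun \<Rightarrow> real"
  assumes H [measurable]: "H \<in> borel_measurable borel" and b: "0 \<le> b"
    and H_le: "\<And>h. (\<And>t i. 0 \<le> apply_cfun h t $ i \<and> apply_cfun h t $ i \<le> c) \<Longrightarrow> \<bar>H h\<bar> \<le> b"
    and H_rest: "\<And>\<omega>. H (rest \<omega>) = 0"
  defines "\<mu> \<equiv> \<delta> * measure \<nu> (A 0)"
  shows "\<bar>(\<integral>\<omega>. H (full \<omega>) \<partial>full_space) -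
      exp (- \<mu>) * \<delta> * (\<integral>f. indicator (A 0) f * (\<integral>\<omega>. H (cfun_max (Z f) (rest \<omega>)) \<partial>rest_space) \<partial>\<nu>)\<bar> \<le> b * \<mu>\<^sup>2"
proof -
  interpret F: prob_space full_space by (rule prob_space_full)
  interpret R: prob_space rest_space by (rule prob_space_rest)
  interpret P: prob_space "piece 0" by (rule prob_space_piece)
  interpret PB: prob_space "PB 0" by (rule prob_space_PB)
  interpret X: prob_space "\<Pi>\<^sub>M j\<in>UNIV::nat set. PB 0" by (intro prob_space_PiM prob_space_PB)
  interpret PR: pair_sigma_finite "piece 0" rest_space by unfold_locales
  interpret NX: pair_sigma_finite "measure_pmf (poisson_law (rate 0))" "\<Pi>\<^sub>M j\<in>UNIV::nat set. PB 0"
    by unfold_locales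
  have mu: "rate 0 = \<mu>" by (simp add: rate_def \<mu>_def B_0)
  define G where "G f \<omega> = H (cfun_max (Z f) (rest \<omega>))" for f \<omega>
  define g where "g f = indicator (A 0) f * (\<integral>\<omega>. G f \<omega> \<partial>rest_space)" for f
  define one where "one p = (indicator {1} (fst p) :: real)" for p :: "nat \<times> (nat \<Rightarrow> 's)"
  define two where "two p = (indicator {2..} (fst p) :: real)" for p :: "nat \<times> (nat \<Rightarrow> 's)"
  have [measurable]: "one \<in> borel_measurable (piece 0)" "two \<in> borel_measurable (piece 0)"
    unfolding one_def two_def
    by (rule measurable_compose[OF measurable_piece_fst], simp)+
  have [simp]: "R.prob UNIV = 1" "PB.prob UNIV = 1"
    using R.prob_space PB.prob_space by simp_all
  have G_le: "\<bar>G f \<omega>\<bar> \<le> b" for f \<omega>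
    unfolding G_def using Z_nonneg Z_le rest_le by (intro H_le) (auto simp: le_max_iff_disj)
  have G_meas: "(\<lambda>(f, \<omega>). G f \<omega>) \<in> borel_measurable (\<nu> \<Otimes>\<^sub>M rest_space)"
    unfolding G_def by measurable
  then have [measurable]: "(\<lambda>f. \<integral>\<omega>. G f \<omega> \<partial>rest_space) \<in> borel_measurable \<nu>"
    by (rule R.borel_measurable_lebesgue_integral)
  have [measurable]: "g \<in> borel_measurable \<nu>"
    unfolding g_def by measurable
  have G_int: "integrable rest_space (\<lambda>\<omega>. G f \<omega>)" for f
    using G_le unfolding G_def by (intro R.integrable_const_bound[of _ b]) auto
  have g_le: "\<bar>g f\<bar> \<le> b" for f
  proof -
    have "\<bar>\<integral>\<omega>. G f \<omega> \<partial>rest_space\<bar> \<le> (\<integral>\<omega>. b \<partial>rest_space)"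
      using G_le G_int by (intro integral_abs_bound[THEN order_trans] integral_mono) auto
    then show ?thesis using b by (auto simp: g_def split: split_indicator)
  qed
  \<comment> \<open>Without points in piece 0 the field is \<open>rest\<close>, where
    \<open>H\<close> vanishes. One point gives its path superposed with \<open>rest\<close> if it
    lies in \<open>A 0\<close>, and again \<open>rest\<close> otherwise. The case of two or more
    points is left as it is and bounded by its probability.\<close>
  have decomp: "H (full (p, \<omega>)) = one p * (indicator (A 0) (snd p 0) * G (snd p 0) \<omega>) + two p * H (full (p, \<omega>))" for p \<omega>
  proof -
    consider "fst p = 0" | "fst p = 1" | "2 \<le> fst p" by linarith
    then show ?thesis
    proof cases
      case 1
      have "full (p, \<omega>) = rest \<omega>"
        using 1 rest_nonneg[of \<omega>] by (intro cfun_eqI) (simp add: full_def part_def vec_eq_iff max_def)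
      then show ?thesis using 1 H_rest by (simp add: one_def two_def)
    next
      case 2
      show ?thesis
      proof (cases "snd p 0 \<in> A 0")
        case True
        have "full (p, \<omega>) = cfun_max (Z (snd p 0)) (rest \<omega>)"
          using 2 True Z_nonneg by (intro cfun_eqI) (simp add: full_def part_def pt_def B_0 vec_eq_iff max_def)
        then show ?thesis using 2 True by (simp add: one_def two_def G_def)
      next
        case False
        have "full (p, \<omega>) = rest \<omega>"
          using 2 False rest_nonneg[of \<omega>]
          by (intro cfun_eqI) (simp add: full_def part_def pt_def B_0 vec_eq_iff max_def)
        then show ?thesis using 2 False H_rest by (simp add: one_def two_def)
      qed
    next
      case 3
      then show ?thesis by (simp add: one_def two_def)
    qed
  qed
  let ?u = "\<lambda>\<omega>. one (fst \<omega>) * (indicator (A 0) (snd (fst \<omega>) 0) * G (snd (fst \<omega>) 0) (snd \<omega>))"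
  let ?v = "\<lambda>\<omega>. two (fst \<omega>) * H (full \<omega>)"
  have full_le: "\<bar>H (full \<omega>)\<bar> \<le> b" for \<omega>
    using full_nonneg full_le by (intro H_le) auto
  have u_meas [measurable]: "?u \<in> borel_measurable full_space"
    using G_meas unfolding full_space_def G_def by measurable
  have u_int: "integrable full_space ?u"
  proof (rule F.integrable_const_bound[of _ b])
    show "AE \<omega> in full_space. norm (?u \<omega>) \<le> b"
      using G_le b by (auto simp: one_def abs_mult split: split_indicator)
  qed measurable
  have [measurable]: "(\<lambda>\<omega>. two (fst \<omega>)) \<in> borel_measurable full_space"
    unfolding full_space_def by measurable
  have v_int: "integrable full_space ?v"
  proof (rule F.integrable_const_bound[of _ b])
    show "AE \<omega> in full_space. norm (?v \<omega>) \<le> b"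
      using full_le b by (auto simp: two_def abs_mult split: split_indicator)
  qed measurable
  have two_int: "integrable full_space (\<lambda>\<omega>. two (fst \<omega>))"
  proof (rule F.integrable_const_bound[of _ 1])
    show "AE \<omega> in full_space. norm (two (fst \<omega>)) \<le> 1"
      by (auto simp: two_def split: split_indicator)
  qed measurable
  have pieceint: "(\<integral>p. s (fst p) * r (snd p 0) \<partial>piece 0)
      = (\<integral>n. s n \<partial>measure_pmf (poisson_law \<mu>)) * (\<integral>f. r f \<partial>PB 0)"
    if [measurable]: "r \<in> borel_measurable \<nu>" and s: "\<And>n. \<bar>s n\<bar> \<le> 1" and r: "\<And>f. \<bar>r f\<bar> \<le> d"
    for s r :: "_ \<Rightarrow> real" and d
  proof -
    have "integrable (piece 0) (\<lambda>p. s (fst p) * r (snd p 0))"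
    proof (rule P.integrable_const_bound[of _ d])
      have "\<bar>s n\<bar> * \<bar>r f\<bar> \<le> 1 * d" for n f
        using s r by (intro mult_mono) auto
      then show "AE p in piece 0. norm (s (fst p) * r (snd p 0)) \<le> d" by (simp add: abs_mult)
    qed measurable
    then have "(\<integral>p. s (fst p) * r (snd p 0) \<partial>piece 0) =
        (\<integral>n. (\<integral>x. s n * r (x 0) \<partial>(\<Pi>\<^sub>M j\<in>(UNIV::nat set). PB 0)) \<partial>measure_pmf (poisson_law \<mu>))"
      unfolding piece_def mu by (subst NX.integral_fst'[symmetric, unfolded mu]) simp_all
    also have "\<dots> = (\<integral>n. s n \<partial>measure_pmf (poisson_law \<mu>)) * (\<integral>x. r (x 0) \<partial>(\<Pi>\<^sub>M j\<in>(UNIV::nat set). PB 0))"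
      by simp
    also have "(\<integral>x. r (x 0) \<partial>(\<Pi>\<^sub>M j\<in>(UNIV::nat set). PB 0)) = (\<integral>f. r f \<partial>PB 0)"
    proof -
      have "(\<integral>x. r (x 0) \<partial>(\<Pi>\<^sub>M j\<in>(UNIV::nat set). PB 0)) = (\<integral>f. r f \<partial>distr (\<Pi>\<^sub>M j\<in>(UNIV::nat set). PB 0) (PB 0) (\<lambda>x. x 0))"
        by (subst integral_distr) (simp_all add: measurable_component_singleton)
      also have "distr (\<Pi>\<^sub>M j\<in>(UNIV::nat set). PB 0) (PB 0) (\<lambda>x. x 0) = PB 0"
      proof -
        interpret PP: product_prob_space "\<lambda>_. PB 0" "UNIV :: nat set"
          by (intro product_prob_spaceI prob_space_PB)
        show ?thesis by (rule PP.PiM_component) simp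
      qed
      finally show ?thesis .
    qed
    finally show ?thesis .
  qed
  have "(\<integral>\<omega>. ?u \<omega> \<partial>full_space) = (\<integral>p. (\<integral>\<omega>. ?u (p, \<omega>) \<partial>rest_space) \<partial>piece 0)"
    using u_int unfolding full_space_def by (rule PR.integral_fst'[symmetric])
  also have "\<dots> = (\<integral>p. indicator {1} (fst p) * g (snd p 0) \<partial>piece 0)"
    by (simp add: one_def g_def)
  also have "\<dots> = (\<integral>n. indicator {1} n \<partial>measure_pmf (poisson_law \<mu>)) * (\<integral>f. g f \<partial>PB 0)"
    by (rule pieceint[OF _ _ g_le]) auto
  also have "(\<integral>n. indicator {1} n \<partial>measure_pmf (poisson_law \<mu>)) = \<mu> * exp (- \<mu>)"
    using rate_nonneg[of 0] by (simp add: mu measure_pmf_single pmf_poisson_law)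
  also have "\<mu> * exp (- \<mu>) * (\<integral>f. g f \<partial>PB 0) = exp (- \<mu>) * (rate 0 * (\<integral>f. g f \<partial>PB 0))"
    by (simp add: mu)
  also have "rate 0 * (\<integral>f. g f \<partial>PB 0) = \<delta> * (\<integral>f. g f \<partial>\<nu>)"
    by (subst rate_integral_PB) (auto simp: B_0 g_def intro!: arg_cong[where f="integral\<^sup>L \<nu>"] split: split_indicator)
  finally have u_eq: "(\<integral>\<omega>. ?u \<omega> \<partial>full_space) = exp (- \<mu>) * \<delta> * (\<integral>f. g f \<partial>\<nu>)" by simp
  have "(\<integral>\<omega>. two (fst \<omega>) \<partial>full_space) = (\<integral>p. indicator {2..} (fst p) * 1 \<partial>piece 0)"
    using two_int unfolding full_space_def
    by (subst PR.integral_fst'[symmetric]) (simp_all add: two_def)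
  also have "\<dots> = measure (measure_pmf (poisson_law \<mu>)) {2..}"
    by (subst pieceint[of "\<lambda>_. 1" _ 1]) simp_all
  also have "\<dots> \<le> \<mu>\<^sup>2"
    using rate_nonneg[of 0] by (intro poisson_law_ge_2) (simp add: mu)
  finally have two_le: "(\<integral>\<omega>. two (fst \<omega>) \<partial>full_space) \<le> \<mu>\<^sup>2" .
  have "(\<integral>\<omega>. H (full \<omega>) \<partial>full_space) = (\<integral>\<omega>. ?u \<omega> + ?v \<omega> \<partial>full_space)"
    using decomp by (intro Bochner_Integration.integral_cong) (auto simp: split_beta)
  also have "\<dots> = (\<integral>\<omega>. ?u \<omega> \<partial>full_space) + (\<integral>\<omega>. ?v \<omega> \<partial>full_space)"
    by (rule Bochner_Integration.integral_add[OF u_int v_int])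
  finally have "\<bar>(\<integral>\<omega>. H (full \<omega>) \<partial>full_space) - exp (- \<mu>) * \<delta> * (\<integral>f. g f \<partial>\<nu>)\<bar>
      = \<bar>\<integral>\<omega>. ?v \<omega> \<partial>full_space\<bar>"
    by (simp add: u_eq)
  also have "\<dots> \<le> (\<integral>\<omega>. b * two (fst \<omega>) \<partial>full_space)"
    using full_le v_int two_int
    by (intro integral_abs_bound[THEN order_trans] integral_mono)
      (auto simp: two_def split: split_indicator)
  also have "\<dots> = b * (\<integral>\<omega>. two (fst \<omega>) \<partial>full_space)" by simp
  also have "\<dots> \<le> b * \<mu>\<^sup>2" using two_le b by (rule mult_left_mono)
  finally show ?thesis unfolding g_def G_def .
qed

end

section \<open>Mixing over scales\<close>

definition orthant :: "real \<Rightarrow> (real^'q) set" where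
  "orthant a = {y. \<forall>i. a \<le> y $ i}"

lemma sets_orthant [measurable]: "orthant a \<in> sets borel"
proof -
  have "{y\<in>space borel. \<forall>i\<in>UNIV. a \<le> y $ i} \<in> sets (borel :: (real^'q) measure)"
    by (intro sets.sets_Collect_countable_All' countable_finite finite) measurable
  then show ?thesis by (simp add: orthant_def)
qed

lemma nn_integral_exp_atLeast:
  assumes s: "0 < s"
  shows "(\<integral>\<^sup>+x. ennreal (indicator {a..} x * exp (- (s * x))) \<partial>lborel) = ennreal (exp (- (s * a)) / s)"
proof -
  have "(\<integral>\<^sup>+x. ennreal (exp (- (s * x))) * indicator {a..} x \<partial>lborel) = ennreal (0 - (- exp (- (s * a)) / s))"
  proof (rule nn_integral_FTC_atLeast)
    show "((\<lambda>x. - exp (- (s * x)) / s) has_real_derivative exp (- (s * x))) (at x)" for x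
      using s by (auto intro!: derivative_eq_intros)
    have "filterlim (\<lambda>x. - (s * x)) at_bot at_top"
      using s by (intro filterlim_uminus_at_bot_at_top[THEN filterlim_compose] filterlim_tendsto_pos_mult_at_top[OF tendsto_const] filterlim_ident)
    then have "((\<lambda>x. exp (- (s * x))) \<longlongrightarrow> 0) at_top"
      by (rule filterlim_compose[OF exp_at_bot])
    from tendsto_divide[OF tendsto_minus[OF this] tendsto_const[of s]] s
    show "((\<lambda>x. - exp (- (s * x)) / s) \<longlongrightarrow> 0) at_top" by simp
  qed simp_all
  then show ?thesis by (simp add: mult.commute ennreal_mult'' ennreal_indicator)
qed

text \<open>On the whole space the exponential density has infinite mass. A bounded path reaches a
  given window only if every coordinate of the scale is bounded below, that is, for scales in such
  an orthant.\<close>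

lemma integrable_exp_orthant:
  fixes \<alpha> :: "real^'q"
  assumes \<alpha>: "\<And>i. 0 < \<alpha> $ i"
  shows "integrable lborel (\<lambda>y. indicator (orthant a) y * exp (- (\<alpha> \<bullet> y)))"
proof (rule integrableI_bounded)
  have *: "indicator (orthant a) y * exp (- (\<alpha> \<bullet> y))
      = (\<Prod>b\<in>Basis. indicator {a..} (y \<bullet> b) * exp (- ((\<alpha> \<bullet> b) * (y \<bullet> b))))" for y :: "real^'q"
  proof -
    have "y \<in> orthant a \<longleftrightarrow> (\<forall>b\<in>Basis. a \<le> y \<bullet> b)"
      by (auto simp: orthant_def Basis_vec_def inner_axis)
    then have "(\<Prod>b\<in>Basis. indicator {a..} (y \<bullet> b)) = (indicator (orthant a) y :: real)"
      by (auto simp: indicator_def intro: prod.neutral)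
    then show ?thesis
      by (simp add: prod.distrib exp_sum[symmetric] sum_negf euclidean_inner[of \<alpha> y])
  qed
  have "(\<integral>\<^sup>+y. ennreal (indicator (orthant a) y * exp (- (\<alpha> \<bullet> y))) \<partial>lborel)
      = (\<integral>\<^sup>+y. (\<Prod>b\<in>Basis. ennreal (indicator {a..} (y \<bullet> b) * exp (- ((\<alpha> \<bullet> b) * (y \<bullet> b))))) \<partial>lborel)"
    unfolding * by (subst prod_ennreal) auto
  also have "\<dots> = (\<Prod>b\<in>Basis. (\<integral>\<^sup>+x. ennreal (indicator {a..} x * exp (- ((\<alpha> \<bullet> b) * x))) \<partial>lborel))"
    by (rule nn_integral_lborel_prod) auto
  also have "\<dots> < \<infinity>"
  proof -
    have "0 < \<alpha> \<bullet> b" if "b \<in> Basis" for b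
      using that \<alpha> by (auto simp: Basis_vec_def inner_axis)
    then have "(\<Prod>b\<in>Basis. (\<integral>\<^sup>+x. ennreal (indicator {a..} x * exp (- ((\<alpha> \<bullet> b) * x))) \<partial>lborel))
        = (\<Prod>b\<in>Basis. ennreal (exp (- ((\<alpha> \<bullet> b) * a)) / (\<alpha> \<bullet> b)))"
      by (intro prod.cong refl nn_integral_exp_atLeast)
    also have "\<dots> < \<infinity>"
      by (simp add: less_top[symmetric] ennreal_prod_eq_top)
    finally show ?thesis .
  qed
  finally show "(\<integral>\<^sup>+y. ennreal (norm (indicator (orthant a) y * exp (- (\<alpha> \<bullet> y)))) \<partial>lborel) < \<infinity>"
    by (simp add: abs_mult)
qed measurable

definition vmin :: "real^'q \<Rightarrow> real" where "vmin y = (MIN i. y $ i)"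

lemma vmin_le: "vmin y \<le> y $ i"
  unfolding vmin_def by (intro Min_le) auto

lemma vmin_ge_iff: "a \<le> vmin y \<longleftrightarrow> (\<forall>i. a \<le> y $ i)"
  unfolding vmin_def by (subst Min_ge_iff) auto

lemma vmin_diff_le: "vmin y - vmin z \<le> norm (y - z)"
proof -
  have "vmin y - norm (y - z) \<le> z $ i" for i
    using vmin_le[of y i] component_le_norm_cart[of "y - z" i] by (simp add: abs_le_iff)
  then show ?thesis using vmin_ge_iff[of "vmin y - norm (y - z)" z] by simp
qed

lemma vmin_lipschitz: "\<bar>vmin y - vmin z\<bar> \<le> norm (y - z)"
  using vmin_diff_le[of y z] vmin_diff_le[of z y] by (simp add: norm_minus_commute abs_le_iff)

lemma vmin_plus_ge: "vmin y + vmin z \<le> vmin (y + z)"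
  unfolding vmin_ge_iff by (auto intro: add_mono vmin_le)

lemma measurable_vmin [measurable]: "vmin \<in> borel_measurable borel"
proof (intro borel_measurable_continuous_onI)
  show "continuous_on UNIV (vmin :: real^'q \<Rightarrow> real)"
    unfolding continuous_on_iff dist_norm
    using vmin_lipschitz by (metis le_less_trans norm_conv_dist dist_norm real_norm_def)
qed

text \<open>A partition of unity in the variable \<open>vmin y\<close> that varies more slowly at each stage; it glues the
  levels together without the limit noticing the seams.\<close>

lemma slow_partition:
  fixes \<psi> :: "nat \<Rightarrow> real^'q \<Rightarrow> real" and a :: "nat \<Rightarrow> real"
  assumes [measurable]: "\<And>k. \<psi> k \<in> borel_measurable borel" and psi_nonneg: "\<And>k y. 0 \<le> \<psi> k y"
    and psi_int: "\<And>k x. integrable lborel (\<lambda>y. indicator (orthant x) y * \<psi> k y)"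
  obtains q :: "nat \<Rightarrow> real \<Rightarrow> real" and x0 :: real where
    "\<And>k. q k \<in> borel_measurable borel"
    "\<And>k x. 0 \<le> q k x" "\<And>k x. q k x \<le> 1"
    "\<And>x. x0 \<le> x \<Longrightarrow> (\<lambda>k. q k x) sums 1"
    "\<And>k. \<forall>\<^sub>F x in at_top. q k x = 0"
    "\<And>k. integrable lborel (\<lambda>y. \<psi> k y * q k (vmin y))"
    "\<And>k. (\<integral>y. \<psi> k y * q k (vmin y) \<partial>lborel) \<le> (1/2) ^ Suc k"
    "\<And>k z. (\<integral>y. indicator (orthant (a k)) y * \<psi> k y * \<bar>q k (vmin (y + z)) - q k (vmin z)\<bar> \<partial>lborel) \<le> 2 * (1/2) ^ k"
proof -
  \<comment> \<open>Up to the factor 2, \<open>E k e\<close> bounds the error of freezing a weight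
    whose ramps have slope at most \<open>e\<close>; dominated convergence sends it to 0 with
    \<open>e\<close>.\<close>
  define E where "E k e = (\<integral>y. indicator (orthant (a k)) y * \<psi> k y * min 1 (e * norm y) \<partial>lborel)" for k e
  have "\<exists>e>0. E k e \<le> (1/2) ^ k" for k
  proof -
    have "(\<lambda>n. \<integral>y. indicator (orthant (a k)) y * \<psi> k y * min 1 (inverse (real (Suc n)) * norm y) \<partial>lborel)
        \<longlonglongrightarrow> (\<integral>y. indicator (orthant (a k)) y * \<psi> k y * min 1 (0 * norm y) \<partial>lborel)"
    proof (rule integral_dominated_convergence)
      show "integrable lborel (\<lambda>y. indicator (orthant (a k)) y * \<psi> k y)" by (rule psi_int)
      show "AE y in lborel. norm (indicator (orthant (a k)) y * \<psi> k y * min 1 (inverse (real (Suc n)) * norm y))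
          \<le> indicator (orthant (a k)) y * \<psi> k y" for n
        using psi_nonneg by (auto simp: abs_mult min_def intro!: mult_left_le split: split_indicator)
      show "AE y in lborel. (\<lambda>n. indicator (orthant (a k)) y * \<psi> k y * min 1 (inverse (real (Suc n)) * norm y))
          \<longlonglongrightarrow> indicator (orthant (a k)) y * \<psi> k y * min 1 (0 * norm y)"
        by (intro AE_I2 tendsto_intros LIMSEQ_inverse_real_of_nat)
    qed measurable
    then have "(\<lambda>n. \<integral>y. indicator (orthant (a k)) y * \<psi> k y * min 1 (inverse (real (Suc n)) * norm y) \<partial>lborel) \<longlonglongrightarrow> 0"
      by simp
    from order_tendstoD(2)[OF this, of "(1/2) ^ k"]
    obtain n where "(\<integral>y. indicator (orthant (a k)) y * \<psi> k y * min 1 (inverse (real (Suc n)) * norm y) \<partial>lborel) < (1/2) ^ k"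
      by (auto simp: eventually_sequentially)
    then show ?thesis unfolding E_def by (intro exI[of _ "inverse (real (Suc n))"]) auto
  qed
  then obtain e where e: "\<And>k. 0 < e k"
      "\<And>k. E k (e k) \<le> (1/2) ^ k"
    by metis
  \<comment> \<open>Starting level \<open>k\<close> far out makes its mass small however large the
    factor hidden in \<open>\<psi> k\<close> is; the masses of all levels then sum to at most
    1.\<close>
  define L where "L k x = (\<integral>y. indicator (orthant x) y * \<psi> k y \<partial>lborel)" for k x
  have "\<exists>x. L k x \<le> (1/2) ^ Suc k" for k
  proof -
    have "(\<lambda>n. \<integral>y. indicator (orthant (real n)) y * \<psi> k y \<partial>lborel) \<longlonglongrightarrow> (\<integral>y. (0::real) \<partial>(lborel :: (real^'q) measure))"
    proof (rule integral_dominated_convergence)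
      show "integrable lborel (\<lambda>y. indicator (orthant 0) y * \<psi> k y)" by (rule psi_int)
      show "AE y in lborel. norm (indicator (orthant (real n)) y * \<psi> k y) \<le> indicator (orthant 0) y * \<psi> k y" for n
      proof (rule AE_I2)
        fix y :: "real^'q"
        have "orthant (real n) \<subseteq> (orthant 0 :: (real^'q) set)"
          using order_trans[OF of_nat_0_le_iff[of n]] unfolding orthant_def by blast
        then have "indicator (orthant (real n)) y \<le> (indicator (orthant 0) y :: real)"
          by (auto simp: indicator_def)
        from mult_right_mono[OF this psi_nonneg[of k y]]
        show "norm (indicator (orthant (real n)) y * \<psi> k y) \<le> indicator (orthant 0) y * \<psi> k y"
          using psi_nonneg[of k y] by (simp add: abs_mult)
      qed
      show "AE y in lborel. (\<lambda>n. indicator (orthant (real n)) y * \<psi> k y) \<longlonglongrightarrow> 0"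
      proof (rule AE_I2)
        fix y :: "real^'q"
        obtain N where N: "vmin y < real N" using reals_Archimedean2 by blast
        have "indicator (orthant (real n)) y * \<psi> k y = 0" if "N \<le> n" for n
          using that N vmin_ge_iff[of "real n" y] by (auto simp: orthant_def indicator_def)
        then have "\<forall>\<^sub>F n in sequentially. indicator (orthant (real n)) y * \<psi> k y = 0"
          by (auto simp: eventually_sequentially)
        then show "(\<lambda>n. indicator (orthant (real n)) y * \<psi> k y) \<longlonglongrightarrow> 0"
          by (rule tendsto_eventually)
      qed
    qed measurable
    then have "(\<lambda>n. \<integral>y. indicator (orthant (real n)) y * \<psi> k y \<partial>lborel) \<longlonglongrightarrow> 0" by simp
    from order_tendstoD(2)[OF this, of "(1/2) ^ Suc k"]
    obtain n where "(\<integral>y. indicator (orthant (real n)) y * \<psi> k y \<partial>lborel) < (1/2) ^ Suc k"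
      by (auto simp: eventually_sequentially)
    then show ?thesis unfolding L_def by (intro exI[of _ "real n"]) simp
  qed
  then obtain x where x: "\<And>k. L k (x k) \<le> (1/2) ^ Suc k"
    by metis
  \<comment> \<open>A running minimum, so that slopes never increase and both ramps that make up
    \<open>q k\<close> have slope at most \<open>e k\<close>.\<close>
  define \<eta> where "\<eta> k = Min (e ` {..k})" for k
  have eta_pos: "0 < \<eta> k" for k
    unfolding \<eta>_def using e(1) by (subst Min_gr_iff) auto
  have eta_le: "\<eta> k \<le> e k" for k
    unfolding \<eta>_def by (intro Min_le) auto
  have eta_Suc: "\<eta> (Suc k) \<le> \<eta> k" for k
    unfolding \<eta>_def by (intro Min_antimono) auto
  \<comment> \<open>The start of ramp \<open>k\<close>: beyond \<open>x k\<close>, at least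
    \<open>k\<close>, and far enough from the previous start for ramp \<open>k\<close> to be
    complete before ramp \<open>Suc k\<close> begins (\<open>m_step\<close>, where the decreasing
    slopes enter).\<close>
  define m where "m k = (\<Sum>j\<le>k. max 0 (x j) + 1 / \<eta> j + 1)" for k
  have m_Suc: "m (Suc k) = m k + (max 0 (x (Suc k)) + 1 / \<eta> (Suc k) + 1)" for k
    by (simp add: m_def)
  have m_ge: "real k \<le> m k \<and> x k \<le> m k" for k
  proof (induction k)
    case 0
    have "0 < 1 / \<eta> 0" using eta_pos[of 0] by simp
    moreover have "0 \<le> max 0 (x 0)" "x 0 \<le> max 0 (x 0)" by simp_all
    moreover have "m 0 = max 0 (x 0) + 1 / \<eta> 0 + 1" by (simp add: m_def)
    ultimately show ?case by linarith
  next
    case (Suc k)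
    moreover have "0 < 1 / \<eta> (Suc k)" using eta_pos[of "Suc k"] by simp
    moreover have "0 \<le> real k" by simp
    moreover have "0 \<le> max 0 (x (Suc k))" "x (Suc k) \<le> max 0 (x (Suc k))" by simp_all
    ultimately show ?case unfolding m_Suc[of k] by (simp only: of_nat_Suc) linarith
  qed
  have m_step: "m k + 1 / \<eta> k \<le> m (Suc k)" for k
    using m_Suc[of k] frac_le[of 1 1 "\<eta> (Suc k)" "\<eta> k"] eta_pos eta_Suc by simp
  define s where "s k u = max 0 (min 1 (\<eta> k * (u - m k)))" for k u
  define q where "q k u = s k u - s (Suc k) u" for k u
  have s01: "0 \<le> s k u" "s k u \<le> 1" for k u by (auto simp: s_def)
  have s0: "s k u = 0" if "u \<le> m k" for k u
  proof -
    have "\<eta> k * (u - m k) \<le> 0" using that eta_pos[of k] by (simp add: mult_le_0_iff)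
    then show ?thesis by (simp add: s_def)
  qed
  have s1: "s k u = 1" if "m k + 1 / \<eta> k \<le> u" for k u
  proof -
    have "1 / \<eta> k \<le> u - m k" using that by simp
    then have "1 \<le> \<eta> k * (u - m k)" using eta_pos[of k] by (simp add: pos_divide_le_eq mult.commute)
    then show ?thesis by (simp add: s_def)
  qed
  have q0: "0 \<le> q k u" for k u
  proof (cases "u \<le> m (Suc k)")
    case True then show ?thesis using s0[of u "Suc k"] s01[of k u] by (simp add: q_def)
  next
    case False
    then have "s k u = 1" using m_step[of k] by (intro s1) simp
    then show ?thesis using s01[of "Suc k" u] by (simp add: q_def)
  qed
  have q1: "q k u \<le> 1" for k u
    using s01[of k u] s01[of "Suc k" u] by (simp add: q_def)
  have s_lip: "\<bar>s k u - s k v\<bar> \<le> min 1 (\<eta> k * \<bar>u - v\<bar>)" for k u v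
  proof -
    have "\<bar>s k u - s k v\<bar> \<le> \<bar>\<eta> k * (u - m k) - \<eta> k * (v - m k)\<bar>"
      by (auto simp: s_def max_def min_def abs_le_iff)
    also have "\<dots> = \<eta> k * \<bar>u - v\<bar>"
      using eta_pos[of k] by (simp add: right_diff_distrib[symmetric] abs_mult)
    finally show ?thesis using s01[of k u] s01[of k v] by (simp add: abs_le_iff)
  qed
  have q_lip: "\<bar>q k u - q k v\<bar> \<le> 2 * min 1 (e k * \<bar>u - v\<bar>)" for k u v
  proof -
    have "\<eta> k * \<bar>u - v\<bar> \<le> e k * \<bar>u - v\<bar>" "\<eta> (Suc k) * \<bar>u - v\<bar> \<le> e k * \<bar>u - v\<bar>"
      using eta_le[of k] eta_Suc[of k] by (auto intro: mult_right_mono)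
    then show ?thesis
      using s_lip[of k u v] s_lip[of "Suc k" u v] unfolding q_def by linarith
  qed
  have q_meas [measurable]: "q k \<in> borel_measurable borel" for k
    unfolding q_def s_def by measurable
  have q_zero: "q k u = 0" if "u \<le> m k" for k u
    using that s0[of u k] s0[of u "Suc k"] m_step[of k] eta_pos[of k]
    by (simp add: q_def) (smt (verit) divide_pos_pos)
  have dom: "\<psi> k y * q k (vmin y) \<le> indicator (orthant (x k)) y * \<psi> k y" for k y
  proof (cases "y \<in> orthant (x k)")
    case True then show ?thesis using q1[of k] psi_nonneg[of k y] by (simp add: mult_left_le)
  next
    case False
    then have "vmin y \<le> m k" using vmin_ge_iff[of "x k" y] m_ge[of k] by (auto simp: orthant_def)
    then show ?thesis using q_zero psi_nonneg[of k y] by simp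
  qed
  have q_int: "integrable lborel (\<lambda>y. \<psi> k y * q k (vmin y))" for k
    by (rule Bochner_Integration.integrable_bound[OF psi_int[of "x k" k]])
      (use dom[of k] q0 psi_nonneg in \<open>auto simp: abs_mult abs_of_nonneg\<close>)
  show ?thesis
  proof (rule that[of q "m 0 + 1 / \<eta> 0"])
    show "(\<lambda>k. q k u) sums 1" if "m 0 + 1 / \<eta> 0 \<le> u" for u
    proof -
      have "(\<Sum>k<n. q k u) = s 0 u - s n u" for n
        by (induction n) (auto simp: q_def)
      moreover have "(\<lambda>n. s 0 u - s n u) \<longlonglongrightarrow> s 0 u - 0"
      proof (intro tendsto_intros tendsto_eventually)
        obtain N where N: "u \<le> real N" using real_arch_simple by blast
        have "s n u = 0" if "N \<le> n" for n
          using that N m_ge[of n] by (intro s0) (smt (verit) of_nat_le_iff)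
        then show "\<forall>\<^sub>F n in sequentially. s n u = 0" by (auto simp: eventually_sequentially)
      qed
      ultimately show ?thesis using s1[OF that] by (simp add: sums_def)
    qed
    show "\<forall>\<^sub>F u in at_top. q k u = 0" for k
      using eventually_ge_at_top[of "max (m k + 1 / \<eta> k) (m (Suc k) + 1 / \<eta> (Suc k))"]
      by eventually_elim (simp add: q_def s1)
    show "(\<integral>y. \<psi> k y * q k (vmin y) \<partial>lborel) \<le> (1/2) ^ Suc k" for k
      using integral_mono[OF q_int psi_int dom, of k] x[of k] unfolding L_def by simp
    show "(\<integral>y. indicator (orthant (a k)) y * \<psi> k y * \<bar>q k (vmin (y + z)) - q k (vmin z)\<bar> \<partial>lborel) \<le> 2 * (1/2) ^ k" for k z
    proof -
      let ?f = "\<lambda>y. indicator (orthant (a k)) y * \<psi> k y * min 1 (e k * norm y)"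
      have int: "integrable lborel ?f"
        using e(1)[of k] psi_nonneg
        by (intro Bochner_Integration.integrable_bound[OF psi_int[of "a k" k]])
          (auto simp: abs_mult min_def intro!: mult_left_le split: split_indicator)
      have "(\<integral>y. indicator (orthant (a k)) y * \<psi> k y * \<bar>q k (vmin (y + z)) - q k (vmin z)\<bar> \<partial>lborel)
          \<le> (\<integral>y. 2 * ?f y \<partial>lborel)"
      proof (rule integral_mono_AE')
        show "integrable lborel (\<lambda>y. 2 * ?f y)" using int by simp
        have "\<bar>q k (vmin (y + z)) - q k (vmin z)\<bar> \<le> 2 * min 1 (e k * norm y)" for y
        proof -
          have "e k * \<bar>vmin (y + z) - vmin z\<bar> \<le> e k * norm y"
            using vmin_lipschitz[of "y + z" z] e(1)[of k] by simp
          then show ?thesis using q_lip[of k "vmin (y + z)" "vmin z"] by linarith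
        qed
        from mult_left_mono[OF this, of "indicator (orthant (a k)) _ * \<psi> k _"]
        show "AE y in lborel. indicator (orthant (a k)) y * \<psi> k y * \<bar>q k (vmin (y + z)) - q k (vmin z)\<bar> \<le> 2 * ?f y"
          using psi_nonneg by (auto simp: mult_ac)
        show "AE y in lborel. 0 \<le> 2 * ?f y"
          using psi_nonneg e(1)[of k] by auto
      qed
      then show ?thesis using e(2)[of k] unfolding E_def by simp
    qed
  qed (use q_meas q0 q1 q_int in auto)
qed

section \<open>Mixtures of scaled stationary laws\<close>

context exhausted_group
begin

text \<open>The masses of the \<open>\<phi> k\<close> sum to some \<open>S \<le> 1\<close>, and the
  missing mass is given to the zero path, which a functional with \<open>G cfun_zero = 0\<close>
  does not see. One random scale is common to all points of the group, so mixing preserves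
  stationarity.\<close>

lemma mixture:
  fixes Q :: "nat \<Rightarrow> ('t, real^'q) cfun measure" and \<phi> :: "nat \<Rightarrow> real^'q \<Rightarrow> real"
  assumes Q: "\<And>k. prob_space (Q k)" "\<And>k. sets (Q k) = sets borel"
    and stat: "\<And>k h. distr (Q k) borel (shift h) = Q k"
    and phi_meas [measurable]: "\<And>k. \<phi> k \<in> borel_measurable borel"
    and phi: "\<And>k y. 0 \<le> \<phi> k y" "\<And>k. integrable lborel (\<phi> k)" "\<And>k. (\<integral>y. \<phi> k y \<partial>lborel) \<le> (1/2) ^ Suc k"
  obtains M :: "('t, real^'q) cfun measure" where "prob_space M" "sets M = sets borel"
    "\<And>h. distr M borel (shift h) = M"
    "\<And>G b. G \<in> borel_measurable borel \<Longrightarrow> (\<And>f. \<bar>G f\<bar> \<le> b) \<Longrightarrow> G cfun_zero = 0 \<Longrightarrow>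
      (\<lambda>k. \<integral>y. \<phi> k y * (\<integral>h. G (vexp y \<odot> h) \<partial>Q k) \<partial>lborel) sums (\<integral>f. G f \<partial>M)"
proof -
  define p where "p k = (\<integral>y. \<phi> k y \<partial>lborel)" for k
  have p0: "0 \<le> p k" for k unfolding p_def using phi(1) by (intro integral_nonneg_AE) auto
  have half: "(\<lambda>k. (1/2::real) ^ Suc k) sums 1"
    by (rule power_half_series)
  have p_sum: "summable p"
    using p0 phi(3) by (intro summable_comparison_test'[OF sums_summable[OF half], of 0]) (auto simp: p_def)
  define S where "S = suminf p"
  have S: "0 \<le> S" "S \<le> 1"
  proof -
    show "0 \<le> S" unfolding S_def by (rule suminf_nonneg[OF p_sum p0])
    have "S \<le> (\<Sum>k. (1/2) ^ Suc k)"
      unfolding S_def using phi(3) by (intro suminf_le p_sum sums_summable[OF half]) (auto simp: p_def)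
    then show "S \<le> 1" using sums_unique[OF half] by simp
  qed
  define R where "R k = (case k of 0 \<Rightarrow> return borel cfun_zero | Suc k \<Rightarrow> Q k)" for k
  have R_prob: "prob_space (R k)" for k
    unfolding R_def using Q(1) by (cases k) (auto intro: prob_space_return)
  have R_sets [measurable_cong, simp]: "sets (R k) = sets borel" for k
    unfolding R_def using Q(2) by (cases k) auto
  have zero_shift: "shift h cfun_zero = (cfun_zero :: ('t, real^'q) cfun)" for h
    by (rule cfun_eqI) simp
  have zero_scale: "r \<odot> cfun_zero = (cfun_zero :: ('t, real^'q) cfun)" for r
    by (rule cfun_eqI) (simp add: vec_eq_iff)
  have R_stat: "distr (R k) borel (shift h) = R k" for k h
    unfolding R_def using stat by (cases k) (simp_all add: distr_return zero_shift)
  \<comment> \<open>Index 0 stands for the zero path and level \<open>k\<close> becomes index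
    \<open>Suc k\<close>. The unit cube merely spreads the mass \<open>1 - S\<close>, since scaling
    leaves the zero path fixed.\<close>
  define \<rho> where "\<rho> k y = (case k of 0 \<Rightarrow> (1 - S) * indicator (cbox 0 One) y | Suc k \<Rightarrow> \<phi> k y)" for k and y :: "real^'q"
  have rho0: "0 \<le> \<rho> k y" for k y
    unfolding \<rho>_def using phi(1) S by (cases k) auto
  have rho_meas' [measurable]: "\<rho> k \<in> borel_measurable borel" for k
    unfolding \<rho>_def by (cases k) simp_all
  have rho_meas [measurable]: "(\<lambda>x. \<rho> (fst x) (snd x)) \<in> borel_measurable (count_space UNIV \<Otimes>\<^sub>M borel)"
    by (rule measurable_pair_measure_countable1) simp_all
  interpret CL: pair_sigma_finite "count_space (UNIV :: nat set)" "lborel :: (real^'q) measure"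
    by (intro pair_sigma_finite.intro sigma_finite_measure_count_space sigma_finite_lborel)
  define \<beta> where "\<beta> = density (count_space UNIV \<Otimes>\<^sub>M lborel) (\<lambda>x. ennreal (\<rho> (fst x) (snd x)))"
  have beta_sets [measurable_cong]: "sets \<beta> = sets (count_space UNIV \<Otimes>\<^sub>M borel)"
    unfolding \<beta>_def sets_density by (intro sets_pair_measure_cong refl sets_lborel)
  have rho_int: "(\<integral>\<^sup>+y. ennreal (\<rho> k y) \<partial>lborel) = ennreal (case k of 0 \<Rightarrow> 1 - S | Suc k \<Rightarrow> p k)" for k
    proof (cases k)
      case 0
      have "(\<integral>\<^sup>+y. ennreal ((1 - S) * indicator (cbox 0 One) y) \<partial>(lborel :: (real^'q) measure))
          = ennreal (1 - S) * emeasure lborel (cbox 0 (One :: real^'q))"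
        using S by (simp add: ennreal_mult' ennreal_indicator nn_integral_cmult_indicator)
      then show ?thesis using 0 by (simp add: \<rho>_def emeasure_lborel_cbox)
    next
      case (Suc j)
      then show ?thesis unfolding \<rho>_def p_def using phi by (simp add: nn_integral_eq_integral)
    qed
  have rho_total: "(\<integral>\<^sup>+x. ennreal (\<rho> (fst x) (snd x)) \<partial>(count_space UNIV \<Otimes>\<^sub>M (lborel :: (real^'q) measure))) = 1"
  proof -
    have "(\<integral>\<^sup>+x. ennreal (\<rho> (fst x) (snd x)) \<partial>(count_space UNIV \<Otimes>\<^sub>M lborel))
        = (\<integral>\<^sup>+k. (\<integral>\<^sup>+y. ennreal (\<rho> k y) \<partial>lborel) \<partial>count_space UNIV)"
      by (subst lborel.nn_integral_fst[symmetric]) simp_all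
    also have "\<dots> = (\<integral>\<^sup>+k. ennreal (case k of 0 \<Rightarrow> 1 - S | Suc k \<Rightarrow> p k) \<partial>count_space UNIV)"
      by (simp only: rho_int)
    also have "(\<integral>\<^sup>+k. ennreal (case k of 0 \<Rightarrow> 1 - S | Suc k \<Rightarrow> p k) \<partial>count_space UNIV) = ennreal 1"
      unfolding nn_integral_count_space_nat
    proof (rule suminf_ennreal_eq)
      show "0 \<le> (case k of 0 \<Rightarrow> 1 - S | Suc k \<Rightarrow> p k)" for k
        using S p0 by (cases k) auto
      have "(\<lambda>k. case Suc k of 0 \<Rightarrow> 1 - S | Suc k \<Rightarrow> p k) sums S"
        using p_sum by (simp add: S_def summable_sums)
      from sums_Suc[OF this] show "(\<lambda>k. case k of 0 \<Rightarrow> 1 - S | Suc k \<Rightarrow> p k) sums 1" by simp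
    qed
    finally show ?thesis by simp
  qed
  have beta_prob: "prob_space \<beta>"
  proof (rule prob_spaceI)
    have "emeasure \<beta> (space \<beta>)
        = (\<integral>\<^sup>+x. ennreal (\<rho> (fst x) (snd x)) * indicator (space (count_space UNIV \<Otimes>\<^sub>M lborel)) x
            \<partial>(count_space UNIV \<Otimes>\<^sub>M lborel))"
      unfolding \<beta>_def space_density by (rule emeasure_density) simp_all
    also have "\<dots> = (\<integral>\<^sup>+x. ennreal (\<rho> (fst x) (snd x)) \<partial>(count_space UNIV \<Otimes>\<^sub>M lborel))"
      by (intro nn_integral_cong) simp
    finally show "emeasure \<beta> (space \<beta>) = 1" by (simp only: rho_total)
  qed
  interpret B: prob_space \<beta> by (rule beta_prob)
  interpret PR: product_prob_space R "UNIV :: nat set" by (intro product_prob_spaceI R_prob)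
  interpret P: prob_space "PiM UNIV R" by (intro prob_space_PiM R_prob)
  interpret BP: pair_prob_space \<beta> "PiM UNIV R" by unfold_locales
  \<comment> \<open>A path is drawn independently from every \<open>R k\<close>, and the pair of
    index and scale then selects and scales one of them; this realises the mixture on a product
    space.\<close>
  define X where "X x = vexp (snd (fst x)) \<odot> snd x (fst (fst x))"
    for x :: "(nat \<times> (real^'q)) \<times> (nat \<Rightarrow> ('t, real^'q) cfun)"
  have X_meas [measurable]: "X \<in> borel_measurable (\<beta> \<Otimes>\<^sub>M PiM UNIV R)"
  proof -
    have "(\<lambda>x. snd x (fst (fst x))) \<in> borel_measurable (\<beta> \<Otimes>\<^sub>M PiM UNIV R)"
    proof (rule measurable_compose_countable)
      show "(\<lambda>x. snd x i) \<in> borel_measurable (\<beta> \<Otimes>\<^sub>M PiM UNIV R)" for i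
      proof -
        have "(\<lambda>x. snd x i) \<in> \<beta> \<Otimes>\<^sub>M PiM UNIV R \<rightarrow>\<^sub>M R i" by measurable
        then show ?thesis by simp
      qed
    qed measurable
    then show ?thesis unfolding X_def by measurable
  qed
  define M where "M = distr (\<beta> \<Otimes>\<^sub>M PiM UNIV R) borel X"
  have M_prob: "prob_space M"
    unfolding M_def by (intro BP.prob_space_distr) measurable
  interpret M: prob_space M by (rule M_prob)
  have gm: "(\<lambda>x. \<integral>h. G (vexp (snd x) \<odot> h) \<partial>R (fst x)) \<in> borel_measurable \<beta>"
    if [measurable]: "G \<in> borel_measurable borel" for G :: "('t, real^'q) cfun \<Rightarrow> real"
  proof -
    have "(\<lambda>y. \<integral>h. G (vexp y \<odot> h) \<partial>R k) \<in> borel_measurable borel" for k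
    proof -
      interpret Rk: prob_space "R k" by (rule R_prob)
      show ?thesis by measurable
    qed
    then have "(\<lambda>x. \<integral>h. G (vexp (snd x) \<odot> h) \<partial>R (fst x)) \<in> borel_measurable (count_space UNIV \<Otimes>\<^sub>M borel)"
      by (intro measurable_pair_measure_countable1) simp_all
    then show ?thesis by (simp cong: measurable_cong_sets add: beta_sets)
  qed
  have M_int: "(\<integral>f. G f \<partial>M) = (\<integral>x. (\<integral>h. G (vexp (snd x) \<odot> h) \<partial>R (fst x)) \<partial>\<beta>)"
    if [measurable]: "G \<in> borel_measurable borel" and b: "\<And>f. \<bar>G f\<bar> \<le> b"
    for G :: "('t, real^'q) cfun \<Rightarrow> real" and b
  proof -
    have "(\<integral>f. G f \<partial>M) = (\<integral>x. G (X x) \<partial>(\<beta> \<Otimes>\<^sub>M PiM UNIV R))"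
      unfolding M_def by (rule integral_distr) measurable
    also have "\<dots> = (\<integral>x. (\<integral>\<zeta>. G (X (x, \<zeta>)) \<partial>PiM UNIV R) \<partial>\<beta>)"
    proof (rule BP.integral_fst'[symmetric])
      show "integrable (\<beta> \<Otimes>\<^sub>M PiM UNIV R) (\<lambda>x. G (X x))"
        by (rule BP.integrable_const_bound[of _ b]) (use b in auto)
    qed
    also have "(\<lambda>x. \<integral>\<zeta>. G (X (x, \<zeta>)) \<partial>PiM UNIV R) = (\<lambda>x. \<integral>h. G (vexp (snd x) \<odot> h) \<partial>R (fst x))"
    proof
      fix x :: "nat \<times> (real^'q)"
      have "(\<integral>\<zeta>. G (X (x, \<zeta>)) \<partial>PiM UNIV R) = (\<integral>\<zeta>. G (vexp (snd x) \<odot> \<zeta> (fst x)) \<partial>PiM UNIV R)"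
        by (simp add: X_def)
      also have "\<dots> = (\<integral>h. G (vexp (snd x) \<odot> h) \<partial>distr (PiM UNIV R) (R (fst x)) (\<lambda>\<zeta>. \<zeta> (fst x)))"
        by (subst integral_distr) (simp_all add: measurable_component_singleton)
      also have "distr (PiM UNIV R) (R (fst x)) (\<lambda>\<zeta>. \<zeta> (fst x)) = R (fst x)"
        by (rule PR.PiM_component) simp
      finally show "(\<integral>\<zeta>. G (X (x, \<zeta>)) \<partial>PiM UNIV R) = (\<integral>h. G (vexp (snd x) \<odot> h) \<partial>R (fst x))" .
    qed
    finally show ?thesis .
  qed
  have M_sets [simp, measurable_cong]: "sets M = sets borel" by (simp add: M_def)
  show ?thesis
  proof (rule that[OF M_prob M_sets])
    fix h
    show "distr M borel (shift h) = M"
    proof (rule measure_eqI)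
      fix A assume "A \<in> sets (distr M borel (shift h))"
      then have A [measurable]: "A \<in> sets borel" by simp
      have "measure M (shift h -` A \<inter> space M) = (\<integral>f. indicat_real (shift h -` A \<inter> space M) f \<partial>M)"
        by simp
      also have "\<dots> = (\<integral>f. indicat_real A (shift h f) \<partial>M)"
        by (intro Bochner_Integration.integral_cong) (auto split: split_indicator)
      also have "\<dots> = (\<integral>x. (\<integral>f. indicat_real A (shift h (vexp (snd x) \<odot> f)) \<partial>R (fst x)) \<partial>\<beta>)"
        by (rule M_int[of _ 1]) (auto split: split_indicator)
      also have "\<dots> = (\<integral>x. (\<integral>f. indicat_real A (vexp (snd x) \<odot> f) \<partial>R (fst x)) \<partial>\<beta>)"
      proof (rule Bochner_Integration.integral_cong[OF refl])
        fix x :: "nat \<times> (real^'q)"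
        have "(\<integral>f. indicat_real A (vexp (snd x) \<odot> f) \<partial>R (fst x)) = (\<integral>f. indicat_real A (vexp (snd x) \<odot> f) \<partial>distr (R (fst x)) borel (shift h))"
          by (simp add: R_stat)
        also have "\<dots> = (\<integral>f. indicat_real A (vexp (snd x) \<odot> shift h f) \<partial>R (fst x))"
          by (rule integral_distr) measurable
        finally show "(\<integral>f. indicat_real A (shift h (vexp (snd x) \<odot> f)) \<partial>R (fst x)) = (\<integral>f. indicat_real A (vexp (snd x) \<odot> f) \<partial>R (fst x))"
          by (simp add: shift_scale)
      qed
      also have "\<dots> = (\<integral>f. indicat_real A f \<partial>M)"
        by (rule M_int[of _ 1, symmetric]) (auto split: split_indicator)
      also have "\<dots> = measure M A"
        using sets.sets_into_space[of A M] by (simp add: Int_absorb2)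
      finally show "emeasure (distr M borel (shift h)) A = emeasure M A"
        by (subst emeasure_distr) (simp_all add: M.emeasure_eq_measure)
    qed simp
  next
    fix G :: "('t, real^'q) cfun \<Rightarrow> real" and b
    assume G [measurable]: "G \<in> borel_measurable borel" and b: "\<And>f. \<bar>G f\<bar> \<le> b" and G0: "G cfun_zero = 0"
    define g where "g x = (\<integral>h. G (vexp (snd x) \<odot> h) \<partial>R (fst x))" for x
    have g_meas: "g \<in> borel_measurable \<beta>" unfolding g_def by (rule gm) measurable
    then have g_meas' [measurable]: "g \<in> borel_measurable (count_space UNIV \<Otimes>\<^sub>M lborel)"
      unfolding \<beta>_def by simp
    have g_le: "\<bar>g x\<bar> \<le> b" for x
    proof -
      have "\<bar>g x\<bar> \<le> (\<integral>h. b \<partial>R (fst x))"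
        unfolding g_def using b order_trans[OF abs_ge_zero b]
        by (intro integral_abs_bound[THEN order_trans] integral_mono PR.M.integrable_const_bound[of _ b]) auto
      then show ?thesis by (simp add: PR.M.prob_space)
    qed
    have "integrable \<beta> g"
      using g_meas g_le by (intro B.integrable_const_bound[of _ b]) auto
    then have int: "integrable (count_space UNIV \<Otimes>\<^sub>M lborel) (\<lambda>x. \<rho> (fst x) (snd x) * g x)"
      unfolding \<beta>_def by (subst (asm) integrable_density) (auto simp: rho0)
    have "(\<integral>f. G f \<partial>M) = (\<integral>x. g x \<partial>\<beta>)"
      unfolding g_def by (rule M_int[OF G b])
    also have "\<dots> = (\<integral>x. \<rho> (fst x) (snd x) * g x \<partial>(count_space UNIV \<Otimes>\<^sub>M lborel))"
      unfolding \<beta>_def by (subst integral_density) (auto simp: rho0)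
    also have "\<dots> = (\<integral>k. (\<integral>y. \<rho> k y * g (k, y) \<partial>lborel) \<partial>count_space UNIV)"
      using CL.integral_fst'[OF int] by simp
    finally have "(\<lambda>k. \<integral>y. \<rho> k y * g (k, y) \<partial>lborel) sums (\<integral>f. G f \<partial>M)"
      using sums_integral_count_space_nat[OF CL.integrable_fst'[OF int]] by simp
    moreover have "(\<integral>y. \<rho> 0 y * g (0, y) \<partial>lborel) = 0"
      by (simp add: g_def R_def integral_return zero_scale G0)
    ultimately have "(\<lambda>k. \<integral>y. \<rho> (Suc k) y * g (Suc k, y) \<partial>lborel) sums (\<integral>f. G f \<partial>M)"
      by (subst sums_Suc_iff) simp
    then show "(\<lambda>k. \<integral>y. \<phi> k y * (\<integral>h. G (vexp y \<odot> h) \<partial>Q k) \<partial>lborel) sums (\<integral>f. G f \<partial>M)"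
      by (simp add: \<rho>_def g_def R_def)
  qed
qed

end

section \<open>Regular variation of the mixture\<close>

lemma tendsto_at_top_minI:
  fixes g :: "real^'q \<Rightarrow> real"
  assumes "\<And>U. (\<And>n. U n \<in> posG) \<Longrightarrow> filterlim (\<lambda>n. vmin (U n)) at_top sequentially \<Longrightarrow> (\<lambda>n. g (U n)) \<longlonglongrightarrow> l"
  shows "(g \<longlongrightarrow> l) at_top_min"
proof (rule ccontr)
  assume "\<not> (g \<longlongrightarrow> l) at_top_min"
  then obtain e where e: "0 < e" "\<not> (\<forall>\<^sub>F u in at_top_min. dist (g u) l < e)"
    unfolding tendsto_iff by blast
  have "\<exists>u. u \<in> posG \<and> real n \<le> vmin u \<and> e \<le> dist (g u) l" for n
  proof (rule ccontr)
    assume "\<not> (\<exists>u. u \<in> posG \<and> real n \<le> vmin u \<and> e \<le> dist (g u) l)"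
    then have "\<forall>u. real n \<le> vmin u \<longrightarrow> u \<in> posG \<longrightarrow> dist (g u) l < e" by (auto simp: not_le)
    moreover have "\<forall>\<^sub>F u :: real^'q in filtercomap vmin at_top. real n \<le> vmin u"
      by (intro eventually_filtercomapI eventually_ge_at_top)
    ultimately have "\<forall>\<^sub>F u :: real^'q in filtercomap vmin at_top. u \<in> posG \<longrightarrow> dist (g u) l < e"
      by (auto elim: eventually_mono)
    then have "\<forall>\<^sub>F u in at_top_min. dist (g u) l < e"
      unfolding at_top_min_def vmin_def[abs_def, symmetric] eventually_inf_principal by simp
    with e show False by simp
  qed
  then obtain U where U: "\<And>n. U n \<in> posG" "\<And>n. real n \<le> vmin (U n)" "\<And>n. e \<le> dist (g (U n)) l"
    by metis
  have "filterlim (\<lambda>n. vmin (U n)) at_top sequentially"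
    by (rule filterlim_at_top_mono[OF filterlim_real_sequentially]) (simp add: U)
  from assms[OF U(1) this] have "\<forall>\<^sub>F n in sequentially. dist (g (U n)) l < e"
    using e(1) unfolding tendsto_iff by blast
  then obtain N where "dist (g (U N)) l < e" by (auto simp: eventually_sequentially)
  then show False using U(3)[of N] by simp
qed

lemma vmin_ln:
  assumes "u \<in> posG" shows "L \<le> vmin (\<chi> i. ln (u $ i)) \<longleftrightarrow> exp L \<le> vmin u"
  unfolding vmin_ge_iff using posGD[OF assms] by (simp add: ln_ge_iff)

text \<open>A Toeplitz argument: eventually the first \<open>k0\<close> weights vanish, and the
  others average numbers smaller than \<open>e\<close>.\<close>

lemma sliding_average_tendsto_0:
  fixes q :: "nat \<Rightarrow> real \<Rightarrow> real"
  assumes q: "\<And>k x. 0 \<le> q k x" and one: "\<And>x. x0 \<le> x \<Longrightarrow> (\<lambda>k. q k x) sums 1"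
    and away: "\<And>k. \<forall>\<^sub>F x in at_top. q k x = 0" and D: "D \<longlonglongrightarrow> 0"
  shows "\<forall>\<^sub>F x in at_top. summable (\<lambda>k. q k x * D k)" "((\<lambda>x. \<Sum>k. q k x * D k) \<longlongrightarrow> 0) at_top"
proof -
  have main: "\<forall>\<^sub>F x in at_top. summable (\<lambda>k. q k x * D k) \<and> \<bar>\<Sum>k. q k x * D k\<bar> \<le> e" if e: "0 < e" for e
  proof -
    obtain k0 where k0: "\<And>k. k0 \<le> k \<Longrightarrow> \<bar>D k\<bar> < e"
      using LIMSEQ_D[OF D e] by auto
    have "\<forall>\<^sub>F x in at_top. \<forall>k\<in>{..<k0}. q k x = 0"
      by (intro eventually_ball_finite) (auto intro: away)
    then show ?thesis
      using eventually_ge_at_top[of x0]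
    proof eventually_elim
      case (elim x)
      have le: "\<bar>q k x * D k\<bar> \<le> e * q k x" for k
      proof (cases "k < k0")
        case True then show ?thesis using elim by simp
      next
        case False
        then show ?thesis using k0[of k] q[of k x] by (simp add: abs_mult mult.commute mult_right_mono)
      qed
      have s: "(\<lambda>k. e * q k x) sums (e * 1)" using one[OF elim(2)] by (rule sums_mult)
      have sa: "summable (\<lambda>k. \<bar>q k x * D k\<bar>)"
        by (rule summable_comparison_test'[OF sums_summable[OF s], of 0]) (use le in auto)
      have "\<bar>\<Sum>k. q k x * D k\<bar> \<le> (\<Sum>k. \<bar>q k x * D k\<bar>)" by (rule summable_rabs[OF sa])
      also have "\<dots> \<le> (\<Sum>k. e * q k x)" by (rule suminf_le[OF le sa sums_summable[OF s]])
      also have "\<dots> = e" using sums_unique[OF s] by simp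
      finally show ?case using summable_rabs_cancel[OF sa] by simp
    qed
  qed
  show "\<forall>\<^sub>F x in at_top. summable (\<lambda>k. q k x * D k)"
    using main[of 1] by (auto elim: eventually_mono)
  show "((\<lambda>x. \<Sum>k. q k x * D k) \<longlongrightarrow> 0) at_top"
    unfolding tendsto_iff
  proof (intro allI impI)
    fix e :: real assume "0 < e"
    then show "\<forall>\<^sub>F x in at_top. dist (\<Sum>k. q k x * D k) 0 < e"
      using main[of "e/2"] by (auto elim!: eventually_mono)
  qed
qed

lemma lborel_translation: "distr lborel borel (\<lambda>x. z + x) = (lborel :: (real^'q) measure)"
  using lborel_affine[of 1 z] by (simp add: density_1)

context exhausted_group
begin

text \<open>The limit hypothesis concerns each level smeared with the full density. The slow weights
  transfer it to the mixture: at large \<open>u\<close> the expectation is close to the average of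
  the level integrals with weights \<open>q k (vmin z)\<close>, and all these levels are high
  ones.\<close>

lemma mixing:
  fixes Q :: "nat \<Rightarrow> ('t, real^'q) cfun measure" and w c :: "nat \<Rightarrow> real" and \<alpha> :: "real^'q"
    and \<nu> :: "('t, real^'q) cfun measure"
  assumes \<alpha>: "\<And>i. 0 < \<alpha> $ i"
    and Q: "\<And>k. prob_space (Q k)" "\<And>k. sets (Q k) = sets borel"
    and stat: "\<And>k h. distr (Q k) borel (shift h) = Q k"
    and bounded: "\<And>k. AE h in Q k. \<forall>t i. \<bar>apply_cfun h t $ i\<bar> \<le> c k"
    and c: "\<And>k. 0 < c k" and w: "\<And>k. 0 \<le> w k"
    and lim: "\<And>F n \<epsilon> b. continuous_on UNIV F \<Longrightarrow> (\<And>f. \<bar>F f\<bar> \<le> b) \<Longrightarrow> (\<And>i. 1 \<le> n $ i) \<Longrightarrow> \<epsilon> \<in> posG \<Longrightarrow>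
      (\<And>f. f \<notin> window K n \<epsilon> \<Longrightarrow> F f = 0) \<Longrightarrow>
      (\<lambda>k. w k * (\<integral>y. exp (- (\<alpha> \<bullet> y)) * (\<integral>h. F (vexp y \<odot> h) \<partial>Q k) \<partial>lborel)) \<longlonglongrightarrow> (\<integral>f. F f \<partial>\<nu>)"
  shows "\<exists>M :: ('t, real^'q) cfun measure. prob_space M \<and> sets M = sets borel \<and>
    (\<forall>h. distr M borel (shift h) = M) \<and> RV_Pi K \<alpha> \<nu> M (\<lambda>f. f)"
proof -
  define \<psi> where "\<psi> k y = w k * exp (- (\<alpha> \<bullet> y))" for k y
  have psi_meas [measurable]: "\<psi> k \<in> borel_measurable borel" for k
    unfolding \<psi>_def by measurable
  have psi0: "0 \<le> \<psi> k y" for k y using w by (simp add: \<psi>_def)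
  have psi_int: "integrable lborel (\<lambda>y. indicator (orthant x) y * \<psi> k y)" for k x
    using integrable_mult_right[OF integrable_exp_orthant[OF \<alpha>, of x], of "w k"]
    by (simp add: \<psi>_def mult_ac)
  \<comment> \<open>A functional that lives on a window of smallest height
    \<open>\<epsilon>0\<close> makes level \<open>k\<close> vanish outside
    \<open>orthant (A k)\<close> with \<open>A k = ln \<epsilon>0 - ln (c k)\<close>. The weights
    must be chosen before the window is known; the term \<open>ln (real (Suc k))\<close> yields
    \<open>a k \<le> A k\<close> for all large \<open>k\<close>.\<close>
  define a where "a k = - (ln (c k) + ln (real (Suc k)))" for k
  obtain q :: "nat \<Rightarrow> real \<Rightarrow> real" and x0 where
    q_meas [measurable]: "\<And>k. q k \<in> borel_measurable borel" and
    q0: "\<And>k x. 0 \<le> q k x" and q1: "\<And>k x. q k x \<le> 1" and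
    q_one: "\<And>x. x0 \<le> x \<Longrightarrow> (\<lambda>k. q k x) sums 1" and
    q_away: "\<And>k. \<forall>\<^sub>F x in at_top. q k x = 0" and
    q_int: "\<And>k. integrable lborel (\<lambda>y. \<psi> k y * q k (vmin y))" and
    q_mass: "\<And>k. (\<integral>y. \<psi> k y * q k (vmin y) \<partial>lborel) \<le> (1/2) ^ Suc k" and
    q_slow: "\<And>k z. (\<integral>y. indicator (orthant (a k)) y * \<psi> k y * \<bar>q k (vmin (y + z)) - q k (vmin z)\<bar> \<partial>lborel) \<le> 2 * (1/2) ^ k"
    using slow_partition[of \<psi> a, OF psi_meas psi0 psi_int] by blast
  obtain M :: "('t, real^'q) cfun measure" where M: "prob_space M" "sets M = sets borel"
    "\<And>h. distr M borel (shift h) = M" and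
    M_sums: "\<And>G b. G \<in> borel_measurable borel \<Longrightarrow> (\<And>f. \<bar>G f\<bar> \<le> b) \<Longrightarrow> G cfun_zero = 0 \<Longrightarrow>
      (\<lambda>k. \<integral>y. \<psi> k y * q k (vmin y) * (\<integral>h. G (vexp y \<odot> h) \<partial>Q k) \<partial>lborel) sums (\<integral>f. G f \<partial>M)"
  proof (rule mixture[of Q "\<lambda>k y. \<psi> k y * q k (vmin y)"])
    show "(\<lambda>y. \<psi> k y * q k (vmin y)) \<in> borel_measurable borel" for k by measurable
  qed (use Q stat psi0 q0 q_int q_mass in auto)
  have "((\<lambda>u. chi \<alpha> u * (\<integral>f. F (vinverse u \<odot> f) \<partial>M)) \<longlongrightarrow> (\<integral>f. F f \<partial>\<nu>)) at_top_min"
    if F: "continuous_on UNIV F" and b: "\<And>f. \<bar>F f\<bar> \<le> b" and n: "\<And>i. 1 \<le> n $ i" and \<epsilon>: "\<epsilon> \<in> posG"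
      and vanish: "\<And>f. f \<notin> window K n \<epsilon> \<Longrightarrow> F f = 0" for F :: "('t, real^'q) cfun \<Rightarrow> real" and n \<epsilon> b
  \<comment> \<open>Sequences suffice, which opens the way to dominated convergence and to Tannery's
    theorem.\<close>
  proof (rule tendsto_at_top_minI)
    fix U :: "nat \<Rightarrow> real^'q" assume U: "\<And>n. U n \<in> posG" and U_lim: "filterlim (\<lambda>n. vmin (U n)) at_top sequentially"
    define z where "z j = (\<chi> i. ln (U j $ i))" for j
    have z_lim: "filterlim (\<lambda>j. vmin (z j)) at_top sequentially"
      unfolding filterlim_at_top z_def vmin_ln[OF U]
      using U_lim unfolding filterlim_at_top by blast
    have F_meas [measurable]: "F \<in> borel_measurable borel"
      using F by (rule borel_measurable_continuous_onI)
    have b0: "0 \<le> b" using order_trans[OF abs_ge_zero b] .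
    have F_zero: "F cfun_zero = 0"
      using n \<epsilon> by (intro vanish) (auto simp: window_iff not_less posGD less_imp_le)
    define f where "f k y = (\<integral>h. F (vexp y \<odot> h) \<partial>Q k)" for k y
    have f_meas [measurable]: "f k \<in> borel_measurable borel" for k
    proof -
      interpret Qk: prob_space "Q k" by (rule Q(1))
      note Q(2)[measurable_cong]
      show ?thesis unfolding f_def by measurable
    qed
    have f_le: "\<bar>f k y\<bar> \<le> b" for k y
    proof -
      interpret Qk: prob_space "Q k" by (rule Q(1))
      note Q(2)[measurable_cong]
      have "\<bar>f k y\<bar> \<le> (\<integral>h. b \<partial>Q k)"
        unfolding f_def using b b0
        by (intro integral_abs_bound[THEN order_trans] integral_mono Qk.integrable_const_bound[of _ b]) auto
      then show ?thesis by (simp add: Qk.prob_space)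
    qed
    define \<epsilon>0 where "\<epsilon>0 = vmin \<epsilon>"
    have e0: "0 < \<epsilon>0" unfolding \<epsilon>0_def vmin_def using \<epsilon> by (subst Min_gr_iff) (auto simp: posG_def)
    define A where "A k = ln \<epsilon>0 - ln (c k)" for k
    have f_zero: "f k y = 0" if "y \<notin> orthant (A k)" for k y
    proof -
      obtain i where "y $ i < A k" using \<open>y \<notin> orthant (A k)\<close> by (auto simp: orthant_def not_le)
      then have "exp (y $ i) < exp (ln \<epsilon>0 - ln (c k))" unfolding A_def by simp
      then have i: "exp (y $ i) * c k < \<epsilon>0" using e0 c[of k] by (simp add: exp_diff pos_less_divide_eq)
      have "AE h in Q k. F (vexp y \<odot> h) = 0"
        using bounded[of k]
      proof eventually_elim
        case (elim h)
        have "\<bar>apply_cfun (vexp y \<odot> h) t $ i\<bar> \<le> \<epsilon> $ i" for t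
        proof -
          have "\<bar>apply_cfun (vexp y \<odot> h) t $ i\<bar> \<le> exp (y $ i) * c k"
            using elim by (simp add: abs_mult)
          then show ?thesis using i vmin_le[of \<epsilon> i] by (simp add: \<epsilon>0_def)
        qed
        then show ?case by (intro vanish) (auto simp: window_iff[OF n] not_less intro!: exI[of _ i])
      qed
      then show ?thesis unfolding f_def by (rule integral_eq_zero_AE)
    qed
    define I where "I k = (\<integral>y. \<psi> k y * f k y \<partial>lborel)" for k
    have I_lim: "I \<longlonglongrightarrow> (\<integral>f. F f \<partial>\<nu>)"
      using lim[OF F b n \<epsilon> vanish] unfolding I_def[abs_def] f_def \<psi>_def by (simp add: mult.assoc)
    have f_bound: "\<bar>\<psi> k y * x * f k y\<bar> \<le> b * (indicator (orthant (A k)) y * \<psi> k y * \<bar>x\<bar>)" for k y x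
    proof (cases "y \<in> orthant (A k)")
      case True
      have "\<psi> k y * \<bar>x\<bar> * \<bar>f k y\<bar> \<le> \<psi> k y * \<bar>x\<bar> * b"
        using f_le psi0 by (intro mult_left_mono) auto
      then show ?thesis using True psi0[of k y] by (simp add: abs_mult mult_ac)
    qed (simp add: f_zero)
    have int_x: "integrable lborel (\<lambda>y. \<psi> k y * x y * f k y)"
      if [measurable]: "x \<in> borel_measurable borel" and x: "\<And>y. \<bar>x y\<bar> \<le> 1" for x k
    proof (rule Bochner_Integration.integrable_bound)
      show "integrable lborel (\<lambda>y. b * (indicator (orthant (A k)) y * \<psi> k y))"
        using psi_int by simp
      show "AE y in lborel. norm (\<psi> k y * x y * f k y) \<le> norm (b * (indicator (orthant (A k)) y * \<psi> k y))"
      proof (rule AE_I2)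
        fix y
        have "b * (indicator (orthant (A k)) y * \<psi> k y * \<bar>x y\<bar>) \<le> b * (indicator (orthant (A k)) y * \<psi> k y * 1)"
          using x psi0 b0 by (intro mult_left_mono) auto
        then show "norm (\<psi> k y * x y * f k y) \<le> norm (b * (indicator (orthant (A k)) y * \<psi> k y))"
          using f_bound[of k y "x y"] b0 psi0[of k y] by (simp add: abs_mult)
      qed
    qed measurable
    \<comment> \<open>The contribution of level \<open>k\<close> after translating the scale by
      \<open>z j\<close>. The factor \<open>exp (- (\<alpha> \<bullet> z j))\<close> released by the
      translation cancels \<open>chi \<alpha> (U j)\<close>.\<close>
    define \<tau> where "\<tau> k j = (\<integral>y. \<psi> k y * q k (vmin (y + z j)) * f k y \<partial>lborel)" for k j
    define r where "r k j = \<tau> k j - q k (vmin (z j)) * I k" for k j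
    have tau_sums: "(\<lambda>k. \<tau> k j) sums (chi \<alpha> (U j) * (\<integral>f. F (vinverse (U j) \<odot> f) \<partial>M))" for j
    proof -
      have zU: "vexp (z j) = U j" unfolding z_def by (rule posG_vexp_ln[OF U])
      have "F (vinverse (U j) \<odot> cfun_zero) = 0"
      proof -
        have "vinverse (U j) \<odot> cfun_zero = (cfun_zero :: ('t, real^'q) cfun)"
          by (rule cfun_eqI) (simp add: vec_eq_iff)
        then show ?thesis by (simp add: F_zero)
      qed
      then have "(\<lambda>k. \<integral>y. \<psi> k y * q k (vmin y) * (\<integral>h. F (vinverse (U j) \<odot> (vexp y \<odot> h)) \<partial>Q k) \<partial>lborel) sums
          (\<integral>f. F (vinverse (U j) \<odot> f) \<partial>M)"
        by (intro M_sums[of "\<lambda>f. F (vinverse (U j) \<odot> f)" b]) (auto simp: b)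
      moreover have "(\<integral>y. \<psi> k y * q k (vmin y) * (\<integral>h. F (vinverse (U j) \<odot> (vexp y \<odot> h)) \<partial>Q k) \<partial>lborel)
          = exp (- (\<alpha> \<bullet> z j)) * \<tau> k j" for k
      proof -
        have "(\<integral>y. \<psi> k y * q k (vmin y) * (\<integral>h. F (vinverse (U j) \<odot> (vexp y \<odot> h)) \<partial>Q k) \<partial>lborel)
          = (\<integral>y. \<psi> k y * q k (vmin y) * f k (y - z j) \<partial>distr lborel borel (\<lambda>x. z j + x))"
          unfolding lborel_translation by (simp add: f_def vinverse_scale_vexp[OF U] z_def)
        also have "\<dots> = (\<integral>y. \<psi> k (z j + y) * q k (vmin (z j + y)) * f k y \<partial>lborel)"
          by (subst integral_distr) simp_all
        also have "\<dots> = (\<integral>y. exp (- (\<alpha> \<bullet> z j)) * (\<psi> k y * q k (vmin (y + z j)) * f k y) \<partial>lborel)"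
          by (simp add: \<psi>_def inner_add_right exp_add exp_minus exp_diff field_simps add.commute[of "z j"])
        finally show ?thesis by (simp add: \<tau>_def)
      qed
      ultimately have "(\<lambda>k. exp (\<alpha> \<bullet> z j) * (exp (- (\<alpha> \<bullet> z j)) * \<tau> k j)) sums
          (exp (\<alpha> \<bullet> z j) * (\<integral>f. F (vinverse (U j) \<odot> f) \<partial>M))"
        by (intro sums_mult) simp
      then show ?thesis
        by (simp add: chi_vexp[symmetric, of \<alpha> "z j"] zU exp_minus chi_pos[OF U] less_imp_neq[symmetric])
          (simp add: zU[symmetric] chi_vexp mult.assoc[symmetric] exp_add[symmetric])
    qed
    have r_eq: "r k j = (\<integral>y. \<psi> k y * (q k (vmin (y + z j)) - q k (vmin (z j))) * f k y \<partial>lborel)" for k j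
    proof -
      have "integrable lborel (\<lambda>y. \<psi> k y * q k (vmin (y + z j)) * f k y)"
        using q0 q1 by (intro int_x) (auto simp: abs_of_nonneg)
      moreover have "integrable lborel (\<lambda>y. \<psi> k y * q k (vmin (z j)) * f k y)"
        using q0 q1 by (intro int_x[of "\<lambda>_. q k (vmin (z j))"]) (auto simp: abs_of_nonneg)
      ultimately have "(\<integral>y. \<psi> k y * (q k (vmin (y + z j)) - q k (vmin (z j))) * f k y \<partial>lborel)
          = \<tau> k j - (\<integral>y. \<psi> k y * q k (vmin (z j)) * f k y \<partial>lborel)"
        unfolding \<tau>_def by (subst Bochner_Integration.integral_diff[symmetric]) (auto simp: algebra_simps)
      also have "(\<integral>y. \<psi> k y * q k (vmin (z j)) * f k y \<partial>lborel) = q k (vmin (z j)) * I k"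
        unfolding I_def by (subst integral_mult_right_zero[symmetric]) (simp add: mult_ac)
      finally show ?thesis by (simp add: r_def)
    qed
    have q_diff: "\<bar>q k x - q k y\<bar> \<le> 1" for k x y
      using q0[of k x] q0[of k y] q1[of k x] q1[of k y] by (simp add: abs_le_iff)
    have r_small: "\<bar>r k j\<bar> \<le> b * (2 * (1/2) ^ k)" if k: "1 / \<epsilon>0 \<le> real (Suc k)" for k j
    proof -
      have "a k \<le> A k"
      proof -
        have "ln (1 / \<epsilon>0) \<le> ln (real (Suc k))" using k e0 by (intro ln_mono) auto
        then show ?thesis using e0 by (simp add: a_def A_def ln_div)
      qed
      then have sub: "orthant (A k) \<subseteq> (orthant (a k) :: (real^'q) set)"
        unfolding orthant_def using order_trans by blast
      let ?d = "\<lambda>y. \<bar>q k (vmin (y + z j)) - q k (vmin (z j))\<bar>"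
      have int_d: "integrable lborel (\<lambda>y. indicator (orthant (a k)) y * \<psi> k y * ?d y)"
        using q_diff psi0 by (intro Bochner_Integration.integrable_bound[OF psi_int[of "a k" k]])
          (auto simp: abs_mult intro!: mult_left_le split: split_indicator)
      have "\<bar>r k j\<bar> \<le> (\<integral>y. b * (indicator (orthant (a k)) y * \<psi> k y * ?d y) \<partial>lborel)"
        unfolding r_eq
      proof (intro integral_abs_bound[THEN order_trans] integral_mono_AE')
        show "integrable lborel (\<lambda>y. b * (indicator (orthant (a k)) y * \<psi> k y * ?d y))" using int_d by simp
        show "AE y in lborel. \<bar>\<psi> k y * (q k (vmin (y + z j)) - q k (vmin (z j))) * f k y\<bar>
            \<le> b * (indicator (orthant (a k)) y * \<psi> k y * ?d y)"
        proof (rule AE_I2)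
          fix y
          have "indicator (orthant (A k)) y * \<psi> k y * ?d y \<le> indicator (orthant (a k)) y * \<psi> k y * ?d y"
            using sub psi0[of k y] by (intro mult_right_mono) (auto simp: indicator_def)
          from order_trans[OF f_bound mult_left_mono[OF this b0]]
          show "\<bar>\<psi> k y * (q k (vmin (y + z j)) - q k (vmin (z j))) * f k y\<bar>
            \<le> b * (indicator (orthant (a k)) y * \<psi> k y * ?d y)" .
        qed
        show "AE y in lborel. 0 \<le> b * (indicator (orthant (a k)) y * \<psi> k y * ?d y)"
          using b0 psi0 by auto
      qed
      also have "\<dots> = b * (\<integral>y. indicator (orthant (a k)) y * \<psi> k y * ?d y \<partial>lborel)" by simp
      also have "\<dots> \<le> b * (2 * (1/2) ^ k)" by (intro mult_left_mono q_slow b0)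
      finally show ?thesis .
    qed
    \<comment> \<open>For a fixed level both weights are eventually 0: \<open>vmin (z j)\<close> and
      \<open>vmin (y + z j)\<close> tend to infinity, and \<open>q_away\<close> applies to
      each.\<close>
    have r_lim: "r k \<longlonglongrightarrow> 0" for k
    proof -
      have "(\<lambda>j. r k j) \<longlonglongrightarrow> (\<integral>y. (0::real) \<partial>(lborel :: (real^'q) measure))"
        unfolding r_eq
      proof (rule integral_dominated_convergence)
        show "integrable lborel (\<lambda>y. b * (indicator (orthant (A k)) y * \<psi> k y))" using psi_int by simp
        show "AE y in lborel. norm (\<psi> k y * (q k (vmin (y + z j)) - q k (vmin (z j))) * f k y)
            \<le> b * (indicator (orthant (A k)) y * \<psi> k y)" for j
        proof (rule AE_I2)
          fix y
          have "b * (indicator (orthant (A k)) y * \<psi> k y * \<bar>q k (vmin (y + z j)) - q k (vmin (z j))\<bar>)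
              \<le> b * (indicator (orthant (A k)) y * \<psi> k y * 1)"
            using q_diff psi0 b0 by (intro mult_left_mono) auto
          then show "norm (\<psi> k y * (q k (vmin (y + z j)) - q k (vmin (z j))) * f k y)
            \<le> b * (indicator (orthant (A k)) y * \<psi> k y)"
            using f_bound[of k y "q k (vmin (y + z j)) - q k (vmin (z j))"] by simp
        qed
        show "AE y in lborel. (\<lambda>j. \<psi> k y * (q k (vmin (y + z j)) - q k (vmin (z j))) * f k y) \<longlonglongrightarrow> 0"
        proof (rule AE_I2)
          fix y :: "real^'q"
          have "filterlim (\<lambda>j. vmin y + vmin (z j)) at_top sequentially"
            by (intro filterlim_tendsto_add_at_top[OF tendsto_const z_lim])
          then have "filterlim (\<lambda>j. vmin (y + z j)) at_top sequentially"
            by (rule filterlim_at_top_mono) (simp add: vmin_plus_ge)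
          from eventually_compose_filterlim[OF q_away[of k] this] eventually_compose_filterlim[OF q_away[of k] z_lim]
          have "\<forall>\<^sub>F j in sequentially. \<psi> k y * (q k (vmin (y + z j)) - q k (vmin (z j))) * f k y = 0"
            by eventually_elim simp
          then show "(\<lambda>j. \<psi> k y * (q k (vmin (y + z j)) - q k (vmin (z j))) * f k y) \<longlonglongrightarrow> 0"
            by (rule tendsto_eventually)
        qed
      qed measurable
      then show ?thesis by simp
    qed
    obtain k1 where k1: "\<And>k. k1 \<le> k \<Longrightarrow> 1 / \<epsilon>0 \<le> real (Suc k)"
    proof -
      obtain k1 where "1 / \<epsilon>0 \<le> real k1" using real_arch_simple by blast
      then show ?thesis by (intro that[of k1]) (simp add: order_trans)
    qed
    \<comment> \<open>The summable bound \<open>r_small\<close> is uniform in \<open>j\<close> for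
      all but finitely many \<open>k\<close>, and each single error tends to 0: dominated
      convergence for series.\<close>
    have tann: "\<forall>\<^sub>F j in sequentially. summable (\<lambda>k. norm (r k j))"
        "(\<lambda>j. \<Sum>k. r k j) \<longlonglongrightarrow> (\<Sum>k::nat. 0)"
    proof -
      have "\<forall>\<^sub>F (k, j) in sequentially \<times>\<^sub>F sequentially. norm (r k j) \<le> b * (2 * (1/2) ^ k)"
        unfolding eventually_prod_filter
        by (intro exI[of _ "\<lambda>k. k1 \<le> k"] exI[of _ "\<lambda>_. True"]) (auto intro: r_small k1)
      moreover have "summable (\<lambda>k. b * (2 * (1/2) ^ k))"
        by (intro summable_mult summable_geometric) simp
      ultimately show "\<forall>\<^sub>F j in sequentially. summable (\<lambda>k. norm (r k j))"
        "(\<lambda>j. \<Sum>k. r k j) \<longlonglongrightarrow> (\<Sum>k::nat. 0)"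
        using tannerys_theorem[of r "\<lambda>_. 0" sequentially, OF r_lim] by auto
    qed
    define J where "J = (\<integral>f. F f \<partial>\<nu>)"
    have D: "(\<lambda>k. I k - J) \<longlonglongrightarrow> 0"
      using tendsto_diff[OF I_lim tendsto_const[of J]] by (simp add: J_def)
    have sl: "\<forall>\<^sub>F x in at_top. summable (\<lambda>k. q k x * (I k - J))"
        "((\<lambda>x. \<Sum>k. q k x * (I k - J)) \<longlongrightarrow> 0) at_top"
      by (rule sliding_average_tendsto_0[of q x0, OF q0 _ q_away D], erule q_one)+
    have lim2: "(\<lambda>j. \<Sum>k. q k (vmin (z j)) * (I k - J)) \<longlonglongrightarrow> 0"
      by (rule filterlim_compose[OF sl(2) z_lim])
    have "\<forall>\<^sub>F j in sequentially. (\<Sum>k. r k j) + (\<Sum>k. q k (vmin (z j)) * (I k - J)) + J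
        = chi \<alpha> (U j) * (\<integral>f. F (vinverse (U j) \<odot> f) \<partial>M)"
      using tann(1) eventually_compose_filterlim[OF sl(1) z_lim]
        eventually_compose_filterlim[OF eventually_ge_at_top[of x0] z_lim]
    proof eventually_elim
      case (elim j)
      have "(\<lambda>k. r k j) sums (\<Sum>k. r k j)" using summable_norm_cancel[OF elim(1)] by (rule summable_sums)
      moreover have "(\<lambda>k. q k (vmin (z j)) * (I k - J)) sums (\<Sum>k. q k (vmin (z j)) * (I k - J))"
        using elim(2) by (rule summable_sums)
      moreover have "(\<lambda>k. q k (vmin (z j)) * J) sums (1 * J)"
        using q_one[OF elim(3)] by (rule sums_mult2)
      ultimately have "(\<lambda>k. r k j + q k (vmin (z j)) * (I k - J) + q k (vmin (z j)) * J) sums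
          ((\<Sum>k. r k j) + (\<Sum>k. q k (vmin (z j)) * (I k - J)) + 1 * J)"
        by (intro sums_add)
      moreover have "r k j + q k (vmin (z j)) * (I k - J) + q k (vmin (z j)) * J = \<tau> k j" for k
        by (simp add: r_def algebra_simps)
      ultimately show ?case using sums_unique2[OF tau_sums[of j]] by simp
    qed
    moreover have "(\<lambda>j. (\<Sum>k. r k j) + (\<Sum>k. q k (vmin (z j)) * (I k - J)) + J) \<longlonglongrightarrow> (\<Sum>k::nat. 0) + 0 + J"
      by (intro tendsto_add tann(2) lim2 tendsto_const)
    ultimately show "(\<lambda>j. chi \<alpha> (U j) * (\<integral>f. F (vinverse (U j) \<odot> f) \<partial>M)) \<longlonglongrightarrow> (\<integral>f. F f \<partial>\<nu>)"
      by (simp add: J_def Lim_transform_eventually)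
  qed
  then have "RV_Pi K \<alpha> \<nu> M (\<lambda>f. f)"
    unfolding RV_Pi_def bounded_iff by fastforce
  then show ?thesis using M by blast
qed

end

section \<open>Truncated levels\<close>

lemma abs_cfun_diff_le:
  assumes "\<And>t c. 0 \<le> apply_cfun h t $ c \<and> apply_cfun h t $ c \<le> E"
  shows "\<bar>apply_cfun (cfun_diff h) t $ i\<bar> \<le> E"
  using assms[of t "(i, True)"] assms[of t "(i, False)"] by (simp add: abs_le_iff)

context exhausted_group
begin

text \<open>\<open>spread k f t i > 1\<close> says that the \<open>i\<close>-th component of \<open>f\<close> is visible from \<open>t\<close> within \<open>K k\<close>. Only paths
  all of whose components are visible from \<open>t\<close> are allowed to contribute at \<open>t\<close>; this is what makes the
  superposition below locally finite.\<close>

definition spread :: "nat \<Rightarrow> ('t, real^'q::finite) cfun \<Rightarrow> 't \<Rightarrow> 'q \<Rightarrow> real" where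
  "spread k f t i = (SUP s\<in>K k. \<bar>apply_cfun f (t + s) $ i\<bar>)"

text \<open>A ramp between heights 1 and 2 in place of an indicator, so that the truncated path
  stays continuous.\<close>

definition cutoff :: "nat \<Rightarrow> ('t, real^'q::finite) cfun \<Rightarrow> 't \<Rightarrow> real" where
  "cutoff k f t = (\<Prod>i\<in>UNIV. max 0 (min 1 (spread k f t i - 1)))"

text \<open>One factor \<open>cutoff\<close> for all components: at a time from which some component
  is not visible, the whole path is dropped.\<close>

definition clamped :: "nat \<Rightarrow> real \<Rightarrow> ('t, real^'q::finite) cfun \<Rightarrow> ('t, real^('q::finite \<times> bool)) cfun" where
  "clamped k L f = Cfun (\<lambda>t. \<chi> c. cutoff k f t *
      max 0 (min (exp L) ((if snd c then 1 else -1) * apply_cfun f t $ fst c)))"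

lemma cutoff_01: "0 \<le> cutoff k f t" "cutoff k f t \<le> 1"
  unfolding cutoff_def by (auto intro: prod_nonneg prod_le_1)

lemma continuous_translate: "continuous_on A (\<lambda>s. \<bar>apply_cfun f (t + s) $ i\<bar>)" for f :: "('t, real^'q::finite) cfun"
  by (intro continuous_intros continuous_on_compose2[OF continuous_cfun_nth]) auto

lemma spread_gt_iff: "1 \<le> k \<Longrightarrow> a < spread k f t i \<longleftrightarrow> (\<exists>s\<in>K k. a < \<bar>apply_cfun f (t + s) $ i\<bar>)"
  unfolding spread_def by (intro SUP_compact_less_iff compact_K K_nonempty continuous_translate)

lemma continuous_spread: "1 \<le> k \<Longrightarrow> continuous_on UNIV (\<lambda>t. spread k f t i)"
  unfolding spread_def
proof (rule continuous_on_SUP_compact[OF compact_K K_nonempty])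
  show "continuous_on UNIV (\<lambda>(t, s). \<bar>apply_cfun f (t + s) $ i\<bar>)"
    unfolding case_prod_beta
    by (intro continuous_intros continuous_on_compose2[OF continuous_cfun_nth]) auto
qed

lemma measurable_spread: "1 \<le> k \<Longrightarrow> (\<lambda>f::('t, real^'q::finite) cfun. spread k f t i) \<in> borel_measurable borel"
proof (rule borel_measurableI_greater)
  fix a assume k: "1 \<le> k"
  have "{f::('t, real^'q::finite) cfun. a < spread k f t i} = (\<Union>s\<in>K k. {f. a < \<bar>apply_cfun f (t + s) $ i\<bar>})"
    by (auto simp: spread_gt_iff[OF k])
  then show "{f \<in> space borel. a < spread k (f::('t, real^'q::finite) cfun) t i} \<in> sets borel"
    by (auto intro!: borel_open open_UN open_cfun_gt)
qed

lemma cutoff_nonzero: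
  assumes k: "1 \<le> k" and "cutoff k f t \<noteq> 0"
  shows "\<exists>s\<in>K k. 1 < \<bar>apply_cfun f (t + s) $ i\<bar>"
proof -
  have "max 0 (min 1 (spread k f t i - 1)) \<noteq> 0"
    using assms(2) unfolding cutoff_def by auto
  then have "1 < spread k f t i" by (auto simp: max_def min_def split: if_splits)
  then show ?thesis using spread_gt_iff[OF k] by blast
qed

lemma cutoff_eq_1:
  assumes k: "1 \<le> k" and "\<And>i. \<exists>s\<in>K k. 2 < \<bar>apply_cfun f (t + s) $ i\<bar>"
  shows "cutoff k f t = 1"
proof -
  have "2 < spread k f t i" for i using assms spread_gt_iff[OF k] by blast
  then have "max 0 (min 1 (spread k f t i - 1)) = 1" for i
    by (metis add_le_cancel_right diff_add_cancel less_imp_le max_def min_def one_add_one zero_le_one)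
  then show ?thesis unfolding cutoff_def by simp
qed

lemma apply_clamped:
  assumes k: "1 \<le> k"
  shows "apply_cfun (clamped k L f) t $ c =
    cutoff k f t * max 0 (min (exp L) ((if snd c then 1 else -1) * apply_cfun f t $ fst c))"
proof -
  have "continuous_on UNIV (\<lambda>t. \<chi> c. cutoff k f t *
      max 0 (min (exp L) ((if snd c then 1 else -1) * apply_cfun f t $ fst c)))"
    unfolding cutoff_def by (intro continuous_intros continuous_spread k)
  then show ?thesis unfolding clamped_def by (subst Cfun_inverse) simp_all
qed

lemma measurable_clamped:
  assumes k: "1 \<le> k" shows "clamped k L \<in> borel \<rightarrow>\<^sub>M (borel :: ('t, real^('q::finite \<times> bool)) cfun measure)"
proof (rule measurable_fieldI)
  note measurable_spread[OF k, measurable]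
  show "(\<lambda>f. apply_cfun (clamped k L f) t $ c) \<in> borel_measurable borel" for t and c :: "'q::finite \<times> bool"
    unfolding apply_clamped[OF k] cutoff_def by measurable
qed

lemma clamped_nonneg: "1 \<le> k \<Longrightarrow> 0 \<le> apply_cfun (clamped k L f) t $ c"
  by (simp add: apply_clamped cutoff_01)

lemma clamped_le: "1 \<le> k \<Longrightarrow> apply_cfun (clamped k L f) t $ c \<le> exp L"
proof -
  assume k: "1 \<le> k"
  have "cutoff k f t * max 0 (min (exp L) ((if snd c then 1 else -1) * apply_cfun f t $ fst c)) \<le> 1 * exp L"
    using cutoff_01[of k f t] by (intro mult_mono) auto
  then show ?thesis unfolding apply_clamped[OF k] by simp
qed

lemma cfun_diff_clamped:
  assumes k: "1 \<le> k"
  shows "apply_cfun (cfun_diff (clamped k L f)) t $ i =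
    cutoff k f t * max (- exp L) (min (exp L) (apply_cfun f t $ i))"
proof -
  have *: "max 0 (min E x) - max 0 (min E (- x)) = max (- E) (min E x)" if "0 < E" for E x :: real
    using that by (auto simp: max_def min_def)
  have "apply_cfun (cfun_diff (clamped k L f)) t $ i = cutoff k f t *
      (max 0 (min (exp L) (apply_cfun f t $ i)) - max 0 (min (exp L) (- (apply_cfun f t $ i))))"
    by (simp add: apply_clamped[OF k] right_diff_distrib)
  then show ?thesis by (simp only: *[OF exp_gt_zero])
qed

text \<open>Truncation shrinks a path pointwise, hence never moves it into a window. This later
  gives a dominating function that is the same for all levels and scales.\<close>

lemma abs_cfun_diff_clamped:
  assumes k: "1 \<le> k"
  shows "\<bar>apply_cfun (cfun_diff (clamped k L f)) t $ i\<bar> \<le> \<bar>apply_cfun f t $ i\<bar>"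
    "\<bar>apply_cfun (cfun_diff (clamped k L f)) t $ i\<bar> \<le> exp L"
proof -
  let ?x = "max (- exp L) (min (exp L) (apply_cfun f t $ i))"
  have "\<bar>cutoff k f t * ?x\<bar> \<le> \<bar>?x\<bar>"
    using cutoff_01[of k f t] by (simp add: abs_mult mult_left_le_one_le)
  moreover have "0 < exp L" by simp
  then have "\<bar>?x\<bar> \<le> \<bar>apply_cfun f t $ i\<bar>" "\<bar>?x\<bar> \<le> exp L" by (auto simp: max_def min_def)
  ultimately show "\<bar>apply_cfun (cfun_diff (clamped k L f)) t $ i\<bar> \<le> \<bar>apply_cfun f t $ i\<bar>"
    "\<bar>apply_cfun (cfun_diff (clamped k L f)) t $ i\<bar> \<le> exp L"
    unfolding cfun_diff_clamped[OF k] by linarith+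
qed

text \<open>Visibility is judged from \<open>t\<close> itself, through \<open>t + K k\<close>, and
  not on one fixed compact set; therefore truncation commutes with shifts.\<close>

lemma clamped_shift:
  assumes k: "1 \<le> k" shows "clamped k L (shift h f) = shift h (clamped k L f)"
proof -
  have "spread k (shift h f) t i = spread k f (t - h) i" for t i
    by (simp add: spread_def algebra_simps)
  then show ?thesis
    by (intro cfun_eqI) (simp add: vec_eq_iff apply_clamped[OF k] cutoff_def)
qed

lemma sum_index:
  obtains m where "1 \<le> m" "\<And>t s. t \<in> K k \<Longrightarrow> s \<in> K n \<Longrightarrow> 1 \<le> k \<Longrightarrow> 1 \<le> n \<Longrightarrow> t + s \<in> K m"
proof (cases "1 \<le> k \<and> 1 \<le> n")
  case True
  have "compact ((\<lambda>p. fst p + snd p) ` (K k \<times> K n))"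
    using True by (intro compact_continuous_image continuous_intros compact_Times compact_K) auto
  then obtain m where "1 \<le> m" "(\<lambda>p. fst p + snd p) ` (K k \<times> K n) \<subseteq> K m"
    using compact_subset_K by blast
  then show ?thesis using that[of m] by force
next
  case False
  then show ?thesis using that[of 1] by auto
qed

end

section \<open>The law of one level\<close>

context tail_measure
begin

text \<open>A path that is not discarded at some \<open>t \<in> K k\<close> has every component
  above 1 somewhere on \<open>t + K k\<close>, hence on \<open>K m\<close>, so it lies in the window
  that appears in the approximation. The pair \<open>R\<close>, \<open>rest\<close> describes the
  points not seen in \<open>K k\<close>.\<close>

lemma level_field:
  assumes k: "1 \<le> k" and m: "1 \<le> m" "\<And>t s. t \<in> K k \<Longrightarrow> s \<in> K k \<Longrightarrow> t + s \<in> K m" and \<delta>: "0 < \<delta>"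
  defines "\<mu> \<equiv> \<delta> * measure \<nu> (window K (\<chi> i. m) 1)"
  shows "\<exists>(Q :: ('t, real^'q) cfun measure) (R :: (nat \<Rightarrow> nat \<times> (nat \<Rightarrow> ('t, real^'q) cfun)) measure) rest.
    prob_space Q \<and> sets Q = sets borel \<and> (\<forall>h. distr Q borel (shift h) = Q) \<and>
    (AE h in Q. \<forall>t i. \<bar>apply_cfun h t $ i\<bar> \<le> exp L) \<and>
    prob_space R \<and> rest \<in> borel_measurable R \<and> (\<forall>\<omega>. \<forall>t\<in>K k. apply_cfun (rest \<omega>) t = 0) \<and>
    (\<forall>\<omega> t c. 0 \<le> apply_cfun (rest \<omega>) t $ c \<and> apply_cfun (rest \<omega>) t $ c \<le> exp L) \<and>
    (\<forall>F b. F \<in> borel_measurable borel \<longrightarrow> 0 \<le> b \<longrightarrow>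
      (\<forall>h. (\<forall>t i. \<bar>apply_cfun h t $ i\<bar> \<le> exp L) \<longrightarrow> \<bar>F h\<bar> \<le> b) \<longrightarrow>
      (\<forall>h. (\<forall>t\<in>K k. apply_cfun h t = 0) \<longrightarrow> F h = 0) \<longrightarrow>
      \<bar>(\<integral>h. F h \<partial>Q) - exp (- \<mu>) * \<delta> * (\<integral>f. indicator (window K (\<chi> i. m) 1) f *
         (\<integral>\<omega>. F (cfun_diff (cfun_max (clamped k L f) (rest \<omega>))) \<partial>R) \<partial>\<nu>)\<bar> \<le> b * \<mu>\<^sup>2)"
proof -
  have "\<exists>m'. \<forall>n. 1 \<le> m' n \<and> (\<forall>t\<in>K (k + n). \<forall>s\<in>K k. t + s \<in> K (m' n))"
  proof (rule choice, rule allI)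
    fix n
    obtain m' where "1 \<le> m'" "\<And>t s. t \<in> K (k + n) \<Longrightarrow> s \<in> K k \<Longrightarrow> 1 \<le> k + n \<Longrightarrow> 1 \<le> k \<Longrightarrow> t + s \<in> K m'"
      using sum_index by blast
    then show "\<exists>m'. 1 \<le> m' \<and> (\<forall>t\<in>K (k + n). \<forall>s\<in>K k. t + s \<in> K m')" using k by (intro exI[of _ m']) auto
  qed
  then obtain m' where m': "\<And>n. 1 \<le> m' n" "\<And>n t s. t \<in> K (k + n) \<Longrightarrow> s \<in> K k \<Longrightarrow> t + s \<in> K (m' n)"
    by blast
  \<comment> \<open>Summing the \<open>m' j\<close> makes the indices monotone in \<open>n\<close>;
    the sum is empty at \<open>n = 0\<close>, so that \<open>A 0\<close> is exactly the window of
    the statement.\<close>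
  define mm where "mm n = m + (\<Sum>j\<in>{1..n}. m' j)" for n
  have mm1: "1 \<le> mm n" for n using m(1) by (simp add: mm_def)
  have mm: "t + s \<in> K (mm n)" if "t \<in> K (k + n)" "s \<in> K k" for n t s
  proof (cases "n = 0")
    case True then show ?thesis using m(2) that by (simp add: mm_def)
  next
    case False
    then have "m' n \<le> (\<Sum>j\<in>{1..n}. m' j)" by (intro member_le_sum) auto
    then have "K (m' n) \<subseteq> K (mm n)" using m'(1) by (intro K_mono) (auto simp: mm_def)
    then show ?thesis using m'(2) that by blast
  qed
  have mm_mono: "i \<le> j \<Longrightarrow> mm i \<le> mm j" for i j
    unfolding mm_def by (intro add_left_mono sum_mono2) auto
  define A where "A n = (window K (\<chi> i. mm n) 1 :: ('t, real^'q) cfun set)" for n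
  have A0: "A 0 = window K (\<chi> i. m) 1" by (simp add: A_def mm_def)
  have one: "(1 :: real^'q) \<in> posG" by (simp add: posG_def)
  interpret P: poisson_superposition K BA k \<nu> "clamped k L" A \<delta> "exp L"
  proof unfold_locales
    show "clamped k L \<in> borel_measurable \<nu>" using measurable_clamped[OF k] measurable_cong_sets[OF sets_nu refl] by blast
    show "A n \<in> sets \<nu>" for n using mm1 by (simp add: A_def sets_window)
    show "incseq A" unfolding incseq_def A_def using mm1 mm_mono by (intro allI impI window_mono) auto
    show "emeasure \<nu> (A n) \<noteq> \<infinity>" for n
      using window_finite[of "\<chi> i. mm n" 1] mm1 one by (simp add: A_def less_top)
    show "apply_cfun (clamped k L f) t = 0" if f: "f \<notin> A n" and t: "t \<in> K (k + n)" for n f t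
    proof -
      have "cutoff k f t = 0"
      proof (rule ccontr)
        assume "cutoff k f t \<noteq> 0"
        then have "\<exists>s\<in>K k. 1 < \<bar>apply_cfun f (t + s) $ i\<bar>" for i by (rule cutoff_nonzero[OF k])
        then have "\<exists>s\<in>K (mm n). 1 < \<bar>apply_cfun f s $ i\<bar>" for i using mm[OF t] by blast
        then have "f \<in> A n" unfolding A_def by (subst window_iff) (use mm1[of n] in auto)
        with f show False by simp
      qed
      then show ?thesis by (simp add: vec_eq_iff apply_clamped[OF k])
    qed
  qed (use k \<delta> clamped_nonneg clamped_le in auto)
  interpret F: prob_space P.full_space by (rule P.prob_space_full)
  define Q where "Q = distr P.full_space borel (\<lambda>\<omega>. cfun_diff (P.full \<omega>))"
  have Qm [measurable]: "(\<lambda>\<omega>. cfun_diff (P.full \<omega>)) \<in> borel_measurable P.full_space" by measurable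
  have diff_le: "\<bar>apply_cfun (cfun_diff h) t $ i\<bar> \<le> exp L"
    if "\<And>t c. 0 \<le> apply_cfun h t $ c \<and> apply_cfun h t $ c \<le> exp L" for h :: "('t, real^('q \<times> bool)) cfun" and t i
    using that by (rule abs_cfun_diff_le)
  have stat: "distr Q borel (shift h) = Q" for h
  proof -
    have "distr P.full_space borel (\<lambda>\<omega>. shift h (P.full \<omega>)) = distr P.full_space borel P.full"
    proof (rule P.stationary[where \<theta> = "shift h"])
      show "shift h \<in> \<nu> \<rightarrow>\<^sub>M \<nu>" by measurable
      show "distr \<nu> \<nu> (shift h) = \<nu>" using distr_shift[of h] by (simp cong: distr_cong)
    qed (rule clamped_shift[OF k])
    then have "distr (distr P.full_space borel (\<lambda>\<omega>. shift h (P.full \<omega>))) borel cfun_diff = distr (distr P.full_space borel P.full) borel cfun_diff"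
      by simp
    then show ?thesis
      unfolding Q_def by (simp add: distr_distr comp_def shift_cfun_diff)
  qed
  have bound: "AE h in Q. \<forall>t i. \<bar>apply_cfun h t $ i\<bar> \<le> exp L"
  proof -
    have "closed {h :: ('t, real^'q) cfun. \<forall>t i. \<bar>apply_cfun h t $ i\<bar> \<le> exp L}"
    proof -
      have "{h :: ('t, real^'q) cfun. \<forall>t i. \<bar>apply_cfun h t $ i\<bar> \<le> exp L}
          = (\<Inter>t. \<Inter>i. {h. \<bar>apply_cfun h t $ i\<bar> \<le> exp L})" by auto
      then show ?thesis
        by (simp only:) (intro closed_INT ballI closed_Collect_le continuous_intros)
    qed
    then have "{h \<in> space borel. \<forall>t i. \<bar>apply_cfun h t $ i\<bar> \<le> exp L} \<in> sets (borel :: ('t, real^'q) cfun measure)"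
      by (simp add: borel_closed)
    then show ?thesis
      unfolding Q_def by (subst AE_distr_iff[OF Qm]) (use diff_le P.full_nonneg P.full_le in auto)
  qed
  have approx: "\<bar>(\<integral>h. F h \<partial>Q) - exp (- \<mu>) * \<delta> * (\<integral>f. indicator (window K (\<chi> i. m) 1) f *
         (\<integral>\<omega>. F (cfun_diff (cfun_max (clamped k L f) (P.rest \<omega>))) \<partial>P.rest_space) \<partial>\<nu>)\<bar> \<le> b * \<mu>\<^sup>2"
    if [measurable]: "F \<in> borel_measurable borel" and b: "0 \<le> b"
      and Fb: "\<And>h. (\<forall>t i. \<bar>apply_cfun h t $ i\<bar> \<le> exp L) \<Longrightarrow> \<bar>F h\<bar> \<le> b"
      and F0: "\<And>h. (\<forall>t\<in>K k. apply_cfun h t = 0) \<Longrightarrow> F h = 0" for F b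
  proof -
    have "(\<integral>h. F h \<partial>Q) = (\<integral>\<omega>. F (cfun_diff (P.full \<omega>)) \<partial>P.full_space)"
      unfolding Q_def by (rule integral_distr) measurable
    moreover have "F (cfun_diff (P.rest \<omega>)) = 0" for \<omega>
      by (intro F0 ballI) (simp add: P.rest_vanish vec_eq_iff)
    ultimately show ?thesis
      using P.single_point_approximation[of "\<lambda>h. F (cfun_diff h)" b] b Fb diff_le
      unfolding \<mu>_def A0 by simp
  qed
  have "prob_space Q" unfolding Q_def by (rule F.prob_space_distr) measurable
  moreover have "sets Q = sets borel" by (simp add: Q_def)
  ultimately show ?thesis
    using stat bound P.prob_space_rest P.measurable_rest P.rest_vanish P.rest_nonneg P.rest_le approx
    by (intro exI[of _ Q] exI[of _ P.rest_space] exI[of _ P.rest]) (intro conjI allI impI ballI; blast)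
qed

end

section \<open>Logarithmic scales and the contribution outside the unit cube\<close>

lemma One_vec: "One = (1 :: real^'q)"
proof (rule euclidean_eqI)
  fix b :: "real^'q" assume b: "b \<in> Basis"
  then have "(1 :: real^'q) \<bullet> b = 1" by (auto simp: Basis_vec_def inner_axis)
  then show "One \<bullet> b = 1 \<bullet> b" using b by (simp add: inner_sum_left inner_Basis)
qed

lemma emeasure_unit_cube: "emeasure lborel (cbox 0 (1 :: real^'q)) = 1" "emeasure lborel (box 0 (1 :: real^'q)) = 1"
  using emeasure_lborel_cbox[of 0 "One :: real^'q"] emeasure_lborel_box[of 0 "One :: real^'q"]
  by (simp_all add: One_vec[symmetric])

lemma AE_unit_cube: "AE v in lborel. v \<in> cbox 0 (1 :: real^'q) \<longrightarrow> v \<in> box 0 1"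
proof (rule AE_I)
  show "{v \<in> space lborel. \<not> (v \<in> cbox 0 (1 :: real^'q) \<longrightarrow> v \<in> box 0 1)} \<subseteq> cbox 0 1 - box 0 1" by auto
  show "emeasure lborel (cbox 0 1 - box 0 (1 :: real^'q)) = 0"
    using box_subset_cbox[of 0 "1 :: real^'q"]
    by (subst emeasure_Diff) (simp_all add: emeasure_unit_cube)
qed simp

text \<open>With \<open>y = - L *\<^sub>R v\<close>, the vector \<open>v\<close> measures the size
  of a path on the logarithmic scale in units of \<open>L\<close>, and scaling by
  \<open>vexp y\<close> brings that path back to unit size.\<close>

lemma lborel_dilation:
  fixes h :: "real^'q \<Rightarrow> real"
  assumes L: "0 < L" and h [measurable]: "h \<in> borel_measurable borel"
  shows "(\<integral>y. h y \<partial>lborel) = L ^ CARD('q) * (\<integral>v. h (- L *\<^sub>R v) \<partial>lborel)"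
    "integrable lborel h \<Longrightarrow> integrable lborel (\<lambda>v. h (- L *\<^sub>R v))"
proof -
  have eq: "(lborel :: (real^'q) measure) = density (distr lborel borel (\<lambda>v. - L *\<^sub>R v)) (\<lambda>_. ennreal (L ^ CARD('q)))"
    using lborel_affine[of "- L" "0 :: real^'q"] L by (simp add: ennreal_power)
  have "(\<integral>y. h y \<partial>lborel) = (\<integral>v. L ^ CARD('q) * h (- L *\<^sub>R v) \<partial>lborel)"
    using L by (subst eq) (simp add: integral_density integral_distr)
  then show "(\<integral>y. h y \<partial>lborel) = L ^ CARD('q) * (\<integral>v. h (- L *\<^sub>R v) \<partial>lborel)"
    by simp
  assume "integrable lborel h"
  then have "integrable (density (distr lborel borel (\<lambda>v. - L *\<^sub>R v)) (\<lambda>_. ennreal (L ^ CARD('q)))) h"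
    by (simp only: eq[symmetric])
  then have "integrable lborel (\<lambda>v. L ^ CARD('q) * h (- L *\<^sub>R v))"
    using L by (simp add: integrable_density integrable_distr_eq)
  then show "integrable lborel (\<lambda>v. h (- L *\<^sub>R v))"
    using L by simp
qed

text \<open>With \<open>V\<close> the mass of the window of a level, \<open>\<kappa>\<close> the logarithm of its index and \<open>L\<close> its logarithmic range,
  this bounds the density of the error made at scales \<open>v\<close> outside the unit cube.\<close>

definition outer :: "real^'q \<Rightarrow> real \<Rightarrow> real \<Rightarrow> real \<Rightarrow> real^'q \<Rightarrow> real" where
  "outer \<alpha> V \<kappa> L v = indicator (- cbox 0 1) v * indicator {v. \<forall>i. v $ i \<le> 1 + \<kappa> / L} v *
    (V * exp (\<alpha> \<bullet> (\<chi> i. min \<kappa> (L * v $ i))))"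

text \<open>Outside the cube some \<open>v $ i\<close> is negative, and \<open>L * v $ i\<close>
  drives the exponential to 0, or some \<open>v $ i\<close> exceeds 1, and the bound
  \<open>1 + \<kappa> / L\<close> eventually excludes it. Dominated convergence does the
  rest.\<close>

lemma outer_small:
  fixes \<alpha> :: "real^'q"
  assumes \<alpha>: "\<And>i. 0 < \<alpha> $ i" and V: "0 \<le> V" and \<kappa>: "0 \<le> \<kappa>" and e: "0 < e"
  shows "\<exists>L\<ge>N. 1 \<le> L \<and> integrable lborel (outer \<alpha> V \<kappa> L) \<and> (\<integral>v. outer \<alpha> V \<kappa> L v \<partial>lborel) \<le> e"
proof -
  define s where "s = (\<Sum>i\<in>UNIV. \<alpha> $ i)"
  \<comment> \<open>A majorant free of \<open>L\<close>: for \<open>1 \<le> L\<close> one has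
    \<open>min \<kappa> (L * v $ i) \<le> \<kappa> + v $ i\<close>, and the support stays inside the
    one for \<open>L = 1\<close>.\<close>
  define g where "g v = V * exp (\<kappa> * s) * (indicator (orthant (- (1 + \<kappa>))) (- 1 *\<^sub>R v) * exp (- (\<alpha> \<bullet> (- 1 *\<^sub>R v))))"
    for v :: "real^'q"
  have [measurable]: "{v :: real^'q. \<forall>i. v $ i \<le> c} \<in> sets borel" for c
  proof -
    have "{v\<in>space borel. \<forall>i\<in>UNIV. v $ i \<le> c} \<in> sets (borel :: (real^'q) measure)"
      by (intro sets.sets_Collect_countable_All' countable_finite finite) measurable
    then show ?thesis by simp
  qed
  have meas_min: "(\<lambda>v :: real^'q. \<chi> i. min \<kappa> (L * v $ i)) \<in> borel_measurable borel" for L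
    by (rule borel_measurable_vecI) simp
  have [measurable]: "outer \<alpha> V \<kappa> L \<in> borel_measurable borel" for L
    unfolding outer_def[abs_def]
    by (intro borel_measurable_times borel_measurable_indicator borel_measurable_const
        measurable_compose[OF _ borel_measurable_exp] borel_measurable_inner meas_min) measurable
  have g_int: "integrable lborel g"
    unfolding g_def
    by (intro integrable_mult_right lborel_dilation(2)[of 1] integrable_exp_orthant \<alpha>) simp_all
  have bound: "outer \<alpha> V \<kappa> L v \<le> g v" if L: "1 \<le> L" for L v
  proof (cases "\<forall>i. v $ i \<le> 1 + \<kappa> / L")
    case True
    have "\<kappa> / L \<le> \<kappa>" using L \<kappa> by (simp add: divide_le_eq mult_left_le_one_le mult_le_cancel_left1)
    then have "- (1 + \<kappa>) \<le> - v $ i" for i using True[rule_format, of i] by linarith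
    then have in_orth: "- 1 *\<^sub>R v \<in> orthant (- (1 + \<kappa>))" by (simp add: orthant_def)
    have "\<alpha> \<bullet> (\<chi> i. min \<kappa> (L * v $ i)) \<le> (\<Sum>i\<in>UNIV. \<alpha> $ i * (\<kappa> + v $ i))"
      unfolding inner_vec_def
    proof (rule sum_mono)
      fix i
      have "min \<kappa> (L * v $ i) \<le> \<kappa> + v $ i"
      proof (cases "0 \<le> v $ i")
        case True then show ?thesis by simp
      next
        case False
        then have "L * v $ i \<le> 1 * v $ i" using L by (intro mult_right_mono_neg) auto
        then show ?thesis using \<kappa> by simp
      qed
      then show "\<alpha> $ i \<bullet> (\<chi> i. min \<kappa> (L * v $ i)) $ i \<le> \<alpha> $ i * (\<kappa> + v $ i)"
        using \<alpha>[of i] by (simp add: mult_left_mono)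
    qed
    also have "\<dots> = \<kappa> * s + \<alpha> \<bullet> v"
      by (simp add: s_def inner_vec_def distrib_left sum.distrib sum_distrib_left mult.commute)
    finally have "V * exp (\<alpha> \<bullet> (\<chi> i. min \<kappa> (L * v $ i))) \<le> V * exp (\<kappa> * s + \<alpha> \<bullet> v)"
      using V by (intro mult_left_mono) auto
    also have "\<dots> = g v" using in_orth by (simp add: g_def exp_add)
    finally show ?thesis
      using V by (auto simp: outer_def g_def split: split_indicator intro: order_trans[rotated])
  next
    case False
    then show ?thesis using V by (simp add: outer_def g_def)
  qed
  have outer0: "0 \<le> outer \<alpha> V \<kappa> L v" for L v using V by (simp add: outer_def)
  have int: "integrable lborel (outer \<alpha> V \<kappa> L)" if "1 \<le> L" for L
    using bound[OF that] outer0 by (intro Bochner_Integration.integrable_bound[OF g_int]) (auto intro!: AE_I2 order_trans[OF _ abs_ge_self])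
  have "(\<lambda>n. \<integral>v. outer \<alpha> V \<kappa> (real (Suc n)) v \<partial>lborel) \<longlonglongrightarrow> (\<integral>v. (0::real) \<partial>(lborel :: (real^'q) measure))"
  proof (rule integral_dominated_convergence[OF _ _ g_int])
    show "AE v in lborel. norm (outer \<alpha> V \<kappa> (real (Suc n)) v) \<le> g v" for n
      using bound[of "real (Suc n)"] outer0 by (intro AE_I2) simp
    show "AE v in lborel. (\<lambda>n. outer \<alpha> V \<kappa> (real (Suc n)) v) \<longlonglongrightarrow> 0"
    proof (rule AE_I2)
      fix v :: "real^'q"
      consider "v \<in> cbox 0 1" | i where "v $ i < 0" | i where "1 < v $ i"
        by (metis mem_box_cart not_le zero_index one_index)
      then show "(\<lambda>n. outer \<alpha> V \<kappa> (real (Suc n)) v) \<longlonglongrightarrow> 0"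
      proof cases
        case 1
        then show ?thesis by (simp add: outer_def)
      next
        case 2
        have le: "outer \<alpha> V \<kappa> (real (Suc n)) v \<le> V * exp (\<kappa> * s) * exp ((\<alpha> $ i * v $ i) * real (Suc n))" for n
        proof -
          have "\<alpha> \<bullet> (\<chi> j. min \<kappa> (real (Suc n) * v $ j)) \<le> (\<Sum>j\<in>UNIV. \<alpha> $ j * \<kappa> + (if j = i then \<alpha> $ i * v $ i * real (Suc n) else 0))"
            unfolding inner_vec_def
          proof (rule sum_mono)
            fix j
            have "min \<kappa> (real (Suc n) * v $ j) \<le> \<kappa> + (if j = i then v $ i * real (Suc n) else 0)"
              using \<kappa> by (auto simp: mult.commute min_le_iff_disj)
            from mult_left_mono[OF this less_imp_le[OF \<alpha>[of j]]]
            show "\<alpha> $ j \<bullet> (\<chi> j. min \<kappa> (real (Suc n) * v $ j)) $ j \<le> \<alpha> $ j * \<kappa> + (if j = i then \<alpha> $ i * v $ i * real (Suc n) else 0)"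
              by (auto simp: distrib_left mult.assoc split: if_splits)
          qed
          also have "\<dots> = \<kappa> * s + (\<alpha> $ i * v $ i) * real (Suc n)"
            by (simp add: sum.distrib s_def sum_distrib_left mult.commute[of \<kappa>] sum_distrib_right)
          finally have "V * exp (\<alpha> \<bullet> (\<chi> j. min \<kappa> (real (Suc n) * v $ j))) \<le> V * exp (\<kappa> * s + (\<alpha> $ i * v $ i) * real (Suc n))"
            using V by (intro mult_left_mono) auto
          then show ?thesis
            using V by (auto simp: outer_def exp_add mult.assoc split: split_indicator intro: order_trans[rotated])
        qed
        have "filterlim (\<lambda>n. (\<alpha> $ i * v $ i) * real (Suc n)) at_bot sequentially"
          using 2 \<alpha>[of i]
          by (intro filterlim_tendsto_neg_mult_at_bot[OF tendsto_const] filterlim_compose[OF filterlim_real_sequentially filterlim_Suc])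
            (simp add: mult_pos_neg)
        from filterlim_compose[OF exp_at_bot this]
        have "(\<lambda>n. V * exp (\<kappa> * s) * exp ((\<alpha> $ i * v $ i) * real (Suc n))) \<longlonglongrightarrow> V * exp (\<kappa> * s) * 0"
          by (intro tendsto_mult tendsto_const)
        then have lim: "(\<lambda>n. V * exp (\<kappa> * s) * exp ((\<alpha> $ i * v $ i) * real (Suc n))) \<longlonglongrightarrow> 0" by simp
        show ?thesis
          by (rule tendsto_sandwich[OF always_eventually always_eventually tendsto_const lim]) (intro allI outer0 le)+
      next
        case 3
        have "(\<lambda>n. \<kappa> * inverse (real (Suc n))) \<longlonglongrightarrow> \<kappa> * 0"
          by (intro tendsto_mult tendsto_const LIMSEQ_inverse_real_of_nat)
        then have "\<forall>\<^sub>F n in sequentially. \<kappa> * inverse (real (Suc n)) < v $ i - 1"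
          using 3 by (intro order_tendstoD(2)) auto
        then have "\<forall>\<^sub>F n in sequentially. outer \<alpha> V \<kappa> (real (Suc n)) v = 0"
        proof eventually_elim
          case (elim n)
          then have "\<not> v $ i \<le> 1 + \<kappa> / real (Suc n)" by (simp add: divide_inverse)
          then have "v \<notin> {v. \<forall>i. v $ i \<le> 1 + \<kappa> / real (Suc n)}" by blast
          then show ?case by (simp add: outer_def)
        qed
        then show ?thesis by (rule tendsto_eventually)
      qed
    qed
  qed measurable
  then have "(\<lambda>n. \<integral>v. outer \<alpha> V \<kappa> (real (Suc n)) v \<partial>lborel) \<longlonglongrightarrow> 0" by simp
  from order_tendstoD(2)[OF this e] have "\<forall>\<^sub>F n in sequentially. (\<integral>v. outer \<alpha> V \<kappa> (real (Suc n)) v \<partial>lborel) < e" .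
  moreover have "\<forall>\<^sub>F n in sequentially. N \<le> real (Suc n)"
    using filterlim_compose[OF filterlim_real_sequentially filterlim_Suc] unfolding filterlim_at_top by blast
  ultimately have "\<forall>\<^sub>F n in sequentially. N \<le> real (Suc n) \<and> (\<integral>v. outer \<alpha> V \<kappa> (real (Suc n)) v \<partial>lborel) < e"
    by eventually_elim simp
  then obtain n where "N \<le> real (Suc n)" "(\<integral>v. outer \<alpha> V \<kappa> (real (Suc n)) v \<partial>lborel) < e"
    by (auto simp: eventually_sequentially)
  then show ?thesis using int[of "real (Suc n)"] by (intro exI[of _ "real (Suc n)"]) simp
qed

section \<open>Convergence of the level laws\<close>

context tail_measure
begin

text \<open>For \<open>0 < v $ i < 1\<close> both \<open>exp (v $ i * L j)\<close> and
  \<open>exp ((1 - v $ i) * L j)\<close> are unbounded: the first lifts a nonzero value of each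
  component above 2, the second leaves room below the clamp for a path bounded on
  \<open>C\<close>.\<close>

lemma truncation_exact:
  assumes v: "v \<in> box 0 1" and g: "\<And>i. \<exists>t. apply_cfun g t $ i \<noteq> 0" and C: "compact C"
    and L: "\<And>j. real (Suc j) \<le> L j"
  shows "\<forall>\<^sub>F j in sequentially. \<forall>t\<in>C.
    apply_cfun (cfun_diff (clamped (Suc j) (L j) (vexp (L j *\<^sub>R v) \<odot> g))) t = apply_cfun (vexp (L j *\<^sub>R v) \<odot> g) t"
proof -
  have v01: "0 < v $ i" "v $ i < 1" for i using v by (auto simp: mem_box_cart)
  have L_top: "filterlim L at_top sequentially"
    by (rule filterlim_at_top_mono[OF filterlim_compose[OF filterlim_real_sequentially filterlim_Suc]]) (use L in simp)
  from g obtain t where t: "\<And>i. apply_cfun g (t i) $ i \<noteq> 0" by metis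
  have "\<forall>\<^sub>F j in sequentially. (\<forall>s\<in>C. \<exists>r\<in>K (Suc j). 2 < \<bar>apply_cfun (vexp (L j *\<^sub>R v) \<odot> g) (s + r) $ i\<bar>) \<and>
      (\<forall>s\<in>C. \<bar>apply_cfun (vexp (L j *\<^sub>R v) \<odot> g) s $ i\<bar> \<le> exp (L j))" for i
  proof -
    have "compact ((\<lambda>s. t i - s) ` C)"
      by (intro compact_continuous_image continuous_intros C)
    then obtain n where n: "1 \<le> n" "(\<lambda>s. t i - s) ` C \<subseteq> K n" by (rule compact_subset_K)
    have "bounded ((\<lambda>s. apply_cfun g s $ i) ` C)"
      by (intro compact_imp_bounded compact_continuous_image C continuous_on_subset[OF continuous_cfun_nth]) auto
    then obtain a where a: "\<And>s. s \<in> C \<Longrightarrow> \<bar>apply_cfun g s $ i\<bar> \<le> a" by (auto simp: bounded_iff)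
    have "filterlim (\<lambda>j. v $ i * L j) at_top sequentially" "filterlim (\<lambda>j. (1 - v $ i) * L j) at_top sequentially"
      using v01 by (auto intro!: filterlim_tendsto_pos_mult_at_top[OF tendsto_const] L_top)
    from filterlim_compose[OF exp_at_top this(1)] filterlim_compose[OF exp_at_top this(2)]
    have "\<forall>\<^sub>F j in sequentially. 2 / \<bar>apply_cfun g (t i) $ i\<bar> < exp (v $ i * L j)"
      "\<forall>\<^sub>F j in sequentially. a \<le> exp ((1 - v $ i) * L j)"
      unfolding filterlim_at_top_dense[of "\<lambda>j. exp (v $ i * L j)"] filterlim_at_top[of "\<lambda>j. exp ((1 - v $ i) * L j)"]
      by simp_all
    then show ?thesis using eventually_ge_at_top[of n]
    proof eventually_elim
      case (elim j)
      have "2 < \<bar>apply_cfun (vexp (L j *\<^sub>R v) \<odot> g) (t i) $ i\<bar>"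
        using elim(1) t[of i] by (simp add: abs_mult pos_divide_less_eq mult.commute)
      moreover have "t i - s \<in> K (Suc j)" if "s \<in> C" for s
        using n elim(3) that K_mono[of n "Suc j"] by auto
      ultimately have "\<exists>r\<in>K (Suc j). 2 < \<bar>apply_cfun (vexp (L j *\<^sub>R v) \<odot> g) (s + r) $ i\<bar>" if "s \<in> C" for s
        using that by (intro bexI[of _ "t i - s"]) simp_all
      moreover have "\<bar>apply_cfun (vexp (L j *\<^sub>R v) \<odot> g) s $ i\<bar> \<le> exp (L j)" if "s \<in> C" for s
      proof -
        have "exp (L j * v $ i) * \<bar>apply_cfun g s $ i\<bar> \<le> exp (L j * v $ i) * exp ((1 - v $ i) * L j)"
          using a[OF that] elim(2) by (intro mult_left_mono) auto
        also have "\<dots> = exp (L j)" by (simp add: exp_add[symmetric] algebra_simps)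
        finally show ?thesis by (simp add: abs_mult)
      qed
      ultimately show ?case by blast
    qed
  qed
  then have "\<forall>\<^sub>F j in sequentially. \<forall>i\<in>UNIV. (\<forall>s\<in>C. \<exists>r\<in>K (Suc j). 2 < \<bar>apply_cfun (vexp (L j *\<^sub>R v) \<odot> g) (s + r) $ i\<bar>) \<and>
      (\<forall>s\<in>C. \<bar>apply_cfun (vexp (L j *\<^sub>R v) \<odot> g) s $ i\<bar> \<le> exp (L j))"
    by (intro eventually_ball_finite) auto
  then show ?thesis
  proof eventually_elim
    case (elim j)
    show ?case
    proof
      fix s assume s: "s \<in> C"
      have "cutoff (Suc j) (vexp (L j *\<^sub>R v) \<odot> g) s = 1"
        using elim s by (intro cutoff_eq_1) auto
      moreover have "max (- exp (L j)) (min (exp (L j)) (apply_cfun (vexp (L j *\<^sub>R v) \<odot> g) s $ i)) = apply_cfun (vexp (L j *\<^sub>R v) \<odot> g) s $ i" for i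
      proof -
        have "\<bar>apply_cfun (vexp (L j *\<^sub>R v) \<odot> g) s $ i\<bar> \<le> exp (L j)" using elim s by blast
        then have "- exp (L j) \<le> apply_cfun (vexp (L j *\<^sub>R v) \<odot> g) s $ i"
          "apply_cfun (vexp (L j *\<^sub>R v) \<odot> g) s $ i \<le> exp (L j)" by linarith+
        then show ?thesis by (simp only: min_absorb2 max_absorb2)
      qed
      ultimately show "apply_cfun (cfun_diff (clamped (Suc j) (L j) (vexp (L j *\<^sub>R v) \<odot> g))) s = apply_cfun (vexp (L j *\<^sub>R v) \<odot> g) s"
        unfolding vec_eq_iff by (subst cfun_diff_clamped) simp_all
    qed
  qed
qed

lemma not_windowI:
  "(\<And>i. 1 \<le> n $ i) \<Longrightarrow> (\<And>t. t \<in> K (n $ i) \<Longrightarrow> \<bar>apply_cfun f t $ i\<bar> \<le> \<epsilon> $ i) \<Longrightarrow> f \<notin> window K n \<epsilon>"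
  by (auto simp: window_iff not_less)

text \<open>Up to the factor \<open>exp (- \<mu> j)\<close> and a two-point error, the normalised
  integral of level \<open>j\<close> is the integral of \<open>cj j\<close> over the scales
  \<open>v\<close>. This density tends to the integral of \<open>F\<close> on the open unit cube and
  is dominated by \<open>outer\<close> elsewhere. Each parameter is fixed after those its bounds
  involve: \<open>m\<close>, \<open>V\<close>, \<open>L\<close>, \<open>Z\<close>, then
  \<open>\<delta>\<close>.\<close>

lemma exists_stationary_law:
  "\<exists>M :: ('t, real^'q) cfun measure. prob_space M \<and> sets M = sets borel \<and>
    (\<forall>h. distr M borel (shift h) = M) \<and> RV_Pi K \<alpha> \<nu> M (\<lambda>f. f)"
proof -
  interpret N: sigma_finite_measure \<nu> by (rule sigma_finite_nu)
  \<comment> \<open>The sum condition catches all paths visible from \<open>K (Suc j)\<close>;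
    \<open>Suc j \<le> m\<close> makes the sets \<open>K m\<close> exhaust the group as
    \<open>j\<close> grows.\<close>
  have "\<exists>m. 1 \<le> m \<and> Suc j \<le> m \<and> (\<forall>t\<in>K (Suc j). \<forall>s\<in>K (Suc j). t + s \<in> K m)" for j
  proof -
    obtain m where m: "1 \<le> m" "\<And>t s. t \<in> K (Suc j) \<Longrightarrow> s \<in> K (Suc j) \<Longrightarrow> 1 \<le> Suc j \<Longrightarrow> 1 \<le> Suc j \<Longrightarrow> t + s \<in> K m"
      using sum_index by blast
    then show ?thesis using K_mono[of m "max m (Suc j)"] by (intro exI[of _ "max m (Suc j)"]) auto
  qed
  then obtain m where m: "\<And>j. 1 \<le> m j" "\<And>j. Suc j \<le> m j" "\<And>j t s. t \<in> K (Suc j) \<Longrightarrow> s \<in> K (Suc j) \<Longrightarrow> t + s \<in> K (m j)"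
    by metis
  define W where "W j = (window K (\<chi> i. m j) 1 :: ('t, real^'q) cfun set)" for j
  have W_meas [measurable]: "W j \<in> sets borel" for j using m(1) by (simp add: W_def sets_window)
  have one: "(1 :: real^'q) \<in> posG" by (simp add: posG_def)
  have W_fin: "emeasure \<nu> (W j) < \<infinity>" for j
    using window_finite[of "\<chi> i. m j" 1] m(1) one by (simp add: W_def)
  define V where "V j = measure \<nu> (W j)" for j
  have V0: "0 \<le> V j" for j by (simp add: V_def)
  have V_eq: "emeasure \<nu> (W j) = ennreal (V j)" for j
    using W_fin[of j] by (simp add: V_def emeasure_eq_ennreal_measure less_top)
  \<comment> \<open>The height \<open>exp (- \<kappa> j) = 1 / real (Suc j)\<close> stands in for
    the height of a window not yet known; it is eventually below every fixed
    \<open>\<epsilon> $ i\<close>.\<close>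
  define \<kappa> where "\<kappa> j = ln (real (Suc j))" for j
  have kappa0: "0 \<le> \<kappa> j" for j by (simp add: \<kappa>_def)
  have exp_kappa: "exp (- \<kappa> j) = 1 / real (Suc j)" for j by (simp add: \<kappa>_def exp_minus inverse_eq_divide)
  have "\<exists>L\<ge>real (Suc j). 1 \<le> L \<and> integrable lborel (outer \<alpha> (V j) (\<kappa> j) L) \<and>
      (\<integral>v. outer \<alpha> (V j) (\<kappa> j) L v \<partial>lborel) \<le> 1 / real (Suc j)" for j
    using outer_small[of \<alpha> "V j" "\<kappa> j" "1 / real (Suc j)", OF alpha_pos V0 kappa0] by simp
  then obtain L where L: "\<And>j. real (Suc j) \<le> L j" "\<And>j. 1 \<le> L j"
      "\<And>j. integrable lborel (outer \<alpha> (V j) (\<kappa> j) (L j))"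
      "\<And>j. (\<integral>v. outer \<alpha> (V j) (\<kappa> j) (L j) v \<partial>lborel) \<le> 1 / real (Suc j)"
    by metis
  have L0: "0 < L j" for j using L(2)[of j] by simp
  \<comment> \<open>At a scale outside this orthant some component of a path bounded by
    \<open>exp (L j)\<close> is pushed below \<open>exp (- \<kappa> j)\<close> everywhere.\<close>
  define Or where "Or j = (orthant (- \<kappa> j - L j) :: (real^'q) set)" for j
  have O_meas [measurable]: "Or j \<in> sets borel" for j by (simp add: Or_def)
  have O_int: "integrable lborel (\<lambda>y. indicator (Or j) y * exp (- (\<alpha> \<bullet> y)))" for j
    unfolding Or_def by (rule integrable_exp_orthant[OF alpha_pos])
  define Z where "Z j = (\<integral>y. indicator (Or j) y * exp (- (\<alpha> \<bullet> y)) \<partial>lborel)" for j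
  have Z0: "0 \<le> Z j" for j unfolding Z_def by (intro integral_nonneg_AE) auto
  define d where "d j = L j ^ CARD('q)" for j
  have d0: "0 < d j" for j using L0 by (simp add: d_def)
  \<comment> \<open>The three summands are the three demands on \<open>\<delta> j\<close>: to be
    finite, to make \<open>\<mu> j = \<delta> j * V j\<close> small, and to make the normalised
    two-point error small, which is \<open>(\<mu> j)\<^sup>2 * Z j / (\<delta> j * d j) = \<delta> j
    * ((V j)\<^sup>2 * Z j / d j)\<close> up to a constant.\<close>
  define S where "S j = 1 + V j + (V j)\<^sup>2 * Z j / d j" for j
  have S0: "1 \<le> S j" "V j \<le> S j" "(V j)\<^sup>2 * Z j / d j \<le> S j" for j
  proof -
    have "0 \<le> (V j)\<^sup>2 * Z j / d j" using V0 Z0 d0[of j] by (intro divide_nonneg_pos mult_nonneg_nonneg) auto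
    then show "1 \<le> S j" "V j \<le> S j" "(V j)\<^sup>2 * Z j / d j \<le> S j" using V0[of j] by (auto simp: S_def)
  qed
  define \<delta> where "\<delta> j = 1 / (real (Suc j) * S j)" for j
  have delta0: "0 < \<delta> j" for j using S0(1)[of j] by (simp add: \<delta>_def zero_less_mult_iff)
  have delta_le: "\<delta> j * x \<le> 1 / real (Suc j)" if "x \<le> S j" for j x
  proof -
    have "\<delta> j * x \<le> \<delta> j * S j" using that delta0[of j] by (intro mult_left_mono) auto
    also have "\<dots> = 1 / real (Suc j)" using S0(1)[of j] by (simp add: \<delta>_def)
    finally show ?thesis .
  qed
  define \<mu> where "\<mu> j = \<delta> j * V j" for j
  have mu: "0 \<le> \<mu> j" "\<mu> j \<le> 1 / real (Suc j)" for j
    using delta_le[OF S0(2)] V0 delta0[of j] by (auto simp: \<mu>_def)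
  define P where "P j Q R rest \<longleftrightarrow>
      prob_space Q \<and> sets Q = sets borel \<and> (\<forall>h. distr Q borel (shift h) = Q) \<and>
      (AE h in Q. \<forall>t i. \<bar>apply_cfun h t $ i\<bar> \<le> exp (L j)) \<and>
      prob_space R \<and> rest \<in> borel_measurable R \<and> (\<forall>\<omega>. \<forall>t\<in>K (Suc j). apply_cfun (rest \<omega>) t = 0) \<and>
      (\<forall>\<omega> t c. 0 \<le> apply_cfun (rest \<omega>) t $ c \<and> apply_cfun (rest \<omega>) t $ c \<le> exp (L j)) \<and>
      (\<forall>F b. F \<in> borel_measurable borel \<longrightarrow> 0 \<le> b \<longrightarrow>
        (\<forall>h. (\<forall>t i. \<bar>apply_cfun h t $ i\<bar> \<le> exp (L j)) \<longrightarrow> \<bar>F h\<bar> \<le> b) \<longrightarrow>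
        (\<forall>h. (\<forall>t\<in>K (Suc j). apply_cfun h t = 0) \<longrightarrow> F h = 0) \<longrightarrow>
        \<bar>(\<integral>h. F h \<partial>Q) - exp (- \<mu> j) * \<delta> j * (\<integral>f. indicator (W j) f *
           (\<integral>\<omega>. F (cfun_diff (cfun_max (clamped (Suc j) (L j) f) (rest \<omega>))) \<partial>R) \<partial>\<nu>)\<bar> \<le> b * (\<mu> j)\<^sup>2)"
    for j and Q :: "('t, real^'q) cfun measure" and R :: "(nat \<Rightarrow> nat \<times> (nat \<Rightarrow> ('t, real^'q) cfun)) measure" and rest
  have "\<exists>Q R rest. P j Q R rest" for j
    unfolding P_def \<mu>_def V_def W_def using level_field[of "Suc j" "m j" "\<delta> j" "L j", OF _ m(1) m(3) delta0] by simp
  then obtain Q R rest where P: "\<And>j. P j (Q j) (R j) (rest j)" by metis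
  have Q: "prob_space (Q j)" "sets (Q j) = sets borel" "distr (Q j) borel (shift h) = Q j"
      "AE x in Q j. \<forall>t i. \<bar>apply_cfun x t $ i\<bar> \<le> exp (L j)" for j h
    using P[of j] unfolding P_def by blast+
  have R: "prob_space (R j)" and rest_meas [measurable]: "rest j \<in> borel_measurable (R j)"
    and rest_zero: "t \<in> K (Suc j) \<Longrightarrow> apply_cfun (rest j \<omega>) t = 0"
    and rest_bound: "0 \<le> apply_cfun (rest j \<omega>) t $ c'" "apply_cfun (rest j \<omega>) t $ c' \<le> exp (L j)"
    for j \<omega> t c'
    using P[of j] unfolding P_def by blast+
  have P_approx: "\<bar>(\<integral>h. F h \<partial>Q j) - exp (- \<mu> j) * \<delta> j * (\<integral>f. indicator (W j) f *
           (\<integral>\<omega>. F (cfun_diff (cfun_max (clamped (Suc j) (L j) f) (rest j \<omega>))) \<partial>R j) \<partial>\<nu>)\<bar> \<le> b * (\<mu> j)\<^sup>2"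
    if "F \<in> borel_measurable borel" "0 \<le> b" "\<And>h. (\<And>t i. \<bar>apply_cfun h t $ i\<bar> \<le> exp (L j)) \<Longrightarrow> \<bar>F h\<bar> \<le> b"
      "\<And>h. (\<And>t. t \<in> K (Suc j) \<Longrightarrow> apply_cfun h t = 0) \<Longrightarrow> F h = 0" for j F b
    using P[of j] that unfolding P_def by blast
  define path where "path j f \<omega> = cfun_diff (cfun_max (clamped (Suc j) (L j) f) (rest j \<omega>))" for j f \<omega>
  have clamped_meas [measurable]: "clamped (Suc j) (L j) \<in> borel \<rightarrow>\<^sub>M borel" for j
    by (rule measurable_clamped) simp
  have path_le: "\<bar>apply_cfun (path j f \<omega>) t $ i\<bar> \<le> exp (L j)" for j f \<omega> t i
    unfolding path_def
    by (rule abs_cfun_diff_le) (simp add: le_max_iff_disj clamped_nonneg clamped_le rest_bound)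
  have path_eq: "apply_cfun (path j f \<omega>) t = apply_cfun (cfun_diff (clamped (Suc j) (L j) f)) t"
    if "t \<in> K (Suc j)" for j f \<omega> t
    using clamped_nonneg[of "Suc j" "L j" f t] that
    by (simp add: path_def vec_eq_iff rest_zero max_absorb1)
  \<comment> \<open>The weight \<open>1 / (\<delta> j * d j)\<close> undoes the thinning of the
    points and the volume of the cube of scales.\<close>
  have lim: "(\<lambda>j. (1 / (\<delta> j * d j)) * (\<integral>y. exp (- (\<alpha> \<bullet> y)) * (\<integral>h. F (vexp y \<odot> h) \<partial>Q j) \<partial>lborel)) \<longlonglongrightarrow> (\<integral>f. F f \<partial>\<nu>)"
    if F: "continuous_on UNIV F" and b: "\<And>f. \<bar>F f\<bar> \<le> b" and n: "\<And>i. 1 \<le> n $ i" and \<epsilon>: "\<epsilon> \<in> posG"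
      and vanish: "\<And>f. f \<notin> window K n \<epsilon> \<Longrightarrow> F f = 0" for F :: "('t, real^'q) cfun \<Rightarrow> real" and n \<epsilon> b
  proof -
    have F_meas [measurable]: "F \<in> borel_measurable borel"
      using F by (rule borel_measurable_continuous_onI)
    have b0: "0 \<le> b" using order_trans[OF abs_ge_zero b] .
    have win_meas [measurable]: "window K n \<epsilon> \<in> sets borel" using n by (rule sets_window)
    have win_fin: "emeasure \<nu> (window K n \<epsilon>) < \<infinity>" using n \<epsilon> by (rule window_finite)
    define J where "J = (\<integral>f. F f \<partial>\<nu>)"
    define f where "f j y = (\<integral>h. F (vexp y \<odot> h) \<partial>Q j)" for j y
    define \<beta> where "\<beta> j y g = (\<integral>\<omega>. F (vexp y \<odot> path j g \<omega>) \<partial>R j)" for j y g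
    define Bj where "Bj j y = (\<integral>g. indicator (W j) g * \<beta> j y g \<partial>\<nu>)" for j y
    \<comment> \<open>The integrand of \<open>Bj\<close> at \<open>y = - L j *\<^sub>R v\<close>,
      evaluated at the path \<open>vexp (L j *\<^sub>R v) \<odot> g\<close> that the scale brings
      back to \<open>g\<close>.\<close>
    define G where "G j v g = indicator (W j) (vexp (L j *\<^sub>R v) \<odot> g) * \<beta> j (- L j *\<^sub>R v) (vexp (L j *\<^sub>R v) \<odot> g)" for j v g
    define cj where "cj j v = (\<integral>g. G j v g \<partial>\<nu>)" for j v
    have f_meas [measurable]: "f j \<in> borel_measurable borel" for j
    proof -
      interpret Qj: prob_space "Q j" by (rule Q(1))
      note Q(2)[measurable_cong]
      show ?thesis unfolding f_def by measurable
    qed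
    have beta_joint: "(\<lambda>x. \<beta> j (fst x) (snd x)) \<in> borel_measurable (borel \<Otimes>\<^sub>M borel)" for j
    proof -
      interpret Rj: prob_space "R j" by (rule R)
      show ?thesis unfolding \<beta>_def path_def by measurable
    qed
    have beta_meas [measurable]: "(\<lambda>g. \<beta> j y g) \<in> borel_measurable borel" for j y
      using measurable_compose[OF measurable_Pair1' beta_joint] by simp
    have beta_joint' [measurable]: "(\<lambda>(y, g). \<beta> j y g) \<in> borel_measurable (borel \<Otimes>\<^sub>M \<nu>)" for j
      using beta_joint by (simp add: case_prod_beta cong: sets_pair_measure_cong measurable_cong_sets)
    have Bj_meas [measurable]: "Bj j \<in> borel_measurable borel" for j
      unfolding Bj_def[abs_def] by (rule N.borel_measurable_lebesgue_integral) measurable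
    have beta_le: "\<bar>\<beta> j y g\<bar> \<le> b" for j y g
    proof -
      interpret Rj: prob_space "R j" by (rule R)
      have "\<bar>\<beta> j y g\<bar> \<le> (\<integral>\<omega>. b \<partial>R j)"
        unfolding \<beta>_def path_def using b b0
        by (intro integral_abs_bound[THEN order_trans] integral_mono Rj.integrable_const_bound[of _ b]) auto
      then show ?thesis by (simp add: Rj.prob_space)
    qed
    \<comment> \<open>From \<open>j0\<close> on, level \<open>j\<close> sees the compact sets of the
      window of \<open>F\<close>, and \<open>exp (- \<kappa> j)\<close> lies below its
      heights.\<close>
    obtain j0 where j0: "\<And>j i. j0 \<le> j \<Longrightarrow> n $ i \<le> Suc j" "\<And>j i. j0 \<le> j \<Longrightarrow> exp (- \<kappa> j) \<le> \<epsilon> $ i"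
    proof -
      define e0 where "e0 = vmin \<epsilon>"
      have e0: "0 < e0" unfolding e0_def vmin_def using \<epsilon> by (subst Min_gr_iff) (auto simp: posG_def)
      obtain N1 where N1: "1 / e0 \<le> real N1" using real_arch_simple by blast
      show ?thesis
      proof (rule that[of "max N1 (Max (range (\<lambda>i. n $ i)))"])
        fix j i assume j: "max N1 (Max (range (\<lambda>i. n $ i))) \<le> j"
        have "n $ i \<le> Max (range (\<lambda>i. n $ i))" by (intro Max_ge) auto
        then show "n $ i \<le> Suc j" using j by linarith
        have "1 / e0 \<le> real (Suc j)" using N1 j by simp
        then have "1 / real (Suc j) \<le> e0" using e0 by (simp add: field_simps)
        then show "exp (- \<kappa> j) \<le> \<epsilon> $ i" using vmin_le[of \<epsilon> i] by (simp add: exp_kappa e0_def)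
      qed
    qed
    have Kn: "K (n $ i) \<subseteq> K (Suc j)" if "j0 \<le> j" for i j
      using K_mono[OF n j0(1)[OF that]] .
    have F_far: "F (vexp y \<odot> h) = 0"
      if j: "j0 \<le> j" and y: "y \<notin> Or j" and h: "\<And>t i. \<bar>apply_cfun h t $ i\<bar> \<le> exp (L j)" for j y h
    proof -
      obtain i where i: "y $ i < - \<kappa> j - L j" using y by (auto simp: Or_def orthant_def not_le)
      have "\<bar>apply_cfun (vexp y \<odot> h) t $ i\<bar> \<le> \<epsilon> $ i" for t
      proof -
        have "\<bar>apply_cfun (vexp y \<odot> h) t $ i\<bar> \<le> exp (y $ i) * exp (L j)"
          using h by (simp add: abs_mult)
        also have "\<dots> \<le> exp (- \<kappa> j)" using i by (simp add: exp_add[symmetric])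
        finally show ?thesis using j0(2)[OF j, of i] by linarith
      qed
      then show ?thesis by (intro vanish not_windowI n)
    qed
    have beta_far: "\<beta> j y g = 0" if "j0 \<le> j" "y \<notin> Or j" for j y g
      unfolding \<beta>_def using F_far[OF that path_le] by simp
    \<comment> \<open>\<open>F\<close> vanishes on level paths scaled by \<open>y\<close> outside
      \<open>Or j\<close>, so its bound may carry the indicator of \<open>Or j\<close>; this makes
      the two-point error integrable against the exponential density.\<close>
    have approx: "\<bar>f j y - exp (- \<mu> j) * \<delta> j * Bj j y\<bar> \<le> b * indicator (Or j) y * (\<mu> j)\<^sup>2" if j: "j0 \<le> j" for j y
      unfolding f_def Bj_def \<beta>_def path_def
    proof (rule P_approx)
      show "0 \<le> b * indicator (Or j) y" using b0 by simp
      show "\<bar>F (vexp y \<odot> h)\<bar> \<le> b * indicator (Or j) y" if "\<And>t i. \<bar>apply_cfun h t $ i\<bar> \<le> exp (L j)" for h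
        using F_far[OF j _ that, of y] b by (cases "y \<in> Or j") auto
      show "F (vexp y \<odot> h) = 0" if h: "\<And>t. t \<in> K (Suc j) \<Longrightarrow> apply_cfun h t = 0" for h
      proof (intro vanish not_windowI n)
        fix t i assume "t \<in> K (n $ i)"
        then have "t \<in> K (Suc j)" using Kn[OF j] by blast
        then show "\<bar>apply_cfun (vexp y \<odot> h) t $ i\<bar> \<le> \<epsilon> $ i" using h posGD[OF \<epsilon>, of i] by simp
      qed
    qed measurable
    have W_int: "integrable \<nu> (\<lambda>g. b * indicator (W j) g)" for j
      using W_fin by (intro integrable_mult_right integrable_real_indicator) auto
    have Bj_le: "\<bar>Bj j y\<bar> \<le> b * V j * indicator (Or j) y" if j: "j0 \<le> j" for j y
    proof (cases "y \<in> Or j")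
      case True
      have "\<bar>Bj j y\<bar> \<le> (\<integral>g. b * indicator (W j) g \<partial>\<nu>)"
        unfolding Bj_def using beta_le b0
        by (intro integral_abs_bound[THEN order_trans] integral_mono_AE' W_int) (auto split: split_indicator)
      then show ?thesis using True by (simp add: V_def)
    next
      case False
      then show ?thesis unfolding Bj_def using beta_far[OF j] by simp
    qed
    have eB_int: "integrable lborel (\<lambda>y. exp (- (\<alpha> \<bullet> y)) * Bj j y)" if j: "j0 \<le> j" for j
    proof (rule Bochner_Integration.integrable_bound[OF integrable_mult_right[OF O_int[of j], of "b * V j"]])
      show "AE y in lborel. norm (exp (- (\<alpha> \<bullet> y)) * Bj j y) \<le> norm (b * V j * (indicator (Or j) y * exp (- (\<alpha> \<bullet> y))))"
      proof (rule AE_I2)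
        fix y
        have "exp (- (\<alpha> \<bullet> y)) * \<bar>Bj j y\<bar> \<le> exp (- (\<alpha> \<bullet> y)) * (b * V j * indicator (Or j) y)"
          using Bj_le[OF j] by (intro mult_left_mono) auto
        then show "norm (exp (- (\<alpha> \<bullet> y)) * Bj j y) \<le> norm (b * V j * (indicator (Or j) y * exp (- (\<alpha> \<bullet> y))))"
          using b0 V0[of j] by (simp add: abs_mult mult_ac)
      qed
    qed measurable
    define s where "s j = (\<integral>y. exp (- (\<alpha> \<bullet> y)) * (f j y - exp (- \<mu> j) * \<delta> j * Bj j y) \<partial>lborel)" for j
    have diff_bound: "\<bar>exp (- (\<alpha> \<bullet> y)) * (f j y - exp (- \<mu> j) * \<delta> j * Bj j y)\<bar> \<le>
        b * (\<mu> j)\<^sup>2 * (indicator (Or j) y * exp (- (\<alpha> \<bullet> y)))" if j: "j0 \<le> j" for j y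
      using mult_left_mono[OF approx[OF j, of y], of "exp (- (\<alpha> \<bullet> y))"] by (simp add: abs_mult mult_ac)
    have diff_int: "integrable lborel (\<lambda>y. exp (- (\<alpha> \<bullet> y)) * (f j y - exp (- \<mu> j) * \<delta> j * Bj j y))" if j: "j0 \<le> j" for j
    proof (rule Bochner_Integration.integrable_bound[OF integrable_mult_right[OF O_int[of j], of "b * (\<mu> j)\<^sup>2"]])
      show "AE y in lborel. norm (exp (- (\<alpha> \<bullet> y)) * (f j y - exp (- \<mu> j) * \<delta> j * Bj j y))
          \<le> norm (b * (\<mu> j)\<^sup>2 * (indicator (Or j) y * exp (- (\<alpha> \<bullet> y))))"
        using diff_bound[OF j] by (intro AE_I2) (metis abs_ge_self order_trans real_norm_def)
    qed measurable
    have s_le: "\<bar>s j\<bar> \<le> b * (\<mu> j)\<^sup>2 * Z j" if j: "j0 \<le> j" for j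
    proof -
      have "\<bar>s j\<bar> \<le> (\<integral>y. b * (\<mu> j)\<^sup>2 * (indicator (Or j) y * exp (- (\<alpha> \<bullet> y))) \<partial>lborel)"
        unfolding s_def
      proof (intro integral_abs_bound[THEN order_trans] integral_mono)
        show "integrable lborel (\<lambda>y. \<bar>exp (- (\<alpha> \<bullet> y)) * (f j y - exp (- \<mu> j) * \<delta> j * Bj j y)\<bar>)"
          using diff_int[OF j] by (rule integrable_abs)
        show "integrable lborel (\<lambda>y. b * (\<mu> j)\<^sup>2 * (indicator (Or j) y * exp (- (\<alpha> \<bullet> y))))"
          by (intro integrable_mult_right O_int)
      qed (rule diff_bound[OF j])
      then show ?thesis by (simp add: Z_def)
    qed
    have f_split: "(\<integral>y. exp (- (\<alpha> \<bullet> y)) * f j y \<partial>lborel) =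
        exp (- \<mu> j) * \<delta> j * (\<integral>y. exp (- (\<alpha> \<bullet> y)) * Bj j y \<partial>lborel) + s j" if j: "j0 \<le> j" for j
    proof -
      have "(\<integral>y. exp (- (\<alpha> \<bullet> y)) * f j y \<partial>lborel) = (\<integral>y. exp (- \<mu> j) * \<delta> j * (exp (- (\<alpha> \<bullet> y)) * Bj j y) +
          exp (- (\<alpha> \<bullet> y)) * (f j y - exp (- \<mu> j) * \<delta> j * Bj j y) \<partial>lborel)"
        by (intro Bochner_Integration.integral_cong refl) (simp add: algebra_simps)
      also have "\<dots> = (\<integral>y. exp (- \<mu> j) * \<delta> j * (exp (- (\<alpha> \<bullet> y)) * Bj j y) \<partial>lborel) + s j"
        unfolding s_def
        by (intro Bochner_Integration.integral_add integrable_mult_right eB_int diff_int j)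
      finally show ?thesis by simp
    qed
    \<comment> \<open>The exponential density at \<open>y = - L j *\<^sub>R v\<close> and the
      homogeneity factor of \<nu> cancel exactly, which leaves plain Lebesgue measure in
      \<open>v\<close>.\<close>
    have cj_eq: "exp (- (\<alpha> \<bullet> (- L j *\<^sub>R v))) * Bj j (- L j *\<^sub>R v) = cj j v" for j v
    proof -
      have "Bj j (- L j *\<^sub>R v) = exp (- (\<alpha> \<bullet> (L j *\<^sub>R v))) * cj j v"
        unfolding Bj_def cj_def G_def by (rule integral_vexp) measurable
      then show ?thesis by (simp add: exp_minus)
    qed
    have cj_meas [measurable]: "cj j \<in> borel_measurable borel" for j
      unfolding cj_eq[symmetric, abs_def] by measurable
    have cj_total: "(\<integral>y. exp (- (\<alpha> \<bullet> y)) * Bj j y \<partial>lborel) = d j * (\<integral>v. cj j v \<partial>lborel)" for j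
      using lborel_dilation(1)[OF L0[of j], of "\<lambda>y. exp (- (\<alpha> \<bullet> y)) * Bj j y"] by (simp only: cj_eq d_def) measurable
    have cj_int: "integrable lborel (cj j)" if j: "j0 \<le> j" for j
      using lborel_dilation(2)[OF L0[of j] _ eB_int[OF j]] by (simp only: cj_eq) measurable
    have G_meas [measurable]: "G j v \<in> borel_measurable borel" for j v
      unfolding G_def[abs_def] by measurable
    \<comment> \<open>Truncation only shrinks \<open>vexp (L j *\<^sub>R v) \<odot> g\<close>, so
      after scaling back the path is at most \<open>g\<close> in modulus on the window of
      \<open>F\<close>. The bound is therefore uniform in \<open>j\<close> and
      \<open>v\<close>.\<close>
    have G_le: "\<bar>G j v g\<bar> \<le> b * indicator (window K n \<epsilon>) g" if j: "j0 \<le> j" for j v g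
    proof (cases "g \<in> window K n \<epsilon>")
      case True
      then show ?thesis using beta_le b0 by (auto simp: G_def split: split_indicator)
    next
      case False
      then obtain i where i: "\<And>t. t \<in> K (n $ i) \<Longrightarrow> \<bar>apply_cfun g t $ i\<bar> \<le> \<epsilon> $ i"
        by (auto simp: window_iff[OF n] not_less)
      have "F (vexp (- L j *\<^sub>R v) \<odot> path j (vexp (L j *\<^sub>R v) \<odot> g) \<omega>) = 0" for \<omega>
      proof (intro vanish not_windowI n)
        fix t assume t: "t \<in> K (n $ i)"
        then have "t \<in> K (Suc j)" using Kn[OF j] by blast
        then have "\<bar>apply_cfun (path j (vexp (L j *\<^sub>R v) \<odot> g) \<omega>) t $ i\<bar>
            = \<bar>apply_cfun (cfun_diff (clamped (Suc j) (L j) (vexp (L j *\<^sub>R v) \<odot> g))) t $ i\<bar>"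
          by (simp only: path_eq)
        also have "\<dots> \<le> \<bar>apply_cfun (vexp (L j *\<^sub>R v) \<odot> g) t $ i\<bar>"
          by (rule abs_cfun_diff_clamped(1)) simp
        also have "\<dots> = exp (L j * v $ i) * \<bar>apply_cfun g t $ i\<bar>" by (simp add: abs_mult)
        finally have "\<bar>apply_cfun (path j (vexp (L j *\<^sub>R v) \<odot> g) \<omega>) t $ i\<bar>
            \<le> exp (L j * v $ i) * \<bar>apply_cfun g t $ i\<bar>" .
        then have "exp (- (L j * v $ i)) * \<bar>apply_cfun (path j (vexp (L j *\<^sub>R v) \<odot> g) \<omega>) t $ i\<bar>
            \<le> exp (- (L j * v $ i)) * (exp (L j * v $ i) * \<bar>apply_cfun g t $ i\<bar>)"
          by (intro mult_left_mono) auto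
        also have "\<dots> = \<bar>apply_cfun g t $ i\<bar>" by (simp add: exp_minus)
        finally show "\<bar>apply_cfun (vexp (- L j *\<^sub>R v) \<odot> path j (vexp (L j *\<^sub>R v) \<odot> g) \<omega>) t $ i\<bar> \<le> \<epsilon> $ i"
          using i[OF t] by (simp add: abs_mult)
      qed
      then have "G j v g = 0" by (simp add: G_def \<beta>_def)
      then show ?thesis using False by simp
    qed
    have G_far: "G j v g = 0" if j: "j0 \<le> j" and v: "1 + \<kappa> j / L j < v $ i" for j v g i
    proof -
      have "- L j *\<^sub>R v \<notin> Or j"
      proof -
        have "L j * (1 + \<kappa> j / L j) < L j * v $ i" using v L0[of j] by simp
        then have "L j + \<kappa> j < L j * v $ i" using L0[of j] by (simp add: distrib_left)
        then show ?thesis by (auto simp: Or_def orthant_def not_le intro!: exI[of _ i])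
      qed
      then show ?thesis by (simp add: G_def beta_far[OF j])
    qed
    have win_int: "integrable \<nu> (\<lambda>g. b * indicator (window K n \<epsilon>) g)"
      using win_fin by (intro integrable_mult_right integrable_real_indicator) auto
    have cj_le: "\<bar>cj j v\<bar> \<le> b * measure \<nu> (window K n \<epsilon>)" if j: "j0 \<le> j" for j v
    proof -
      have "\<bar>cj j v\<bar> \<le> (\<integral>g. b * indicator (window K n \<epsilon>) g \<partial>\<nu>)"
        unfolding cj_def using G_le[OF j] b0
        by (intro integral_abs_bound[THEN order_trans] integral_mono_AE' win_int) auto
      then show ?thesis by simp
    qed
    \<comment> \<open>A contributing \<open>g\<close> exceeds \<open>exp (- \<kappa> j)\<close> by
      the window of \<open>F\<close> and \<open>exp (- (L j * v $ i))\<close> by \<open>W j\<close>,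
      hence in each component the larger of the two. That is a window \<open>?U\<close> over
      \<open>K (m j)\<close>, whose mass follows from \<open>window_scaling\<close>.\<close>
    have cj_outer: "\<bar>indicator (- cbox 0 1) v * cj j v\<bar> \<le> b * outer \<alpha> (V j) (\<kappa> j) (L j) v" if j: "j0 \<le> j" for j v
    proof (cases "\<forall>i. v $ i \<le> 1 + \<kappa> j / L j")
      case False
      then obtain i where "1 + \<kappa> j / L j < v $ i" by (auto simp: not_le)
      then have "G j v = (\<lambda>_. 0)" using G_far[OF j] by blast
      then have "cj j v = 0" unfolding cj_def by simp
      then show ?thesis using b0 V0[of j] by (simp add: outer_def)
    next
      case True
      define mn where "mn = (\<chi> i. min (\<kappa> j) (L j * v $ i))"
      let ?U = "window K (\<chi> i. m j) (vexp (- mn)) :: ('t, real^'q) cfun set"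
      have U_meas: "?U \<in> sets borel" using m(1) by (intro sets_window) simp
      have U_measure: "emeasure \<nu> ?U = ennreal (exp (\<alpha> \<bullet> mn) * V j)"
        using window_scaling[of "\<chi> i. m j" "vexp (- mn)"] m(1) V_eq[of j] V0[of j]
        by (simp add: W_def chi_vexp exp_minus ennreal_mult')
      have sub: "\<bar>G j v g\<bar> \<le> b * indicator ?U g" for g
      proof (cases "g \<in> window K n \<epsilon> \<and> vexp (L j *\<^sub>R v) \<odot> g \<in> W j")
        case True
        have "g \<in> ?U"
        proof (subst window_iff)
          show "\<forall>i. \<exists>t\<in>K ((\<chi> i. m j) $ i). vexp (- mn) $ i < \<bar>apply_cfun g t $ i\<bar>"
          proof
            fix i
            show "\<exists>t\<in>K ((\<chi> i. m j) $ i). vexp (- mn) $ i < \<bar>apply_cfun g t $ i\<bar>"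
            proof (cases "\<kappa> j \<le> L j * v $ i")
              case le: True
              obtain t where t: "t \<in> K (n $ i)" "\<epsilon> $ i < \<bar>apply_cfun g t $ i\<bar>"
                using True window_iff[OF n, of g \<epsilon>] by blast
              have "t \<in> K (m j)"
                using t(1) Kn[OF j, of i] K_mono[OF _ m(2), of j] by auto
              moreover have "exp (- \<kappa> j) < \<bar>apply_cfun g t $ i\<bar>" using t(2) j0(2)[OF j, of i] by linarith
              ultimately show ?thesis using le by (auto simp: mn_def)
            next
              case ge: False
              obtain t where t: "t \<in> K (m j)" "1 < \<bar>apply_cfun (vexp (L j *\<^sub>R v) \<odot> g) t $ i\<bar>"
                using True m(1)[of j] by (auto simp: W_def window_iff)
              then have "exp (- (L j * v $ i)) < \<bar>apply_cfun g t $ i\<bar>"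
                by (simp add: abs_mult exp_minus inverse_eq_divide pos_divide_less_eq mult.commute)
              then show ?thesis using ge t(1) by (auto simp: mn_def min_def)
            qed
          qed
        qed (use m(1)[of j] in simp)
        then show ?thesis using beta_le b0 by (auto simp: G_def split: split_indicator)
      next
        case False
        then have "G j v g = 0" using G_le[OF j, of v g] by (auto simp: G_def)
        then show ?thesis using b0 by simp
      qed
      have "\<bar>cj j v\<bar> \<le> (\<integral>g. b * indicator ?U g \<partial>\<nu>)"
        unfolding cj_def using sub b0 U_meas U_measure
        by (intro integral_abs_bound[THEN order_trans] integral_mono_AE' integrable_mult_right integrable_real_indicator) auto
      also have "\<dots> = b * (V j * exp (\<alpha> \<bullet> mn))"
        using U_measure V0[of j] by (simp add: measure_def mult.commute)
      finally show ?thesis using True b0 V0[of j] by (simp add: outer_def mn_def abs_mult split: split_indicator)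
    qed
    have cj_lim: "(\<lambda>j. cj (j + j0) v) \<longlonglongrightarrow> J" if v: "v \<in> box 0 1" for v
      unfolding cj_def J_def
    proof (rule integral_dominated_convergence[OF _ _ win_int])
      show "AE g in \<nu>. norm (G (j + j0) v g) \<le> b * indicator (window K n \<epsilon>) g" for j
        using G_le[of "j + j0"] by (intro AE_I2) simp
      show "AE g in \<nu>. (\<lambda>j. G (j + j0) v g) \<longlonglongrightarrow> F g"
        using AE_not_D_Pi
      proof eventually_elim
        case (elim g)
        have v01: "0 < v $ i" for i using v by (auto simp: mem_box_cart)
        have L_top: "filterlim L at_top sequentially"
          by (rule filterlim_at_top_mono[OF filterlim_compose[OF filterlim_real_sequentially filterlim_Suc]]) (use L(1) in simp)
        have inW: "\<forall>\<^sub>F j in sequentially. vexp (L j *\<^sub>R v) \<odot> g \<in> W j"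
        proof -
          from elim obtain t where t: "\<And>i. apply_cfun g (t i) $ i \<noteq> 0" by metis
          have "\<forall>\<^sub>F j in sequentially. \<exists>s\<in>K (m j). 1 < \<bar>apply_cfun (vexp (L j *\<^sub>R v) \<odot> g) s $ i\<bar>" for i
          proof -
            obtain N1 where N1: "1 \<le> N1" "{t i} \<subseteq> K N1" by (rule compact_subset_K[of "{t i}"]) auto
            have "filterlim (\<lambda>j. v $ i * L j) at_top sequentially"
              using v01 by (intro filterlim_tendsto_pos_mult_at_top[OF tendsto_const] L_top)
            from filterlim_compose[OF exp_at_top this]
            have "\<forall>\<^sub>F j in sequentially. 1 / \<bar>apply_cfun g (t i) $ i\<bar> < exp (v $ i * L j)"
              unfolding filterlim_at_top_dense by blast
            then show ?thesis using eventually_ge_at_top[of N1]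
            proof eventually_elim
              case (elim j)
              have "t i \<in> K (m j)" using N1 elim(2) m(2)[of j] K_mono[of N1 "m j"] by auto
              moreover have "1 < \<bar>apply_cfun (vexp (L j *\<^sub>R v) \<odot> g) (t i) $ i\<bar>"
                using elim(1) t[of i] by (simp add: abs_mult pos_divide_less_eq mult.commute)
              ultimately show ?case by blast
            qed
          qed
          then have "\<forall>\<^sub>F j in sequentially. \<forall>i\<in>UNIV. \<exists>s\<in>K (m j). 1 < \<bar>apply_cfun (vexp (L j *\<^sub>R v) \<odot> g) s $ i\<bar>"
            by (intro eventually_ball_finite) auto
          then show ?thesis
            by eventually_elim (use m(1) in \<open>auto simp: W_def window_iff\<close>)
        qed
        \<comment> \<open>Continuity of \<open>F\<close> at \<open>g\<close> involves only a compact
          set \<open>C\<close>. Eventually the truncated and rescaled path equals \<open>g\<close>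
          on \<open>C\<close>, whatever the remaining points do, since they are not seen in
          \<open>K (Suc j)\<close>.\<close>
        have "(\<lambda>j. G j v g) \<longlonglongrightarrow> F g"
        proof (rule LIMSEQ_I)
          fix e' :: real assume e': "0 < e'"
          define e where "e = e' / 2"
          have e: "0 < e" "e < e'" using e' by (simp_all add: e_def)
          have "open (F -` {x. \<bar>x - F g\<bar> < e})"
            by (intro open_vimage F open_Collect_less continuous_intros)
          moreover have "g \<in> F -` {x. \<bar>x - F g\<bar> < e}" using e by simp
          ultimately obtain C r where C: "compact C" "0 < r" "cfun_nbhd g C r \<subseteq> F -` {x. \<bar>x - F g\<bar> < e}"
            by (rule open_cfun_nbhdD)
          obtain l where l: "1 \<le> l" "C \<subseteq> K l" using compact_subset_K[OF C(1)] by blast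
          have "\<forall>\<^sub>F j in sequentially. \<bar>G j v g - F g\<bar> \<le> e"
            using inW truncation_exact[OF v elim[rule_format] compact_K[OF l(1)] L(1)] eventually_ge_at_top[of l]
          proof eventually_elim
            case (elim j)
            interpret Rj: prob_space "R j" by (rule R)
            have near: "\<bar>F (vexp (- L j *\<^sub>R v) \<odot> path j (vexp (L j *\<^sub>R v) \<odot> g) \<omega>) - F g\<bar> \<le> e" for \<omega>
            proof -
              have "apply_cfun (vexp (- L j *\<^sub>R v) \<odot> path j (vexp (L j *\<^sub>R v) \<odot> g) \<omega>) t = apply_cfun g t" if t: "t \<in> C" for t
              proof -
                have "t \<in> K (Suc j)" using t l elim(3) K_mono[of l "Suc j"] by auto
                then have "apply_cfun (path j (vexp (L j *\<^sub>R v) \<odot> g) \<omega>) t = apply_cfun (vexp (L j *\<^sub>R v) \<odot> g) t"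
                  using elim(2) t l(2) by (auto simp: path_eq)
                then show ?thesis by (simp add: vec_eq_iff exp_minus)
              qed
              then have "vexp (- L j *\<^sub>R v) \<odot> path j (vexp (L j *\<^sub>R v) \<odot> g) \<omega> \<in> cfun_nbhd g C r"
                using C(2) unfolding cfun_nbhd_def by (auto simp del: scale.rep_eq)
              then show ?thesis using C(3) by auto
            qed
            have "G j v g - F g = (\<integral>\<omega>. F (vexp (- L j *\<^sub>R v) \<odot> path j (vexp (L j *\<^sub>R v) \<odot> g) \<omega>) - F g \<partial>R j)"
            proof -
              have "integrable (R j) (\<lambda>\<omega>. F (vexp (- L j *\<^sub>R v) \<odot> path j (vexp (L j *\<^sub>R v) \<odot> g) \<omega>))"
                unfolding path_def using b by (intro Rj.integrable_const_bound[of _ b]) auto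
              then show ?thesis using elim(1) by (simp add: G_def \<beta>_def Rj.prob_space)
            qed
            also have "\<bar>\<dots>\<bar> \<le> (\<integral>\<omega>. e \<partial>R j)"
              using near e unfolding path_def
              by (intro integral_abs_bound[THEN order_trans] integral_mono Rj.integrable_const_bound[of _ e]) auto
            finally show ?case by (simp add: Rj.prob_space)
          qed
          then obtain no where "\<And>j. no \<le> j \<Longrightarrow> \<bar>G j v g - F g\<bar> \<le> e"
            unfolding eventually_sequentially by blast
          then have "norm (G j v g - F g) < e'" if "no \<le> j" for j
            using that e(2) by (metis le_less_trans real_norm_def)
          then show "\<exists>no. \<forall>j\<ge>no. norm (G j v g - F g) < e'" by blast
        qed
        then show ?case by (rule LIMSEQ_ignore_initial_segment)
      qed
    qed measurable
    \<comment> \<open>The scales inside the unit cube, whose volume 1 gives the limit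
      \<open>J\<close>, are separated from the others. Convergence is known on the open cube only,
      and its boundary is a null set.\<close>
    define a where "a j = (\<integral>v. indicator (cbox 0 1) v * cj j v \<partial>lborel)" for j
    define r where "r j = (\<integral>v. indicator (- cbox 0 1) v * cj j v \<partial>lborel)" for j
    have cube_fin: "integrable lborel (\<lambda>v. indicator (cbox 0 (1 :: real^'q)) v * (x :: real))" for x
      by (intro integrable_mult_left integrable_real_indicator) (simp_all add: emeasure_unit_cube)
    have a_lim: "(\<lambda>j. a (j + j0)) \<longlonglongrightarrow> J"
    proof -
      have "(\<lambda>j. a (j + j0)) \<longlonglongrightarrow> (\<integral>v. indicator (cbox 0 (1 :: real^'q)) v * J \<partial>lborel)"
        unfolding a_def
      proof (rule integral_dominated_convergence[OF _ _ cube_fin[of "b * measure \<nu> (window K n \<epsilon>)"]])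
        show "AE v in lborel. norm (indicator (cbox 0 1) v * cj (j + j0) v) \<le> indicator (cbox 0 1) v * (b * measure \<nu> (window K n \<epsilon>))" for j
          using cj_le[of "j + j0"] by (intro AE_I2) (auto split: split_indicator)
        show "AE v in lborel. (\<lambda>j. indicator (cbox 0 1) v * cj (j + j0) v) \<longlonglongrightarrow> indicator (cbox 0 1) v * J"
          using AE_unit_cube
        proof eventually_elim
          case (elim v)
          then show ?case by (cases "v \<in> cbox 0 1") (auto intro: cj_lim)
        qed
      qed measurable
      also have "(\<integral>v. indicator (cbox 0 (1 :: real^'q)) v * J \<partial>lborel) = J"
        using emeasure_unit_cube(1)[where 'q='q] by (simp add: measure_def)
      finally show ?thesis .
    qed
    have r_le: "\<bar>r j\<bar> \<le> b * (1 / real (Suc j))" if j: "j0 \<le> j" for j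
    proof -
      have "\<bar>r j\<bar> \<le> (\<integral>v. b * outer \<alpha> (V j) (\<kappa> j) (L j) v \<partial>lborel)"
        unfolding r_def using cj_outer[OF j] order_trans[OF abs_ge_zero cj_outer[OF j]]
        by (intro integral_abs_bound[THEN order_trans] integral_mono_AE' integrable_mult_right L(3)) auto
      also have "\<dots> = b * (\<integral>v. outer \<alpha> (V j) (\<kappa> j) (L j) v \<partial>lborel)" by simp
      also have "\<dots> \<le> b * (1 / real (Suc j))" by (intro mult_left_mono L(4) b0)
      finally show ?thesis .
    qed
    have cj_split: "(\<integral>v. cj j v \<partial>lborel) = a j + r j" if j: "j0 \<le> j" for j
    proof -
      have "integrable lborel (\<lambda>v. indicator (cbox 0 1) v * cj j v)" "integrable lborel (\<lambda>v. indicator (- cbox 0 1) v * cj j v)"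
        using cj_int[OF j] by (auto intro!: integrable_real_mult_indicator simp: mult.commute[of "indicator _ _"])
      from Bochner_Integration.integral_add[OF this]
      have "a j + r j = (\<integral>v. indicator (cbox 0 1) v * cj j v + indicator (- cbox 0 1) v * cj j v \<partial>lborel)"
        unfolding a_def r_def by simp
      also have "\<dots> = (\<integral>v. cj j v \<partial>lborel)"
        by (intro Bochner_Integration.integral_cong) (auto split: split_indicator)
      finally show ?thesis by simp
    qed
    have total: "(1 / (\<delta> j * d j)) * (\<integral>y. exp (- (\<alpha> \<bullet> y)) * f j y \<partial>lborel)
        = exp (- \<mu> j) * (a j + r j) + s j / (\<delta> j * d j)" if j: "j0 \<le> j" for j
      unfolding f_split[OF j] cj_total cj_split[OF j] using delta0[of j] d0[of j] by (simp add: field_simps)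
    have s_small: "\<bar>s j / (\<delta> j * d j)\<bar> \<le> b * (1 / real (Suc j))" if j: "j0 \<le> j" for j
    proof -
      have "\<bar>s j / (\<delta> j * d j)\<bar> = \<bar>s j\<bar> / (\<delta> j * d j)" using delta0[of j] d0[of j] by simp
      also have "\<dots> \<le> b * (\<mu> j)\<^sup>2 * Z j / (\<delta> j * d j)"
        using s_le[OF j] delta0[of j] d0[of j] by (intro divide_right_mono) auto
      also have "\<dots> = b * (\<delta> j * ((V j)\<^sup>2 * Z j / d j))"
        using delta0[of j] d0[of j] by (simp add: \<mu>_def power2_eq_square field_simps)
      also have "\<dots> \<le> b * (1 / real (Suc j))" by (intro mult_left_mono delta_le S0(3) b0)
      finally show ?thesis .
    qed
    have inv0: "(\<lambda>j. b * (1 / real (Suc (j + j0)))) \<longlonglongrightarrow> 0"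
      using LIMSEQ_ignore_initial_segment[OF tendsto_mult[OF tendsto_const[of b] LIMSEQ_inverse_real_of_nat], of j0]
      by (simp add: inverse_eq_divide)
    have r_lim: "(\<lambda>j. r (j + j0)) \<longlonglongrightarrow> 0"
      by (rule Lim_null_comparison[OF always_eventually inv0], intro allI)
        (simp only: real_norm_def r_le le_add2)
    have s_lim: "(\<lambda>j. s (j + j0) / (\<delta> (j + j0) * d (j + j0))) \<longlonglongrightarrow> 0"
      by (rule Lim_null_comparison[OF always_eventually inv0], intro allI)
        (simp only: real_norm_def s_small le_add2)
    have mu_lim: "(\<lambda>j. \<mu> (j + j0)) \<longlonglongrightarrow> 0"
    proof (rule Lim_null_comparison)
      show "\<forall>\<^sub>F j in sequentially. norm (\<mu> (j + j0)) \<le> 1 / real (Suc (j + j0))"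
        by (intro always_eventually allI) (simp only: real_norm_def abs_of_nonneg mu)
      show "(\<lambda>j. 1 / real (Suc (j + j0))) \<longlonglongrightarrow> 0"
        using LIMSEQ_ignore_initial_segment[OF LIMSEQ_inverse_real_of_nat, of j0] by (simp add: inverse_eq_divide)
    qed
    have "(\<lambda>j. exp (- \<mu> (j + j0)) * (a (j + j0) + r (j + j0)) + s (j + j0) / (\<delta> (j + j0) * d (j + j0)))
        \<longlonglongrightarrow> exp (- 0) * (J + 0) + 0"
      by (intro tendsto_intros mu_lim a_lim r_lim s_lim)
    then have "(\<lambda>j. exp (- \<mu> (j + j0)) * (a (j + j0) + r (j + j0)) + s (j + j0) / (\<delta> (j + j0) * d (j + j0)))
        \<longlonglongrightarrow> J" by simp
    then have "(\<lambda>j. (1 / (\<delta> (j + j0) * d (j + j0))) * (\<integral>y. exp (- (\<alpha> \<bullet> y)) * f (j + j0) y \<partial>lborel)) \<longlonglongrightarrow> J"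
      by (simp only: total[OF le_add2])
    from LIMSEQ_offset[OF this]
    show "(\<lambda>j. (1 / (\<delta> j * d j)) * (\<integral>y. exp (- (\<alpha> \<bullet> y)) * (\<integral>h. F (vexp y \<odot> h) \<partial>Q j) \<partial>lborel)) \<longlonglongrightarrow> (\<integral>f. F f \<partial>\<nu>)"
      unfolding f_def J_def .
  qed
  show ?thesis
  proof (rule mixing[of \<alpha> Q "\<lambda>j. exp (L j)" "\<lambda>j. 1 / (\<delta> j * d j)" \<nu>])
    show "0 \<le> 1 / (\<delta> j * d j)" for j using delta0[of j] d0[of j] by simp
    show "(\<lambda>j. 1 / (\<delta> j * d j) * (\<integral>y. exp (- (\<alpha> \<bullet> y)) * (\<integral>h. F (vexp y \<odot> h) \<partial>Q j) \<partial>lborel)) \<longlonglongrightarrow> (\<integral>f. F f \<partial>\<nu>)"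
      if "continuous_on UNIV F" "\<And>f. \<bar>F f\<bar> \<le> b" "\<And>i. 1 \<le> n $ i" "\<epsilon> \<in> posG" "\<And>f. f \<notin> window K n \<epsilon> \<Longrightarrow> F f = 0"
      for F n \<epsilon> b
      using that by (rule lim)
  qed (use alpha_pos Q in auto)
qed

section \<open>Stationary fields and the nonnegative version\<close>

lemma continuous_cfun_abs: "continuous_on UNIV (cfun_abs :: ('t, real^'n) cfun \<Rightarrow> _)"
proof -
  have "open (cfun_abs -` S)" if S: "open S" for S :: "('t, real^'n) cfun set"
    unfolding open_cfun_def
  proof
    fix f assume "f \<in> cfun_abs -` S"
    then obtain C e where C: "compact C" "0 < e" "cfun_nbhd (cfun_abs f) C e \<subseteq> S"
      using open_cfun_nbhdD[OF S, of "cfun_abs f"] by auto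
    have "cfun_nbhd f C e \<subseteq> cfun_abs -` S"
    proof
      fix g assume g: "g \<in> cfun_nbhd f C e"
      have "dist (apply_cfun (cfun_abs g) t) (apply_cfun (cfun_abs f) t) \<le> dist (apply_cfun g t) (apply_cfun f t)" for t
        unfolding dist_norm norm_vec_def by (intro L2_set_mono) auto
      then have "cfun_abs g \<in> cfun_nbhd (cfun_abs f) C e"
        using g le_less_trans unfolding cfun_nbhd_def by blast
      then show "g \<in> cfun_abs -` S" using C(3) by blast
    qed
    then show "\<exists>C e. compact C \<and> 0 < e \<and> cfun_nbhd f C e \<subseteq> cfun_abs -` S" using C by blast
  qed
  then show ?thesis by (simp add: continuous_on_open_vimage)
qed

text \<open>Windows depend on absolute values only, so composing an admissible test function with
  \<open>cfun_abs\<close> gives an admissible one. Absolute values commute with shifts and with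
  positive scaling, and change nothing \<nu>-almost everywhere when \<nu> is carried by nonnegative
  paths.\<close>

lemma exists_stationary_field:
  shows "\<exists>(M :: ('t, real^'q) cfun measure) X. random_field M X \<and> strictly_stationary M X \<and> RV_Pi K \<alpha> \<nu> M X"
    and "(AE f in \<nu>. nonnegative_path f) \<Longrightarrow>
      \<exists>(M :: ('t, real^'q) cfun measure) X. random_field M X \<and> strictly_stationary M X \<and> RV_Pi K \<alpha> \<nu> M X \<and>
        (\<forall>\<omega>\<in>space M. nonnegative_path (X \<omega>))"
proof -
  obtain M :: "('t, real^'q) cfun measure" where M: "prob_space M" "sets M = sets borel"
      "\<And>h. distr M borel (shift h) = M" "RV_Pi K \<alpha> \<nu> M (\<lambda>f. f)"
    using exists_stationary_law by blast
  note M(2)[measurable_cong]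
  have M_id: "distr M borel (\<lambda>f. f) = M" by (rule distr_id2) (simp add: M(2))
  have "random_field M (\<lambda>f. f)" "strictly_stationary M (\<lambda>f. f)"
    using M M_id by (auto simp: random_field_def strictly_stationary_def cong: measurable_cong_sets)
  then show "\<exists>(M :: ('t, real^'q) cfun measure) X. random_field M X \<and> strictly_stationary M X \<and> RV_Pi K \<alpha> \<nu> M X"
    using M(4) by blast
  assume nonneg: "AE f in \<nu>. nonnegative_path f"
  have "strictly_stationary M cfun_abs"
    unfolding strictly_stationary_def
  proof
    fix h
    have "shift h (cfun_abs f) = cfun_abs (shift h f)" for f :: "('t, real^'q) cfun"
      by (rule cfun_eqI) (simp add: vec_eq_iff)
    then have "distr M borel (\<lambda>f. shift h (cfun_abs f)) = distr (distr M borel (shift h)) borel cfun_abs"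
      by (subst distr_distr) (simp_all add: comp_def)
    then show "distr M borel (\<lambda>f. shift h (cfun_abs f)) = distr M borel cfun_abs" by (simp add: M(3))
  qed
  moreover have "RV_Pi K \<alpha> \<nu> M cfun_abs"
    unfolding RV_Pi_def
  proof (intro allI impI, elim conjE exE)
    fix F :: "('t, real^'q) cfun \<Rightarrow> real" and n \<epsilon>
    assume F: "continuous_on UNIV F" "bounded (range F)" and n: "\<forall>i. 1 \<le> n $ i" and \<epsilon>: "\<epsilon> \<in> posG"
      and vanish: "\<forall>f. f \<notin> window K n \<epsilon> \<longrightarrow> F f = 0"
    let ?G = "\<lambda>f. F (cfun_abs f)"
    have "continuous_on UNIV ?G"
      by (rule continuous_on_compose2[OF F(1) continuous_cfun_abs]) simp
    moreover have "bounded (range ?G)"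
      by (rule bounded_subset[OF F(2)]) auto
    moreover have "\<forall>f. f \<notin> window K n \<epsilon> \<longrightarrow> ?G f = 0"
      using vanish n by (simp add: window_iff)
    ultimately have lim: "((\<lambda>u. chi \<alpha> u * (\<integral>f. ?G (vinverse u \<odot> f) \<partial>M)) \<longlongrightarrow> (\<integral>f. ?G f \<partial>\<nu>)) at_top_min"
      using M(4) n \<epsilon> unfolding RV_Pi_def by blast
    have [measurable]: "F \<in> borel_measurable borel" using F(1) by (rule borel_measurable_continuous_onI)
    have "(\<integral>f. ?G f \<partial>\<nu>) = (\<integral>f. F f \<partial>\<nu>)"
    proof (rule integral_cong_AE)
      show "AE f in \<nu>. ?G f = F f"
        using nonneg
      proof eventually_elim
        case (elim f)
        then have "cfun_abs f = f" by (intro cfun_eqI) (simp add: vec_eq_iff nonnegative_path_def)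
        then show ?case by simp
      qed
    qed measurable
    moreover have "\<forall>\<^sub>F u :: real^'q in at_top_min. u \<in> posG"
      unfolding at_top_min_def eventually_inf_principal by simp
    then have "\<forall>\<^sub>F u in at_top_min. chi \<alpha> u * (\<integral>f. ?G (vinverse u \<odot> f) \<partial>M) = chi \<alpha> u * (\<integral>f. F (vinverse u \<odot> cfun_abs f) \<partial>M)"
    proof eventually_elim
      case (elim u)
      have "cfun_abs (vinverse u \<odot> f) = vinverse u \<odot> cfun_abs f" for f :: "('t, real^'q) cfun"
        using posGD[OF elim] by (intro cfun_eqI) (simp add: vec_eq_iff vinverse_def abs_mult abs_of_pos)
      then show ?case by simp
    qed
    ultimately show "((\<lambda>u. chi \<alpha> u * (\<integral>f. F (vinverse u \<odot> cfun_abs f) \<partial>M)) \<longlongrightarrow> (\<integral>f. F f \<partial>\<nu>)) at_top_min"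
      using Lim_transform_eventually[OF lim] by simp
  qed
  moreover have "random_field M cfun_abs" using M(1) by (simp add: random_field_def)
  moreover have "\<forall>\<omega>\<in>space M. nonnegative_path (cfun_abs \<omega>)" by (simp add: nonnegative_path_def)
  ultimately show "\<exists>(M :: ('t, real^'q) cfun measure) X. random_field M X \<and> strictly_stationary M X \<and> RV_Pi K \<alpha> \<nu> M X \<and>
        (\<forall>\<omega>\<in>space M. nonnegative_path (X \<omega>))"
    by blast
qed

end

section \<open>The two kinds of index group\<close>

lemma exhausted_group_discrete:
  fixes K :: "nat \<Rightarrow> 't::{countable, discrete_topology, topological_ab_group_add} set"
  assumes "compact_exhaustion K"
  shows "exhausted_group K (range (\<lambda>t. {t}))"
proof
  show "compact_exhaustion K" by fact
  show "topological_basis (range (\<lambda>t::'t. {t}))"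
    unfolding topological_basis_def
  proof (intro conjI allI impI ballI)
    fix S :: "'t set"
    show "\<exists>B'\<subseteq>range (\<lambda>t::'t. {t}). \<Union>B' = S"
      by (rule exI[of _ "(\<lambda>t. {t}) ` S"]) auto
  qed (auto simp: discrete_topology_class.open_discrete)
  show "countable (range (\<lambda>t::'t. {t}))" by simp
  fix t :: 't
  have "compact {t}" by simp
  then obtain n where "1 \<le> n" "{t} \<subseteq> K n" using assms unfolding compact_exhaustion_def by blast
  then show "\<exists>n\<ge>1. \<exists>U. open U \<and> t \<in> U \<and> U \<subseteq> K n"
    using discrete_topology_class.open_discrete[of "{t}"] by blast
qed

lemma cube_eq_cbox: "cube n = cbox (\<chi> i. - real n) (\<chi> i. real n)"
  by (auto simp: cube_def mem_box_cart)

lemma compact_exhaustion_cube: "compact_exhaustion (cube :: nat \<Rightarrow> (real^'m) set)"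
proof -
  have bounded_cube: "\<exists>n\<ge>1. C \<subseteq> cube n" if "bounded C" for C :: "(real^'m) set"
  proof -
    obtain a where a: "\<And>x. x \<in> C \<Longrightarrow> norm x \<le> a" using \<open>bounded C\<close> unfolding bounded_iff by blast
    obtain n where n: "a \<le> real n" using real_arch_simple by blast
    have "x \<in> cube (max 1 n)" if "x \<in> C" for x
    proof -
      have "\<bar>x $ i\<bar> \<le> real (max 1 n)" for i
        using component_le_norm_cart[of x i] a[OF that] n by linarith
      then show ?thesis by (simp add: cube_def abs_le_iff minus_le_iff)
    qed
    then show ?thesis by (intro exI[of _ "max 1 n"]) auto
  qed
  have "\<exists>n\<ge>1. x \<in> cube n" for x :: "real^'m"
    using bounded_cube[of "{x}"] by auto
  moreover have "0 \<in> (cube n :: (real^'m) set)" for n by (simp add: cube_def)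
  moreover have "cube n \<subseteq> (cube (Suc n) :: (real^'m) set)" for n
    unfolding cube_def by (auto, (smt (verit))+)
  ultimately show ?thesis
    unfolding compact_exhaustion_def
  proof (intro conjI allI impI)
    show "compact (cube n :: (real^'m) set)" for n by (simp add: cube_eq_cbox compact_cbox)
    show "(\<Union>n\<in>{1..}. cube n) = (UNIV :: (real^'m) set)"
      using \<open>\<And>x. \<exists>n\<ge>1. x \<in> cube n\<close> by (auto simp: set_eq_iff Bex_def)
    show "\<exists>n\<ge>1. C \<subseteq> cube n" if "compact C" for C :: "(real^'m) set"
      using that by (intro bounded_cube compact_imp_bounded)
  qed (use \<open>\<And>n. 0 \<in> cube n\<close> in blast)+
qed

lemma exhausted_group_cube:
  obtains BA :: "(real^'m) set set" where "exhausted_group cube BA"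
proof -
  obtain BA :: "(real^'m) set set" where BA: "countable BA" "topological_basis BA"
    using ex_countable_basis by blast
  have "exhausted_group cube BA"
  proof
    show "compact_exhaustion (cube :: nat \<Rightarrow> (real^'m) set)" by (rule compact_exhaustion_cube)
    fix t :: "real^'m"
    have "bounded (ball t 1)" by simp
    then have "compact (closure (ball t 1))" by (simp add: compact_closure)
    then obtain n where "1 \<le> n" "closure (ball t 1) \<subseteq> cube n"
      using compact_exhaustion_cube unfolding compact_exhaustion_def by blast
    then show "\<exists>n\<ge>1. \<exists>U. open U \<and> t \<in> U \<and> U \<subseteq> cube n"
      using closure_subset[of "ball t 1"] by (intro exI[of _ n] conjI exI[of _ "ball t 1"]) auto
  qed (use BA in auto)
  then show ?thesis by (rule that)
qed

theorem theorem3p12: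
  fixes \<alpha> :: "real^'q"
    and K :: "nat \<Rightarrow> 't::{countable, discrete_topology, topological_ab_group_add} set"
    and \<nu> :: "('t, real^'q) cfun measure"
    and \<nu>' :: "(real^'m, real^'q) cfun measure"
  assumes "\<forall>i. 0 < \<alpha> $ i"
  shows
    "(compact_exhaustion K \<and> multihomogeneous_tail_measure K \<alpha> \<nu> \<and> shift_invariant \<nu> \<longrightarrow>
       (\<exists>(M :: ('t, real^'q) cfun measure) X.
          random_field M X \<and> strictly_stationary M X \<and> RV_Pi K \<alpha> \<nu> M X) \<and>
       ((AE f in \<nu>. nonnegative_path f) \<longrightarrow>
        (\<exists>(M :: ('t, real^'q) cfun measure) X.
          random_field M X \<and> strictly_stationary M X \<and> RV_Pi K \<alpha> \<nu> M X \<and>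
          (\<forall>\<omega>\<in>space M. nonnegative_path (X \<omega>)))))
   \<and> (multihomogeneous_tail_measure cube \<alpha> \<nu>' \<and> shift_invariant \<nu>' \<longrightarrow>
       (\<exists>(M :: (real^'m, real^'q) cfun measure) X.
          random_field M X \<and> strictly_stationary M X \<and> RV_Pi cube \<alpha> \<nu>' M X) \<and>
       ((AE f in \<nu>'. nonnegative_path f) \<longrightarrow>
        (\<exists>(M :: (real^'m, real^'q) cfun measure) X.
          random_field M X \<and> strictly_stationary M X \<and> RV_Pi cube \<alpha> \<nu>' M X \<and>
          (\<forall>\<omega>\<in>space M. nonnegative_path (X \<omega>)))))"
proof (intro conjI[of "_ \<longrightarrow> _"] impI; elim conjE)
  assume "compact_exhaustion K" "multihomogeneous_tail_measure K \<alpha> \<nu>" "shift_invariant \<nu>"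
  then interpret tail_measure K "range (\<lambda>t. {t})" \<alpha> \<nu>
    using assms exhausted_group_discrete by (simp add: tail_measure_def tail_measure_axioms_def)
  show "(\<exists>(M :: ('t, real^'q) cfun measure) X.
          random_field M X \<and> strictly_stationary M X \<and> RV_Pi K \<alpha> \<nu> M X) \<and>
       ((AE f in \<nu>. nonnegative_path f) \<longrightarrow>
        (\<exists>(M :: ('t, real^'q) cfun measure) X.
          random_field M X \<and> strictly_stationary M X \<and> RV_Pi K \<alpha> \<nu> M X \<and>
          (\<forall>\<omega>\<in>space M. nonnegative_path (X \<omega>))))"
    using exists_stationary_field by blast
next
  assume \<nu>': "multihomogeneous_tail_measure cube \<alpha> \<nu>'" "shift_invariant \<nu>'"
  obtain BA :: "(real^'m) set set" where "exhausted_group cube BA"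
    by (rule exhausted_group_cube)
  then interpret tail_measure cube BA \<alpha> \<nu>'
    using assms \<nu>' by (simp add: tail_measure_def tail_measure_axioms_def)
  show "(\<exists>(M :: (real^'m, real^'q) cfun measure) X.
          random_field M X \<and> strictly_stationary M X \<and> RV_Pi cube \<alpha> \<nu>' M X) \<and>
       ((AE f in \<nu>'. nonnegative_path f) \<longrightarrow>
        (\<exists>(M :: (real^'m, real^'q) cfun measure) X.
          random_field M X \<and> strictly_stationary M X \<and> RV_Pi cube \<alpha> \<nu>' M X \<and>
          (\<forall>\<omega>\<in>space M. nonnegative_path (X \<omega>))))"
    using exists_stationary_field by blast
qed

end
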